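(* Let a compact Lie group $G$ act continuously and transitively on a finite set $\bar{\mathbf{x}}$, and let $F$ be a $G$-equivariant topological complex vector bundle over $\bar{\mathbf{x}}$. Let $w$ be a representation extension of $F$ and let $\bar{x}\in\bar{\mathbf{x}}$. If $\mathrm{res}^G_{G_{\bar{x}}}U$ is irreducible for each irreducible $G$-representation $U$ contained in $w$, then $\Psi_F(w)$ is simply connected.
   Context: All representations are finite-dimensional (continuous) complex representations. For $\bar{x}\in\bar{\mathbf{x}}$, $G_{\bar{x}}$ is the isotropy group and $F_{\bar{x}}$ is the fiber of $F$ over $\bar{x}$, regarded as a $G_{\bar{x}}$-representation. For vector spaces $V,W$, $\mathrm{iso}(V,W)$ is the set of all linear isomorphisms $V\to W$ (no group action considered). A pointwise clutching map with respect to $F$ is an element $\psi$ of $\prod_{(\bar{x},\bar{x}')\in\bar{\mathbf{x}}\times\bar{\mathbf{x}}}\mathrm{iso}(F_{\bar{x}},F_{\bar{x}'})$, with components $\psi(\bar{x},\bar{x}')$, such that for all $\bar{x},\bar{x}',\bar{x}''\in\bar{\mathbf{x}}$: $\psi(\bar{x},\bar{x})=\mathrm{id}_{F_{\bar{x}}}$; $\psi(\bar{x},\bar{x}')=\psi(\bar{x}',\bar{x})^{-1}$; $\psi(\bar{x},\bar{x}'')=\psi(\bar{x}',\bar{x}'')\psi(\bar{x},\bar{x}')$. The group $G$ acts on pointwise clutching maps by $(g\cdot\psi)(\bar{x},\bar{x}')\bar{u}=g\,\psi(g^{-1}\bar{x},g^{-1}\bar{x}')\,g^{-1}\bar{u}$;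 $\psi$ is equivariant if $g\cdot\psi=\psi$ for all $g\in G$. $\Psi_F$ is the set of all equivariant pointwise clutching maps with respect to $F$, with the subspace topology from the product topology. For a pointwise clutching map $\psi$, $F/\psi$ is the quotient of $F$ by $\bar{u}\sim\bar{u}' \iff \psi(\bar{x},\bar{x}')\bar{u}=\bar{u}'$ (for $\bar{u}\in F_{\bar{x}}$, $\bar{u}'\in F_{\bar{x}'}$), and $p_\psi:F\to F/\psi$ is the quotient map; $F/\psi$ has the unique vector space structure for which $p_\psi$ restricts to a linear isomorphism on each fiber. If $\psi$ is equivariant, $F/\psi$ carries a unique $G$-representation structure for which $p_\psi$ is $G$-equivariant, and $F/\psi$ denotes this representation. A complex $G$-representation $w$ is a representation extension of $F$ if $\mathrm{res}^G_{G_{\bar{x}}}w\cong F_{\bar{x}}$ as $G_{\bar{x}}$-representations for each $\bar{x}\in\bar{\mathbf{x}}$. For such $w$, $\Psi_F(w)$ is the subspace of all $\psi\in\Psi_F$ such that $F/\psi\cong w$ as $G$-representations. *)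

theory Defs
  imports
    "HOL-Analysis.Analysis"
    "HOL-Algebra.Group_Action"
    "Jordan_Normal_Form.VS_Connect"
begin

section \<open>Compact Lie groups\<close>

text \<open>
  Coordinate space is \<^const>\<open>Euclidean_space\<close> \<open>n\<close>, the functions \<open>nat \<Rightarrow> real\<close> vanishing from
  index \<open>n\<close> on, so that dimension \<open>0\<close> (finite groups) is included.
  \<open>C_k n U k f\<close>: all iterated partial derivatives of \<open>f\<close> of order at most \<open>k\<close> in the first \<open>n\<close>
  coordinates exist and are continuous on the open set \<open>U\<close>.
\<close>

primrec C_k :: "nat \<Rightarrow> (nat \<Rightarrow> real) set \<Rightarrow> nat \<Rightarrow> ((nat \<Rightarrow> real) \<Rightarrow> real) \<Rightarrow> bool" where
  "C_k n U 0 f \<longleftrightarrow> continuous_on U f"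
| "C_k n U (Suc k) f \<longleftrightarrow> continuous_on U f \<and>
     (\<forall>i<n. (\<forall>x\<in>U. (\<lambda>t. f (x(i := t))) differentiable (at (x i))) \<and>
            C_k n U k (\<lambda>x. deriv (\<lambda>t. f (x(i := t))) (x i)))"

definition C_infinity ::
  "nat \<Rightarrow> nat \<Rightarrow> (nat \<Rightarrow> real) set \<Rightarrow> ((nat \<Rightarrow> real) \<Rightarrow> nat \<Rightarrow> real) \<Rightarrow> bool" where
  "C_infinity n m U f \<longleftrightarrow> (\<forall>k. \<forall>j<m. C_k n U k (\<lambda>x. f x j))"

type_synonym 'a chart = "'a set \<times> ('a \<Rightarrow> nat \<Rightarrow> real)"

definition smooth_manifold :: "nat \<Rightarrow> 'a topology \<Rightarrow> 'a chart set \<Rightarrow> bool" where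
  "smooth_manifold n M A \<longleftrightarrow>
     Hausdorff_space M \<and> second_countable M \<and>
     \<Union> (fst ` A) = topspace M \<and>
     (\<forall>(U, \<phi>)\<in>A. openin M U \<and> openin (Euclidean_space n) (\<phi> ` U) \<and>
        homeomorphic_map (subtopology M U) (subtopology (Euclidean_space n) (\<phi> ` U)) \<phi>) \<and>
     (\<forall>(U, \<phi>)\<in>A. \<forall>(V, \<eta>)\<in>A. C_infinity n n (\<phi> ` (U \<inter> V)) (\<eta> \<circ> inv_into U \<phi>))"

definition smooth_map ::
  "nat \<Rightarrow> 'a topology \<Rightarrow> 'a chart set \<Rightarrow> nat \<Rightarrow> 'b topology \<Rightarrow> 'b chart set \<Rightarrow> ('a \<Rightarrow> 'b) \<Rightarrow> bool" where
  "smooth_map n M A m N B f \<longleftrightarrow> continuous_map M N f \<and>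
     (\<forall>(U, \<phi>)\<in>A. \<forall>(V, \<eta>)\<in>B.
        C_infinity n m (\<phi> ` {a \<in> U. f a \<in> V}) (\<eta> \<circ> f \<circ> inv_into U \<phi>))"

definition product_chart :: "nat \<Rightarrow> 'a chart \<Rightarrow> 'b chart \<Rightarrow> ('a \<times> 'b) chart" where
  "product_chart n c d =
     (fst c \<times> fst d, \<lambda>(a, b) i. if i < n then snd c a i else snd d b (i - n))"

definition product_atlas :: "nat \<Rightarrow> 'a chart set \<Rightarrow> 'b chart set \<Rightarrow> ('a \<times> 'b) chart set" where
  "product_atlas n A B = {product_chart n c d | c d. c \<in> A \<and> d \<in> B}"

definition lie_group ::
  "nat \<Rightarrow> 'g topology \<Rightarrow> 'g chart set \<Rightarrow> ('g, 'r) monoid_scheme \<Rightarrow> bool" where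
  "lie_group n TG A G \<longleftrightarrow> group G \<and> topspace TG = carrier G \<and> smooth_manifold n TG A \<and>
     smooth_map (n + n) (prod_topology TG TG) (product_atlas n A A) n TG A
       (\<lambda>(g, h). g \<otimes>\<^bsub>G\<^esub> h) \<and>
     smooth_map n TG A n TG A (\<lambda>g. inv\<^bsub>G\<^esub> g)"

definition compact_lie_group ::
  "nat \<Rightarrow> 'g topology \<Rightarrow> 'g chart set \<Rightarrow> ('g, 'r) monoid_scheme \<Rightarrow> bool" where
  "compact_lie_group n TG A G \<longleftrightarrow> lie_group n TG A G \<and> compact_space TG"

definition continuous_action ::
  "'g topology \<Rightarrow> ('g, 'r) monoid_scheme \<Rightarrow> 'x topology \<Rightarrow> ('g \<Rightarrow> 'x \<Rightarrow> 'x) \<Rightarrow> bool" where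
  "continuous_action TG G TX act \<longleftrightarrow> group_action G (topspace TX) act \<and>
     continuous_map (prod_topology TG TX) TX (\<lambda>(g, x). act g x)"

definition isotropy_group ::
  "('g, 'r) monoid_scheme \<Rightarrow> ('g \<Rightarrow> 'x \<Rightarrow> 'x) \<Rightarrow> 'x \<Rightarrow> ('g, 'r) monoid_scheme" where
  "isotropy_group G act x = G\<lparr>carrier := stabilizer G act x\<rparr>"

section \<open>Complex vector spaces and representations\<close>

definition linear_iso ::
  "(complex, 'v) module \<Rightarrow> (complex, 'w) module \<Rightarrow> ('v \<Rightarrow> 'w) \<Rightarrow> bool" where
  "linear_iso V W T \<longleftrightarrow> linear_map class_ring V W T \<and> bij_betw T (carrier V) (carrier W)"

definition iso_set :: "(complex, 'v) module \<Rightarrow> (complex, 'w) module \<Rightarrow> ('v \<Rightarrow> 'w) set" where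
  "iso_set V W = {T \<in> carrier V \<rightarrow>\<^sub>E carrier W. linear_iso V W T}"

definition Cn :: "nat \<Rightarrow> (complex, nat \<Rightarrow> complex) module" where
  "Cn n = ring.func_space class_ring {..<n}"

definition Cn_topology :: "nat \<Rightarrow> (nat \<Rightarrow> complex) topology" where
  "Cn_topology n = product_topology (\<lambda>_. euclidean) {..<n}"

text \<open>
  The standard topology of a finite-dimensional complex vector space: the one for which every
  linear isomorphism onto some \<open>Cn n\<close> is a homeomorphism.
\<close>

definition vs_topology :: "(complex, 'v) module \<Rightarrow> 'v topology" where
  "vs_topology V = topology (\<lambda>S. S \<subseteq> carrier V \<and>
     (\<forall>n h. linear_iso V (Cn n) h \<longrightarrow> openin (Cn_topology n) (h ` S)))"

lemma openin_vs_topology: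
  "openin (vs_topology V) S \<longleftrightarrow> S \<subseteq> carrier V \<and>
     (\<forall>n h. linear_iso V (Cn n) h \<longrightarrow> openin (Cn_topology n) (h ` S))"
proof -
  let ?P = "\<lambda>S. S \<subseteq> carrier V \<and> (\<forall>n h. linear_iso V (Cn n) h \<longrightarrow> openin (Cn_topology n) (h ` S))"
  have "istopology ?P"
    unfolding istopology_def
  proof (intro conjI allI impI)
    fix S T n h assume S: "?P S" and T: "?P T" and h: "linear_iso V (Cn n) h"
    have "h ` (S \<inter> T) = h ` S \<inter> h ` T"
      using S T h by (metis inj_on_image_Int linear_iso_def bij_betw_def)
    then show "openin (Cn_topology n) (h ` (S \<inter> T))"
      using S T h by auto
  next
    fix \<K> n h assume "\<forall>K\<in>\<K>. ?P K" and "linear_iso V (Cn n) h"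
    then show "openin (Cn_topology n) (h ` \<Union>\<K>)"
      unfolding image_Union by (intro openin_Union) auto
  qed blast+
  then show ?thesis
    by (simp add: vs_topology_def topology_inverse')
qed

definition representation ::
  "'g topology \<Rightarrow> ('g, 'r) monoid_scheme \<Rightarrow> (complex, 'v) module \<Rightarrow> ('g \<Rightarrow> 'v \<Rightarrow> 'v) \<Rightarrow> bool" where
  "representation TG G V \<rho> \<longleftrightarrow>
     vectorspace class_ring V \<and> vectorspace.fin_dim class_ring V \<and>
     group_action G (carrier V) \<rho> \<and>
     (\<forall>g\<in>carrier G. linear_map class_ring V V (\<rho> g)) \<and>
     continuous_map (prod_topology TG (vs_topology V)) (vs_topology V) (\<lambda>(g, v). \<rho> g v)"

text \<open>Only the values \<open>\<rho> g v\<close> for \<open>g\<close> in the carrier of \<open>G\<close> and \<open>v\<close> in the carrier of \<open>V\<close> enter the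
  following notions, so restriction to a subgroup or to an invariant subspace is expressed by
  replacing \<open>G\<close> or the carrier of \<open>V\<close> and keeping \<open>\<rho>\<close>.\<close>

definition rep_iso ::
  "('g, 'r) monoid_scheme \<Rightarrow> (complex, 'v) module \<Rightarrow> ('g \<Rightarrow> 'v \<Rightarrow> 'v) \<Rightarrow>
     (complex, 'w) module \<Rightarrow> ('g \<Rightarrow> 'w \<Rightarrow> 'w) \<Rightarrow> bool" where
  "rep_iso G V \<rho> W \<sigma> \<longleftrightarrow>
     (\<exists>T. linear_iso V W T \<and> (\<forall>g\<in>carrier G. \<forall>v\<in>carrier V. T (\<rho> g v) = \<sigma> g (T v)))"

definition invariant_subspace ::
  "('g, 'r) monoid_scheme \<Rightarrow> (complex, 'v) module \<Rightarrow> ('g \<Rightarrow> 'v \<Rightarrow> 'v) \<Rightarrow> 'v set \<Rightarrow> bool" where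
  "invariant_subspace G V \<rho> U \<longleftrightarrow>
     VectorSpace.subspace class_ring U V \<and> (\<forall>g\<in>carrier G. \<rho> g ` U \<subseteq> U)"

definition irreducible_rep ::
  "('g, 'r) monoid_scheme \<Rightarrow> (complex, 'v) module \<Rightarrow> ('g \<Rightarrow> 'v \<Rightarrow> 'v) \<Rightarrow> bool" where
  "irreducible_rep G V \<rho> \<longleftrightarrow> carrier V \<noteq> {\<zero>\<^bsub>V\<^esub>} \<and>
     (\<forall>U. invariant_subspace G V \<rho> U \<longrightarrow> U = {\<zero>\<^bsub>V\<^esub>} \<or> U = carrier V)"

section \<open>Equivariant vector bundles\<close>

text \<open>The total space carries the subspace topology of its type \<open>'e\<close>.\<close>

record ('e, 'x) vector_bundle =
  total :: "'e set"
  proj :: "'e \<Rightarrow> 'x"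
  fibre :: "'x \<Rightarrow> (complex, 'e) module"

definition complex_vector_bundle ::
  "'x topology \<Rightarrow> ('e::topological_space, 'x) vector_bundle \<Rightarrow> bool" where
  "complex_vector_bundle B F \<longleftrightarrow>
     continuous_map (top_of_set (total F)) B (proj F) \<and>
     (\<forall>x\<in>topspace B. carrier (fibre F x) = {u \<in> total F. proj F u = x} \<and>
        vectorspace class_ring (fibre F x)) \<and>
     (\<forall>x\<in>topspace B. \<exists>N n h. openin B N \<and> x \<in> N \<and>
        homeomorphic_map (top_of_set {u \<in> total F. proj F u \<in> N})
          (prod_topology (subtopology B N) (Cn_topology n)) (\<lambda>u. (proj F u, h u)) \<and>
        (\<forall>y\<in>N. linear_iso (fibre F y) (Cn n) h))"

definition equivariant_vector_bundle ::
  "'g topology \<Rightarrow> ('g, 'r) monoid_scheme \<Rightarrow> 'x topology \<Rightarrow> ('g \<Rightarrow> 'x \<Rightarrow> 'x) \<Rightarrow>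
     ('e::topological_space, 'x) vector_bundle \<Rightarrow> ('g \<Rightarrow> 'e \<Rightarrow> 'e) \<Rightarrow> bool" where
  "equivariant_vector_bundle TG G B act F \<alpha> \<longleftrightarrow>
     complex_vector_bundle B F \<and>
     continuous_action TG G B act \<and>
     continuous_action TG G (top_of_set (total F)) \<alpha> \<and>
     (\<forall>g\<in>carrier G. \<forall>u\<in>total F. proj F (\<alpha> g u) = act g (proj F u)) \<and>
     (\<forall>g\<in>carrier G. \<forall>x\<in>topspace B.
        linear_map class_ring (fibre F x) (fibre F (act g x)) (\<alpha> g))"

definition representation_extension ::
  "'g topology \<Rightarrow> ('g, 'r) monoid_scheme \<Rightarrow> 'x set \<Rightarrow> ('g \<Rightarrow> 'x \<Rightarrow> 'x) \<Rightarrow> ('e, 'x) vector_bundle \<Rightarrow>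
     ('g \<Rightarrow> 'e \<Rightarrow> 'e) \<Rightarrow> (complex, 'w) module \<Rightarrow> ('g \<Rightarrow> 'w \<Rightarrow> 'w) \<Rightarrow> bool" where
  "representation_extension TG G X act F \<alpha> W \<rho> \<longleftrightarrow> representation TG G W \<rho> \<and>
     (\<forall>x\<in>X. rep_iso (isotropy_group G act x) W \<rho> (fibre F x) \<alpha>)"

section \<open>Equivariant pointwise clutching maps\<close>

text \<open>
  Clutching maps are extensional functions, i.e. \<open>undefined\<close> outside \<open>X \<times> X\<close>, with components
  \<open>undefined\<close> outside the respective fibre. Hence the topology of the function type
  \<open>'x \<times> 'x \<Rightarrow> 'e \<Rightarrow> 'e\<close> induces on sets of clutching maps the product topology, each
  \<open>iso_set (fibre F x) (fibre F y)\<close> having the topology of pointwise convergence; as the fibres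
  are finite-dimensional, this is the usual topology on linear maps.
\<close>

definition pointwise_clutching_map ::
  "'x set \<Rightarrow> ('e, 'x) vector_bundle \<Rightarrow> ('x \<times> 'x \<Rightarrow> 'e \<Rightarrow> 'e) \<Rightarrow> bool" where
  "pointwise_clutching_map X F \<psi> \<longleftrightarrow>
     \<psi> \<in> (\<Pi>\<^sub>E (x, y)\<in>X \<times> X. iso_set (fibre F x) (fibre F y)) \<and>
     (\<forall>x\<in>X. \<psi> (x, x) = (\<lambda>u\<in>carrier (fibre F x). u)) \<and>
     (\<forall>x\<in>X. \<forall>y\<in>X. \<psi> (x, y) =
        restrict (inv_into (carrier (fibre F y)) (\<psi> (y, x))) (carrier (fibre F x))) \<and>
     (\<forall>x\<in>X. \<forall>y\<in>X. \<forall>z\<in>X. \<psi> (x, z) = compose (carrier (fibre F x)) (\<psi> (y, z)) (\<psi> (x, y)))"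

definition clutching_action ::
  "('g, 'r) monoid_scheme \<Rightarrow> 'x set \<Rightarrow> ('g \<Rightarrow> 'x \<Rightarrow> 'x) \<Rightarrow> ('e, 'x) vector_bundle \<Rightarrow> ('g \<Rightarrow> 'e \<Rightarrow> 'e) \<Rightarrow>
     'g \<Rightarrow> ('x \<times> 'x \<Rightarrow> 'e \<Rightarrow> 'e) \<Rightarrow> ('x \<times> 'x \<Rightarrow> 'e \<Rightarrow> 'e)" where
  "clutching_action G X act F \<alpha> g \<psi> =
     (\<lambda>(x, y)\<in>X \<times> X. \<lambda>u\<in>carrier (fibre F x).
        \<alpha> g (\<psi> (act (inv\<^bsub>G\<^esub> g) x, act (inv\<^bsub>G\<^esub> g) y) (\<alpha> (inv\<^bsub>G\<^esub> g) u)))"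

definition equivariant_clutching_maps ::
  "('g, 'r) monoid_scheme \<Rightarrow> 'x set \<Rightarrow> ('g \<Rightarrow> 'x \<Rightarrow> 'x) \<Rightarrow> ('e, 'x) vector_bundle \<Rightarrow> ('g \<Rightarrow> 'e \<Rightarrow> 'e) \<Rightarrow>
     ('x \<times> 'x \<Rightarrow> 'e \<Rightarrow> 'e) set" where
  "equivariant_clutching_maps G X act F \<alpha> =
     {\<psi>. pointwise_clutching_map X F \<psi> \<and>
          (\<forall>g\<in>carrier G. clutching_action G X act F \<alpha> g \<psi> = \<psi>)}"

definition clutching_rel :: "('e, 'x) vector_bundle \<Rightarrow> ('x \<times> 'x \<Rightarrow> 'e \<Rightarrow> 'e) \<Rightarrow> ('e \<times> 'e) set" where
  "clutching_rel F \<psi> =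
     {(u, v). u \<in> total F \<and> v \<in> total F \<and> \<psi> (proj F u, proj F v) u = v}"

definition quot_map :: "('e, 'x) vector_bundle \<Rightarrow> ('x \<times> 'x \<Rightarrow> 'e \<Rightarrow> 'e) \<Rightarrow> 'e \<Rightarrow> 'e set" where
  "quot_map F \<psi> u = clutching_rel F \<psi> `` {u}"

text \<open>
  The operations on the quotient are those of the fibres on representatives; the unions below are
  over sets of mutually equal equivalence classes. The fields \<open>mult\<close> and \<open>one\<close> of the
  record type are irrelevant for modules.
\<close>

definition quot_space ::
  "'x set \<Rightarrow> ('e, 'x) vector_bundle \<Rightarrow> ('x \<times> 'x \<Rightarrow> 'e \<Rightarrow> 'e) \<Rightarrow> (complex, 'e set) module" where
  "quot_space X F \<psi> =
     \<lparr>carrier = total F // clutching_rel F \<psi>,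
      mult = undefined,
      one = undefined,
      zero = (\<Union>x\<in>X. quot_map F \<psi> \<zero>\<^bsub>fibre F x\<^esub>),
      add = (\<lambda>P Q. \<Union>x\<in>X. \<Union>u\<in>P \<inter> carrier (fibre F x). \<Union>v\<in>Q \<inter> carrier (fibre F x).
               quot_map F \<psi> (u \<oplus>\<^bsub>fibre F x\<^esub> v)),
      smult = (\<lambda>c P. \<Union>u\<in>P. quot_map F \<psi> (c \<odot>\<^bsub>fibre F (proj F u)\<^esub> u))\<rparr>"

definition quot_action ::
  "('e, 'x) vector_bundle \<Rightarrow> ('g \<Rightarrow> 'e \<Rightarrow> 'e) \<Rightarrow> ('x \<times> 'x \<Rightarrow> 'e \<Rightarrow> 'e) \<Rightarrow> 'g \<Rightarrow> 'e set \<Rightarrow> 'e set" where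
  "quot_action F \<alpha> \<psi> g P = (\<Union>u\<in>P. quot_map F \<psi> (\<alpha> g u))"

lemma vectorspace_transfer:
  assumes V: "vectorspace class_ring (V :: (complex,'v) module)"
    and bij: "bij_betw f (carrier V) (carrier (W :: (complex,'w) module))"
    and add: "\<And>u v. u \<in> carrier V \<Longrightarrow> v \<in> carrier V \<Longrightarrow> f (u \<oplus>\<^bsub>V\<^esub> v) = f u \<oplus>\<^bsub>W\<^esub> f v"
    and smult: "\<And>c v. v \<in> carrier V \<Longrightarrow> f (c \<odot>\<^bsub>V\<^esub> v) = c \<odot>\<^bsub>W\<^esub> f v"
    and zero: "f \<zero>\<^bsub>V\<^esub> = \<zero>\<^bsub>W\<^esub>"
  shows "linear_iso V W f"
proof -
  interpret V: vectorspace class_ring V by (rule V)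
  have ex: "\<exists>v\<in>carrier V. w = f v" if "w \<in> carrier W" for w
    using that bij by (auto simp: bij_betw_def)
  have mem: "f v \<in> carrier W" if "v \<in> carrier V" for v
    using that bij by (auto simp: bij_betw_def)
  have "abelian_group W"
  proof (rule abelian_groupI)
    fix a b assume "a \<in> carrier W" "b \<in> carrier W"
    then obtain u v where *: "a = f u" "b = f v" "u \<in> carrier V" "v \<in> carrier V" using ex by metis
    show "a \<oplus>\<^bsub>W\<^esub> b \<in> carrier W" using * by (metis add mem V.a_closed)
    show "a \<oplus>\<^bsub>W\<^esub> b = b \<oplus>\<^bsub>W\<^esub> a" using * by (metis add V.a_comm)
    fix c assume "c \<in> carrier W"
    then obtain w where w: "c = f w" "w \<in> carrier V" using ex by metis
    show "a \<oplus>\<^bsub>W\<^esub> b \<oplus>\<^bsub>W\<^esub> c = a \<oplus>\<^bsub>W\<^esub> (b \<oplus>\<^bsub>W\<^esub> c)"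
      using * w by (metis add V.a_assoc V.a_closed)
  next
    show "\<zero>\<^bsub>W\<^esub> \<in> carrier W" using zero mem V.zero_closed by metis
  next
    fix a assume "a \<in> carrier W"
    then obtain u where *: "a = f u" "u \<in> carrier V" using ex by metis
    show "\<zero>\<^bsub>W\<^esub> \<oplus>\<^bsub>W\<^esub> a = a" using * by (metis add zero V.l_zero V.zero_closed)
    show "\<exists>y\<in>carrier W. y \<oplus>\<^bsub>W\<^esub> a = \<zero>\<^bsub>W\<^esub>"
      using * by (metis add zero mem V.l_neg V.a_inv_closed)
  qed
  then have "module class_ring W"
  proof (intro moduleI)
    show "cring (class_ring :: complex ring)" using vectorspace.axioms(1)[OF V] by (rule module.axioms(1))
    fix a b :: complex and x y assume "x \<in> carrier W" 
    then obtain u where u: "x = f u" "u \<in> carrier V" using ex by metis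
    have sc: "\<And>c w. w \<in> carrier V \<Longrightarrow> c \<odot>\<^bsub>V\<^esub> w \<in> carrier V" using V.smult_closed by simp
    show "a \<odot>\<^bsub>W\<^esub> x \<in> carrier W" using u by (metis smult mem sc)
    show "(a \<oplus>\<^bsub>class_ring\<^esub> b) \<odot>\<^bsub>W\<^esub> x = a \<odot>\<^bsub>W\<^esub> x \<oplus>\<^bsub>W\<^esub> b \<odot>\<^bsub>W\<^esub> x"
      using u V.smult_l_distr[of a b u] by (simp add: add[symmetric] smult[symmetric] sc)
    show "a \<otimes>\<^bsub>class_ring\<^esub> b \<odot>\<^bsub>W\<^esub> x = a \<odot>\<^bsub>W\<^esub> (b \<odot>\<^bsub>W\<^esub> x)"
      using u V.smult_assoc1[of a b u] by (simp add: add[symmetric] smult[symmetric] sc)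
    show "\<one>\<^bsub>class_ring\<^esub> \<odot>\<^bsub>W\<^esub> x = x" 
      using u V.smult_one[of u] by (simp add: add[symmetric] smult[symmetric] sc)
    assume "y \<in> carrier W"
    then obtain v where v: "y = f v" "v \<in> carrier V" using ex by metis
    show "a \<odot>\<^bsub>W\<^esub> (x \<oplus>\<^bsub>W\<^esub> y) = a \<odot>\<^bsub>W\<^esub> x \<oplus>\<^bsub>W\<^esub> a \<odot>\<^bsub>W\<^esub> y"
      using u v V.smult_r_distr[of a u v] by (simp add: add[symmetric] smult[symmetric] sc)
  qed auto
  then have W: "vectorspace class_ring W"
    using vectorspace.axioms(2)[OF V] by (intro vectorspace.intro)
  have "linear_map class_ring V W f"
    by (intro linear_map.intro mod_hom.intro mod_hom_axioms.intro V W
       vectorspace.axioms(1)[OF V] vectorspace.axioms(1)[OF W])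
       (auto simp: module_hom_def mem add smult)
  with bij show ?thesis by (simp add: linear_iso_def)
qed

text \<open>The vector space and representation structures on the quotient are the required ones.\<close>

lemma quot_map_linear_iso:
  assumes F: "complex_vector_bundle (discrete_topology X) F"
    and psi: "pointwise_clutching_map X F \<psi>" and x: "x \<in> X"
  shows "linear_iso (fibre F x) (quot_space X F \<psi>) (quot_map F \<psi>)"
proof -
  let ?q = "quot_map F \<psi>" and ?R = "clutching_rel F \<psi>" and ?Q = "quot_space X F \<psi>"
  have pX: "proj F u \<in> X" if "u \<in> total F" for u
    using F that by (auto simp: complex_vector_bundle_def continuous_map_def)
  have fib: "carrier (fibre F y) = {u \<in> total F. proj F u = y}" if "y \<in> X" for y
    using F that by (auto simp: complex_vector_bundle_def)
  have vs: "vectorspace class_ring (fibre F y)" if "y \<in> X" for y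
    using F that by (auto simp: complex_vector_bundle_def)
  have iso: "linear_iso (fibre F y) (fibre F z) (\<psi> (y, z))" if "y \<in> X" "z \<in> X" for y z
  proof -
    have "\<psi> \<in> (\<Pi>\<^sub>E (x, y)\<in>X \<times> X. iso_set (fibre F x) (fibre F y))"
      using psi unfolding pointwise_clutching_map_def by blast
    from PiE_mem[OF this, of "(y, z)"] that show ?thesis by (simp add: iso_set_def)
  qed
  have cl: "\<psi> (y, z) u \<in> carrier (fibre F z)" if "y \<in> X" "z \<in> X" "u \<in> carrier (fibre F y)" for y z u
    using iso[OF that(1,2)] that(3) by (auto simp: linear_iso_def bij_betw_def)
  have id: "\<psi> (y, y) u = u" if "y \<in> X" "u \<in> carrier (fibre F y)" for y u
  proof -
    have "\<psi> (y, y) = (\<lambda>u\<in>carrier (fibre F y). u)"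
      using psi that unfolding pointwise_clutching_map_def by blast
    then show ?thesis using that by simp
  qed
  have comp: "\<psi> (y, w) u = \<psi> (z, w) (\<psi> (y, z) u)" if "y \<in> X" "z \<in> X" "w \<in> X" "u \<in> carrier (fibre F y)" for y z w u
  proof -
    have "\<psi> (y, w) = compose (carrier (fibre F y)) (\<psi> (z, w)) (\<psi> (y, z))"
      using psi that unfolding pointwise_clutching_map_def by blast
    then show ?thesis using that by (simp add: compose_eq)
  qed
  have eq: "equiv (total F) ?R"
  proof (rule equivI)
    show "?R \<subseteq> total F \<times> total F" by (auto simp: clutching_rel_def)
    show "refl_on (total F) ?R" using pX fib id by (auto simp: refl_on_def clutching_rel_def)
    show "sym ?R"
    proof (rule symI)
      fix u v assume "(u, v) \<in> ?R"
      then have *: "u \<in> total F" "v \<in> total F" "\<psi> (proj F u, proj F v) u = v"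
        by (auto simp: clutching_rel_def)
      have "\<psi> (proj F v, proj F u) v = u"
        using comp[of "proj F u" "proj F v" "proj F u" u] * pX fib id by auto
      with * show "(v, u) \<in> ?R" by (auto simp: clutching_rel_def)
    qed
    show "trans ?R"
    proof (rule transI)
      fix u v w assume "(u, v) \<in> ?R" "(v, w) \<in> ?R"
      then have *: "u \<in> total F" "v \<in> total F" "w \<in> total F" "\<psi> (proj F u, proj F v) u = v" "\<psi> (proj F v, proj F w) v = w"
        by (auto simp: clutching_rel_def)
      then have "\<psi> (proj F u, proj F w) u = w"
        using comp[of "proj F u" "proj F v" "proj F w" u] pX fib by auto
      with * show "(u, w) \<in> ?R" by (auto simp: clutching_rel_def)
    qed
  qed
  have q: "?q (\<psi> (y, z) u) = ?q u" if "y \<in> X" "z \<in> X" "u \<in> carrier (fibre F y)" for y z u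
  proof -
    have "(u, \<psi> (y, z) u) \<in> ?R"
      using cl[OF that] that fib by (auto simp: clutching_rel_def)
    then show ?thesis unfolding quot_map_def using equiv_class_eq[OF eq] by metis
  qed
  have qel: "v \<in> ?q u \<longleftrightarrow> v = \<psi> (y, proj F v) u \<and> v \<in> total F" if "y \<in> X" "u \<in> carrier (fibre F y)" for y u v
    using that fib by (auto simp: quot_map_def clutching_rel_def)
  have int: "?q u \<inter> carrier (fibre F z) = {\<psi> (y, z) u}" if "y \<in> X" "z \<in> X" "u \<in> carrier (fibre F y)" for y z u
  proof (intro equalityI subsetI)
    fix v assume "v \<in> ?q u \<inter> carrier (fibre F z)"
    then have "v \<in> ?q u" "proj F v = z" using fib[OF that(2)] by auto
    then show "v \<in> {\<psi> (y, z) u}" using qel[OF that(1,3), of v] by blast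
  next
    fix v assume "v \<in> {\<psi> (y, z) u}"
    moreover have "\<psi> (y, z) u \<in> total F" "proj F (\<psi> (y, z) u) = z"
      using cl[OF that] fib[OF that(2)] by auto
    ultimately show "v \<in> ?q u \<inter> carrier (fibre F z)"
      using qel[OF that(1,3), of v] cl[OF that] by simp
  qed
  interpret Vx: vectorspace class_ring "fibre F x" using vs x .
  have sc: "c \<odot>\<^bsub>fibre F x\<^esub> u \<in> carrier (fibre F x)" if "u \<in> carrier (fibre F x)" for c u
    using Vx.smult_closed that by simp
  have ac: "u \<oplus>\<^bsub>fibre F x\<^esub> v \<in> carrier (fibre F x)"
    if "u \<in> carrier (fibre F x)" "v \<in> carrier (fibre F x)" for u v
    using Vx.a_closed that by simp
  have zc: "\<zero>\<^bsub>fibre F x\<^esub> \<in> carrier (fibre F x)"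
    using Vx.zero_closed by simp
  show ?thesis
  proof (rule vectorspace_transfer)
    show "vectorspace class_ring (fibre F x)" using vs x .
    show "bij_betw ?q (carrier (fibre F x)) (carrier ?Q)"
    proof (rule bij_betwI')
      fix u v assume uv: "u \<in> carrier (fibre F x)" "v \<in> carrier (fibre F x)"
      show "(?q u = ?q v) = (u = v)"
        using int[OF x x uv(1)] int[OF x x uv(2)] id[OF x uv(1)] id[OF x uv(2)]
        by (metis singleton_inject)
    next
      fix u assume "u \<in> carrier (fibre F x)"
      then show "?q u \<in> carrier ?Q" using x fib 
        by (auto simp: quot_space_def quot_map_def quotientI)
    next
      fix P assume "P \<in> carrier ?Q"
      then obtain u where "P = ?q u" "u \<in> total F" 
        by (auto simp: quot_space_def quot_map_def quotient_def)
      then have "P = ?q (\<psi> (proj F u, x) u)" "\<psi> (proj F u, x) u \<in> carrier (fibre F x)"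
        using q[of "proj F u" x u] cl[of "proj F u" x u] pX x fib by auto
      then show "\<exists>u\<in>carrier (fibre F x). P = ?q u" by blast
    qed
    fix u v c assume u: "u \<in> carrier (fibre F x)" 
    show "?q (c \<odot>\<^bsub>fibre F x\<^esub> u) = c \<odot>\<^bsub>?Q\<^esub> ?q u"
    proof -
      have "?q (c \<odot>\<^bsub>fibre F (proj F v)\<^esub> v) = ?q (c \<odot>\<^bsub>fibre F x\<^esub> u)" if "v \<in> ?q u" for v
      proof -
        have v: "v = \<psi> (x, proj F v) u" "proj F v \<in> X" using qel[OF x u, of v] that pX by blast+
        interpret L: linear_map class_ring "fibre F x" "fibre F (proj F v)" "\<psi> (x, proj F v)"
          using iso[OF x v(2)] by (simp add: linear_iso_def)
        have "c \<odot>\<^bsub>fibre F (proj F v)\<^esub> v = \<psi> (x, proj F v) (c \<odot>\<^bsub>fibre F x\<^esub> u)"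
          using L.T_smult[of c u] u v(1)[symmetric] by simp
        then show ?thesis using q[OF x v(2) sc[OF u], of c] by simp
      qed
      moreover have "u \<in> ?q u"
      proof -
        have "u \<in> total F" "proj F u = x" using u fib[OF x] by blast+
        then show ?thesis using qel[OF x u, of u] id[OF x u] by presburger
      qed
      ultimately have "(\<Union>v\<in>?q u. ?q (c \<odot>\<^bsub>fibre F (proj F v)\<^esub> v)) = ?q (c \<odot>\<^bsub>fibre F x\<^esub> u)"
        by blast
      then show ?thesis by (simp add: quot_space_def)
    qed
    assume v: "v \<in> carrier (fibre F x)"
    show "?q (u \<oplus>\<^bsub>fibre F x\<^esub> v) = ?q u \<oplus>\<^bsub>?Q\<^esub> ?q v"
    proof -
      have "?q (\<psi> (x, y) u \<oplus>\<^bsub>fibre F y\<^esub> \<psi> (x, y) v) = ?q (u \<oplus>\<^bsub>fibre F x\<^esub> v)" if "y \<in> X" for y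
      proof -
        interpret L: linear_map class_ring "fibre F x" "fibre F y" "\<psi> (x, y)"
          using iso[OF x that] by (simp add: linear_iso_def)
        have "\<psi> (x, y) u \<oplus>\<^bsub>fibre F y\<^esub> \<psi> (x, y) v = \<psi> (x, y) (u \<oplus>\<^bsub>fibre F x\<^esub> v)"
          using L.T_add[OF u v] by (rule sym)
        then show ?thesis by (simp only: q[OF x that ac[OF u v]])
      qed
      then have "?q u \<oplus>\<^bsub>?Q\<^esub> ?q v = (\<Union>y\<in>X. ?q (u \<oplus>\<^bsub>fibre F x\<^esub> v))"
        by (simp only: quot_space_def monoid.simps ring.simps int[OF x _ u] int[OF x _ v]
            UN_insert UN_empty Un_empty_right cong: SUP_cong)
      then show ?thesis using x by blast
    qed
  next
    have "?q \<zero>\<^bsub>fibre F y\<^esub> = ?q \<zero>\<^bsub>fibre F x\<^esub>" if "y \<in> X" for y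
    proof -
      interpret L: linear_map class_ring "fibre F x" "fibre F y" "\<psi> (x, y)"
        using iso[OF x that] by (simp add: linear_iso_def)
      show ?thesis using q[OF x that zc] by (simp only: L.T0_is_0)
    qed
    then have "(\<Union>y\<in>X. ?q \<zero>\<^bsub>fibre F y\<^esub>) = ?q \<zero>\<^bsub>fibre F x\<^esub>" using x by blast
    then show "?q \<zero>\<^bsub>fibre F x\<^esub> = \<zero>\<^bsub>?Q\<^esub>" by (simp add: quot_space_def)
  qed
qed

lemma quot_map_equivariant:
  assumes F: "equivariant_vector_bundle TG G (discrete_topology X) act F \<alpha>"
    and psi: "\<psi> \<in> equivariant_clutching_maps G X act F \<alpha>"
    and g: "g \<in> carrier G" and u: "u \<in> total F"
  shows "quot_action F \<alpha> \<psi> g (quot_map F \<psi> u) = quot_map F \<psi> (\<alpha> g u)"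
proof -
  have B: "complex_vector_bundle (discrete_topology X) F" using F by (simp add: equivariant_vector_bundle_def)
  interpret E: group_action G "total F" \<alpha>
    using F by (simp add: equivariant_vector_bundle_def continuous_action_def)
  interpret X: group_action G X act
    using F by (simp add: equivariant_vector_bundle_def continuous_action_def)
  have P: "pointwise_clutching_map X F \<psi>" using psi by (simp add: equivariant_clutching_maps_def)
  have pX: "proj F u \<in> X" if "u \<in> total F" for u
    using B that by (auto simp: complex_vector_bundle_def continuous_map_def)
  have fib: "carrier (fibre F y) = {u \<in> total F. proj F u = y}" if "y \<in> X" for y
    using B that by (auto simp: complex_vector_bundle_def)
  have id: "\<psi> (y, y) u = u" if "y \<in> X" "u \<in> carrier (fibre F y)" for y u
  proof -
    have "\<psi> (y, y) = (\<lambda>u\<in>carrier (fibre F y). u)"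
      using P that unfolding pointwise_clutching_map_def by blast
    then show ?thesis using that by simp
  qed
  have ag: "\<alpha> g v \<in> total F" "proj F (\<alpha> g v) = act g (proj F v)" if "v \<in> total F" for v
    using F that g E.element_image by (auto simp: equivariant_vector_bundle_def)
  have *: "quot_map F \<psi> (\<alpha> g v) = quot_map F \<psi> (\<alpha> g u)" if "v \<in> quot_map F \<psi> u" for v
  proof -
    have v: "v \<in> total F" "\<psi> (proj F u, proj F v) u = v" using that by (auto simp: quot_map_def clutching_rel_def)
    define x y where "x = act g (proj F u)" and "y = act g (proj F v)"
    have xy: "x \<in> X" "y \<in> X" using X.element_image g pX u v by (auto simp: x_def y_def)
    have i: "act (inv\<^bsub>G\<^esub> g) x = proj F u" "act (inv\<^bsub>G\<^esub> g) y = proj F v" 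
      "\<alpha> (inv\<^bsub>G\<^esub> g) (\<alpha> g u) = u"
      using X.orbit_sym_aux[OF g] E.orbit_sym_aux[OF g] pX u v by (auto simp: x_def y_def)
    have mem: "\<alpha> g u \<in> carrier (fibre F x)" using ag u fib xy by (auto simp: x_def)
    have "\<psi> (x, y) (\<alpha> g u) = clutching_action G X act F \<alpha> g \<psi> (x, y) (\<alpha> g u)"
      using psi g by (simp add: equivariant_clutching_maps_def)
    also have "\<dots> = \<alpha> g v" using i v mem xy by (simp add: clutching_action_def)
    finally have e: "\<psi> (x, y) (\<alpha> g u) = \<alpha> g v" .
    have "\<alpha> g v \<in> quot_map F \<psi> (\<alpha> g u) \<inter> carrier (fibre F y)"
      using e ag u v fib xy by (auto simp: quot_map_def clutching_rel_def x_def y_def)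
    moreover have "bij_betw (quot_map F \<psi>) (carrier (fibre F y)) (carrier (quot_space X F \<psi>))"
      using quot_map_linear_iso[OF B P xy(2)] by (simp add: linear_iso_def)
    moreover have "quot_map F \<psi> (\<alpha> g u) \<in> carrier (quot_space X F \<psi>)"
      using ag u by (auto simp: quot_space_def quot_map_def quotientI)
    ultimately obtain w where w: "w \<in> carrier (fibre F y)" "quot_map F \<psi> w = quot_map F \<psi> (\<alpha> g u)"
      "\<alpha> g v \<in> quot_map F \<psi> w"
      unfolding bij_betw_def by (metis IntD1 imageE)
    have "\<psi> (y, y) w = w" using id w xy by blast
    moreover have "\<psi> (proj F w, proj F (\<alpha> g v)) w = \<alpha> g v" using w(3) by (simp add: quot_map_def clutching_rel_def)
    moreover have "proj F w = y" "proj F (\<alpha> g v) = y" using w(1) fib[OF xy(2)] ag v by (auto simp: y_def)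
    ultimately have "w = \<alpha> g v" by simp
    then show ?thesis using w by simp
  qed
  moreover have "u \<in> quot_map F \<psi> u"
    using id[of "proj F u" u] u pX[OF u] fib[OF pX[OF u]]
    by (simp add: quot_map_def clutching_rel_def)
  ultimately show ?thesis unfolding quot_action_def by blast
qed

definition clutching_maps_onto ::
  "('g, 'r) monoid_scheme \<Rightarrow> 'x set \<Rightarrow> ('g \<Rightarrow> 'x \<Rightarrow> 'x) \<Rightarrow> ('e, 'x) vector_bundle \<Rightarrow> ('g \<Rightarrow> 'e \<Rightarrow> 'e) \<Rightarrow>
     (complex, 'w) module \<Rightarrow> ('g \<Rightarrow> 'w \<Rightarrow> 'w) \<Rightarrow> ('x \<times> 'x \<Rightarrow> 'e \<Rightarrow> 'e) set" where
  "clutching_maps_onto G X act F \<alpha> W \<rho> =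
     {\<psi> \<in> equivariant_clutching_maps G X act F \<alpha>.
        rep_iso G (quot_space X F \<psi>) (quot_action F \<alpha> \<psi>) W \<rho>}"

end

theory Submission
  imports Defs "HOL-Library.Function_Algebras"
    "Jordan_Normal_Form.Determinant" "Jordan_Normal_Form.Schur_Decomposition"
begin

text \<open>
  Let \<open>H\<close> be the isotropy group of \<open>x\<close>, identify \<open>W\<close> with the fibre \<open>F\<^sub>x\<close> as an \<open>H\<close>-representation, and let
  \<open>E \<supseteq> D\<close> be the commutants of \<open>H\<close> and of \<open>G\<close>, with unit groups \<open>A \<supseteq> B\<close>. An equivariant clutching map \<open>\<psi>\<close> is the
  same thing as an extension of the \<open>H\<close>-action on \<open>F\<^sub>x\<close> to a \<open>G\<close>-action with quotient \<open>F/\<psi>\<close>, so those with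
  \<open>F/\<psi> \<cong> w\<close> are the conjugates of the given action by \<open>A\<close> and form the homogeneous space \<open>A/B\<close>; averaging
  over the finite set \<open>G/H\<close> gives local sections.

  A loop in \<open>A/B\<close> lifts to a path in \<open>A\<close>, which is closed up inside \<open>B\<close>, and any loop in \<open>A\<close> is a product of
  pieces lying in complex lines \<open>1 + \<complex> k\<close> with \<open>k \<in> E\<close>, because finitely many points of such a line are singular.
  As the irreducible summands of \<open>W\<close> stay irreducible over \<open>H\<close>, their projections lie in \<open>D\<close> and satisfy Schur's
  lemma in \<open>E\<close>, so \<open>k\<close> can be triangularised and then deformed to a diagonal element of \<open>D\<close> without
  changing \<open>det (1 + z k)\<close>. This moves loops in the line to loops in \<open>B\<close>, which are constant in \<open>A/B\<close>.
\<close>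

section \<open>Isospectral deformation in a split algebra\<close>

text \<open>As \<open>A\<close> is connected, simple connectedness of \<open>A/B\<close> amounts to
  \<open>B\<close> being connected and every loop of \<open>A\<close> being homotopic to one in
  \<open>B\<close>. The first point comes from the ground field: the line
  \<open>1 + z (b - 1)\<close> stays in the algebra \<open>D\<close>, and a plane without finitely
  many points is connected. The second is where the restriction hypothesis enters, since it puts a
  full set of diagonal idempotents of \<open>E\<close> into \<open>D\<close>. Deformations of
  \<open>k\<close> keep \<open>det (1 + z k)\<close> fixed because then one and the same path of
  parameters \<open>z\<close> avoids the singular points from beginning to end.

  The algebra is abstract here: \<open>\<delta>\<close> stands for the determinant,
  \<open>sc\<close> for the scalars, \<open>iv\<close> for the inverse. That lines have finitely
  many singular points reflects that \<open>\<delta>\<close> is a polynomial along them, and the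
  split annihilating polynomial is the source of eigenvectors.

  The idempotents in \<open>D\<close> rest on complete reducibility. Invariant complements are found
  by minimising a strictly convex norm that is invariant under the group; such a norm exists because
  the action is bounded.\<close>

locale matrix_like_algebra =
  fixes E :: "'r::{ring_1,topological_space} set"
    and sc :: "complex \<Rightarrow> 'r" and \<delta> :: "'r \<Rightarrow> complex" and iv :: "'r \<Rightarrow> 'r"
  assumes sc_E: "sc z \<in> E"
    and add_E: "a \<in> E \<Longrightarrow> b \<in> E \<Longrightarrow> a + b \<in> E"
    and mult_E: "a \<in> E \<Longrightarrow> b \<in> E \<Longrightarrow> a * b \<in> E"
    and sc_one: "sc 1 = 1"
    and sc_add: "sc (z + w) = sc z + sc w"
    and sc_mult: "sc (z * w) = sc z * sc w"
    and sc_central: "a \<in> E \<Longrightarrow> a * sc z = sc z * a"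
    and continuous_add_E: "continuous_on (E \<times> E) (\<lambda>x. fst x + snd x)"
    and continuous_mult_E: "continuous_on (E \<times> E) (\<lambda>x. fst x * snd x)"
    and continuous_sc: "continuous_on UNIV sc"
    and continuous_\<delta>: "continuous_on E \<delta>"
    and \<delta>_one: "\<delta> 1 = 1"
    and \<delta>_mult: "a \<in> E \<Longrightarrow> b \<in> E \<Longrightarrow> \<delta> (a * b) = \<delta> a * \<delta> b"
    and iv_E: "a \<in> E \<Longrightarrow> \<delta> a \<noteq> 0 \<Longrightarrow> iv a \<in> E"
    and iv_left: "a \<in> E \<Longrightarrow> \<delta> a \<noteq> 0 \<Longrightarrow> iv a * a = 1"
    and iv_right: "a \<in> E \<Longrightarrow> \<delta> a \<noteq> 0 \<Longrightarrow> a * iv a = 1"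
    and continuous_iv: "continuous_on {a \<in> E. \<delta> a \<noteq> 0} iv"
    and finite_singular: "b \<in> E \<Longrightarrow> finite {z. \<delta> (1 + sc z * b) = 0}"
    and annihilating: "k \<in> E \<Longrightarrow> \<exists>zs. foldr (\<lambda>z x. (k - sc z) * x) zs 1 = 0"
begin

definition units :: "'r set" where "units = {a \<in> E. \<delta> a \<noteq> 0}"

section \<open>Closure and continuity rules of the algebra\<close>

lemma sc_zero: "sc 0 = 0"
  using sc_add[of 0 0] by simp

lemma sc_minus: "sc (- z) = - sc z"
  using sc_add[of z "- z"] by (simp add: sc_zero eq_neg_iff_add_eq_0 add.commute)

lemma one_E: "1 \<in> E"
  using sc_E[of 1] by (simp add: sc_one)

lemma zero_E: "0 \<in> E"
  using sc_E[of 0] by (simp add: sc_zero)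

lemma uminus_E: "a \<in> E \<Longrightarrow> - a \<in> E"
  using mult_E[OF sc_E[of "-1"], of a] by (simp add: sc_minus sc_one)

lemma diff_E: "a \<in> E \<Longrightarrow> b \<in> E \<Longrightarrow> a - b \<in> E"
  using add_E[of a "- b"] uminus_E by simp

lemmas E_closed = sc_E one_E zero_E add_E mult_E uminus_E diff_E

lemma sum_E: "(\<And>i. i \<in> J \<Longrightarrow> f i \<in> E) \<Longrightarrow> sum f J \<in> E"
  by (induction J rule: infinite_finite_induct) (auto intro: E_closed)

lemma units_E: "a \<in> units \<Longrightarrow> a \<in> E"
  by (simp add: units_def)

lemma one_units: "1 \<in> units"
  by (simp add: units_def one_E \<delta>_one)

lemma mult_units: "a \<in> units \<Longrightarrow> b \<in> units \<Longrightarrow> a * b \<in> units"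
  by (simp add: units_def mult_E \<delta>_mult)

lemma iv_units: "a \<in> units \<Longrightarrow> iv a \<in> units"
  using \<delta>_mult[of a "iv a"] by (auto simp: units_def iv_E iv_right \<delta>_one)

lemma iv_units_left: "a \<in> units \<Longrightarrow> iv a * a = 1" and iv_units_right: "a \<in> units \<Longrightarrow> a * iv a = 1"
  by (auto simp: units_def iv_left iv_right)

lemma continuous_on_add_E:
  assumes "continuous_on T f" "continuous_on T g" "f ` T \<subseteq> E" "g ` T \<subseteq> E"
  shows "continuous_on T (\<lambda>x. f x + g x)"
  using continuous_on_compose2[OF continuous_add_E, of T "\<lambda>x. (f x, g x)"] assms
  by (auto intro: continuous_on_Pair)

lemma continuous_on_mult_E:
  assumes "continuous_on T f" "continuous_on T g" "f ` T \<subseteq> E" "g ` T \<subseteq> E"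
  shows "continuous_on T (\<lambda>x. f x * g x)"
  using continuous_on_compose2[OF continuous_mult_E, of T "\<lambda>x. (f x, g x)"] assms
  by (auto intro: continuous_on_Pair)

lemma continuous_on_sc: "continuous_on T f \<Longrightarrow> continuous_on T (\<lambda>x. sc (f x))"
  using continuous_on_compose2[OF continuous_sc] by blast

lemma continuous_on_\<delta>: "continuous_on T f \<Longrightarrow> f ` T \<subseteq> E \<Longrightarrow> continuous_on T (\<lambda>x. \<delta> (f x))"
  using continuous_on_compose2[OF continuous_\<delta>] by blast

lemma continuous_on_line:
  assumes "continuous_on T f" "continuous_on T g" "g ` T \<subseteq> E"
  shows "continuous_on T (\<lambda>x. 1 + sc (f x) * g x)"
  using assms by (intro continuous_on_add_E continuous_on_mult_E continuous_on_sc continuous_on_const)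
    (auto intro!: E_closed)

text \<open>The zeros of \<open>\<delta> (1 + sc z * l)\<close> in \<open>z\<close> are the singular
  points of the line through 1 in direction \<open>l\<close>, so these points do not move while
  \<open>l\<close> runs along the path.\<close>

definition isospectral :: "'r \<Rightarrow> 'r \<Rightarrow> bool" where
  "isospectral k k' \<longleftrightarrow> (\<exists>\<kappa>. path \<kappa> \<and> path_image \<kappa> \<subseteq> E \<and> pathstart \<kappa> = k \<and> pathfinish \<kappa> = k' \<and>
     (\<forall>l\<in>path_image \<kappa>. \<forall>z. \<delta> (1 + sc z * l) = \<delta> (1 + sc z * k)))"

lemma isospectral_refl: "k \<in> E \<Longrightarrow> isospectral k k"
  unfolding isospectral_def
  by (rule exI[of _ "\<lambda>_. k"]) (auto simp: path_def path_image_def pathstart_def pathfinish_def)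

lemma isospectral_trans: assumes "isospectral k l" "isospectral l m" shows "isospectral k m"
proof -
  obtain \<kappa> where \<kappa>: "path \<kappa>" "path_image \<kappa> \<subseteq> E" "pathstart \<kappa> = k" "pathfinish \<kappa> = l"
     "\<And>x z. x \<in> path_image \<kappa> \<Longrightarrow> \<delta> (1 + sc z * x) = \<delta> (1 + sc z * k)"
    using assms(1) unfolding isospectral_def by blast
  obtain \<mu> where \<mu>: "path \<mu>" "path_image \<mu> \<subseteq> E" "pathstart \<mu> = l" "pathfinish \<mu> = m"
     "\<And>x z. x \<in> path_image \<mu> \<Longrightarrow> \<delta> (1 + sc z * x) = \<delta> (1 + sc z * l)"
    using assms(2) unfolding isospectral_def by blast
  have "l \<in> path_image \<kappa>" using \<kappa>(4) pathfinish_in_path_image by blast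
  then show ?thesis
    unfolding isospectral_def using \<kappa> \<mu>
    by (intro exI[of _ "\<kappa> +++ \<mu>"]) (auto simp: path_image_join)
qed

text \<open>Scalars are central, so \<open>1 + sc z * (u * k * v)\<close> is itself
  \<open>u * (1 + sc z * k) * v\<close>, and the outer factors contribute
  \<open>\<delta> u * \<delta> v = 1\<close>.\<close>

lemma conjugate_spectrum:
  assumes "u \<in> E" "v \<in> E" "k \<in> E" "u * v = 1"
  shows "\<delta> (1 + sc z * (u * k * v)) = \<delta> (1 + sc z * k)"
proof -
  have "1 + sc z * (u * k * v) = u * (1 + sc z * k) * v"
    using assms(4) sc_central[OF assms(1), of z] by (simp add: algebra_simps flip: mult.assoc)
  moreover have "\<delta> u * \<delta> v = 1"
    using \<delta>_mult[OF assms(1,2)] assms(4) \<delta>_one by simp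
  ultimately show ?thesis
    using assms by (simp add: \<delta>_mult E_closed)
qed

text \<open>Since \<open>m * m = 0\<close>, the inverse of \<open>1 + t m\<close> is
  \<open>1 - t m\<close> for every scalar \<open>t\<close>; the conjugates for \<open>t\<close> from
  0 to 1 form the path.\<close>

lemma isospectral_shear:
  assumes k: "k \<in> E" and m: "m \<in> E" "m * m = 0"
  shows "isospectral k ((1 + m) * k * (1 - m))"
  unfolding isospectral_def
proof (intro exI[of _ "\<lambda>t. (1 + sc (complex_of_real t) * m) * k * (1 + sc (- complex_of_real t) * m)"] conjI ballI allI)
  let ?\<kappa> = "\<lambda>t::real. (1 + sc (complex_of_real t) * m) * k * (1 + sc (- complex_of_real t) * m)"
  have inE: "1 + sc z * m \<in> E" for z by (intro E_closed m)
  show "path ?\<kappa>" unfolding path_def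
    by (intro continuous_on_mult_E continuous_on_line continuous_intros) (use inE k m in \<open>auto intro!: mult_E\<close>)
  show "path_image ?\<kappa> \<subseteq> E" using inE k by (auto simp: path_image_def intro!: mult_E)
  show "pathstart ?\<kappa> = k" "pathfinish ?\<kappa> = (1 + m) * k * (1 - m)"
    by (auto simp: pathstart_def pathfinish_def sc_zero sc_one sc_minus)
  fix l z assume "l \<in> path_image ?\<kappa>"
  then obtain t where t: "l = ?\<kappa> t" by (auto simp: path_image_def)
  have "(sc t * m) * (sc t * m) = sc t * sc t * (m * m)" for t
    using sc_central[OF m(1), of t] by (metis mult.assoc)
  then have "(1 + sc t * m) * (1 + sc (- t) * m) = 1" for t
    using m(2) by (simp add: algebra_simps sc_minus)
  then show "\<delta> (1 + sc z * l) = \<delta> (1 + sc z * k)"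
    unfolding t by (intro conjugate_spectrum inE k)
qed

text \<open>Relative to \<open>p\<close> and \<open>1 - p\<close> the element \<open>k\<close> is
  block triangular, because \<open>k * p = sc c * p\<close>. Conjugation by \<open>s\<close> on
  \<open>p\<close> and 1 on \<open>1 - p\<close> multiplies the off-diagonal block
  \<open>p * k * (1 - p)\<close> by \<open>s\<close>, and \<open>s = 1 - t\<close> runs to
  0.\<close>

lemma isospectral_compress:
  assumes k: "k \<in> E" and p: "p \<in> E" "p * p = p" and kp: "k * p = sc c * p"
  shows "isospectral k (sc c * p + (1 - p) * k * (1 - p))"
proof -
  define \<kappa> where "\<kappa> t = (sc c * p + (1 - p) * k * (1 - p)) + sc (1 - complex_of_real t) * (p * k * (1 - p))" for t
  have \<kappa>E: "\<kappa> t \<in> E" for t unfolding \<kappa>_def by (intro E_closed k p)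
  have cont: "continuous_on T \<kappa>" for T
    unfolding \<kappa>_def
    by (intro continuous_on_add_E continuous_on_mult_E continuous_on_sc continuous_intros)
      (auto intro!: E_closed k p)
  have k_eq: "k = sc c * p + (p * k * (1 - p) + (1 - p) * k * (1 - p))"
  proof -
    have "k = k * p + (p + (1 - p)) * k * (1 - p)" by (simp add: algebra_simps)
    then show ?thesis by (simp add: kp algebra_simps)
  qed
  have spec: "\<delta> (1 + sc z * \<kappa> t) = \<delta> (1 + sc z * k)" if "t \<in> {0..<1}" for z t
  proof -
    define s where "s = 1 - complex_of_real t"
    have s: "s \<noteq> 0" using that by (auto simp: s_def simp flip: of_real_diff[of 1 t, simplified])
    let ?u = "sc s * p + (1 - p)" and ?v = "sc (1/s) * p + (1 - p)"
    have up: "?u * p = sc s * p" "?u * (1 - p) = 1 - p"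
      and pv: "p * ?v = sc (1/s) * p" "(1 - p) * ?v = 1 - p"
      using p sc_central[OF p(1)] by (auto simp: algebra_simps simp flip: mult.assoc)
        (auto simp: mult.assoc)
    have ss: "sc s * sc (1/s) = 1" using s by (simp add: sc_one flip: sc_mult)
    have "?u * ?v = sc s * (p * ?v) + (1 - p) * ?v" by (simp add: distrib_right mult.assoc)
    then have uv: "?u * ?v = 1"
      unfolding pv using ss by (simp flip: mult.assoc)
    have distr: "u * (sc c * p + (p * k * p' + p' * k * p')) * v = u * (sc c * p) * v + (u * p * k * (p' * v) + u * p' * k * (p' * v))"
      for u v p' by (simp add: distrib_left distrib_right mult.assoc)
    have uE: "?u \<in> E" "?v \<in> E" by (intro E_closed p)+
    have "?u * (sc c * p) * ?v = sc c * (?u * p * ?v)"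
      by (simp only: sc_central[OF uE(1), of c] flip: mult.assoc)
    also have "?u * p * ?v = p"
      unfolding up using pv(1) ss by (metis mult.assoc mult_1)
    finally have "?u * (sc c * p + (p * k * (1 - p) + (1 - p) * k * (1 - p))) * ?v
       = sc c * p + (?u * p * k * ((1 - p) * ?v) + ?u * (1 - p) * k * ((1 - p) * ?v))"
      unfolding distr by simp
    then have "?u * k * ?v = sc c * p + (?u * p * k * ((1 - p) * ?v) + ?u * (1 - p) * k * ((1 - p) * ?v))"
      unfolding k_eq[symmetric] .
    then have "?u * k * ?v = sc c * p + (sc s * p * k * (1 - p) + (1 - p) * k * (1 - p))"
      by (simp only: up pv)
    then have "?u * k * ?v = \<kappa> t"
      unfolding \<kappa>_def s_def by (simp only: mult.assoc add_ac)
    then show ?thesis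
      using conjugate_spectrum[OF uE k uv, of z] by simp
  qed
  \<comment> \<open>At \<open>t = 1\<close> the conjugating element degenerates; there the equality
    is the limit of those for \<open>t < 1\<close>.\<close>
  have spec1: "\<delta> (1 + sc z * \<kappa> t) = \<delta> (1 + sc z * k)" if "t \<in> {0..1}" for z t
  proof (rule continuous_constant_on_closure[of "{0..<1::real}" "\<lambda>t. \<delta> (1 + sc z * \<kappa> t)"])
    show "continuous_on (closure {0..<1}) (\<lambda>t. \<delta> (1 + sc z * \<kappa> t))"
      by (intro continuous_on_\<delta> continuous_on_line continuous_on_const cont) (auto intro!: E_closed \<kappa>E)
  qed (use spec that in auto)
  have "path \<kappa>" "path_image \<kappa> \<subseteq> E" using cont \<kappa>E by (auto simp: path_def path_image_def)
  moreover have "pathstart \<kappa> = k"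
    by (subst k_eq) (simp add: pathstart_def \<kappa>_def sc_one ac_simps)
  moreover have "pathfinish \<kappa> = sc c * p + (1 - p) * k * (1 - p)"
    by (simp add: pathfinish_def \<kappa>_def sc_zero)
  ultimately show ?thesis
    unfolding isospectral_def using spec1 by (intro exI[of _ \<kappa>]) (auto simp: path_image_def)
qed

text \<open>An eigenvector in the range of \<open>q\<close>, expressed as an element of the algebra.
  The factors \<open>k - sc z\<close> of an annihilating product are applied to \<open>q\<close> one
  after another; the last nonzero partial product is the eigen-element, and it stays in the corner
  of \<open>q\<close> because \<open>q\<close> commutes with \<open>k\<close>.\<close>

lemma eigen_element:
  assumes k: "k \<in> E" and q: "q \<in> E" "q \<noteq> 0" "q * q = q" "q * k = k * q"
  shows "\<exists>z. \<exists>e\<in>E. e \<noteq> 0 \<and> k * e = sc z * e \<and> q * e = e \<and> e * q = e"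
proof -
  let ?f = "\<lambda>zs. foldr (\<lambda>z x. (k - sc z) * x) zs"
  have inv: "?f zs q \<in> E \<and> q * ?f zs q = ?f zs q \<and> ?f zs q * q = ?f zs q" for zs
  proof (induction zs)
    case (Cons z zs)
    have "q * (k - sc z) = (k - sc z) * q"
      using q(4) sc_central[OF q(1), of z] by (simp add: algebra_simps)
    then show ?case using Cons k by (auto simp: mult.assoc intro!: E_closed) (metis mult.assoc)
  qed (use q in auto)
  have "?f zs x * q = ?f zs (x * q)" for zs x
    by (induction zs) (auto simp: mult.assoc)
  then obtain zs where zs: "?f zs q = 0" using annihilating[OF k] by (metis mult_1 mult_zero_left)
  have "\<exists>z zs. ?f zs q \<noteq> 0 \<and> (k - sc z) * ?f zs q = 0" if "?f zs q = 0" for zs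
    using that by (induction zs) (use q in auto)
  from this[OF zs] obtain z zs' where "?f zs' q \<noteq> 0" "k * ?f zs' q = sc z * ?f zs' q"
    by (auto simp: left_diff_distrib)
  then show ?thesis using inv by blast
qed

end

text \<open>By \<open>schur\<close> a nonzero element between two corners is invertible there, as a
  multiple of a matrix unit is. So \<open>E\<close> behaves like a product of matrix algebras, and
  \<open>D\<close> contains the diagonal idempotents.\<close>

locale split_subalgebra = matrix_like_algebra E sc \<delta> iv
  for E :: "'r::{ring_1,topological_space} set" and sc \<delta> iv +
  fixes D :: "'r set" and I :: "'i set" and p :: "'i \<Rightarrow> 'r"
  assumes D_E: "D \<subseteq> E" and sc_D: "sc z \<in> D"
    and add_D: "a \<in> D \<Longrightarrow> b \<in> D \<Longrightarrow> a + b \<in> D"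
    and mult_D: "a \<in> D \<Longrightarrow> b \<in> D \<Longrightarrow> a * b \<in> D"
    and finite_I: "finite I" and p_D: "i \<in> I \<Longrightarrow> p i \<in> D"
    and p_idem: "i \<in> I \<Longrightarrow> p i * p i = p i"
    and p_orth: "i \<in> I \<Longrightarrow> j \<in> I \<Longrightarrow> i \<noteq> j \<Longrightarrow> p i * p j = 0"
    and p_sum: "(\<Sum>i\<in>I. p i) = 1"
    and schur: "i \<in> I \<Longrightarrow> j \<in> I \<Longrightarrow> a \<in> E \<Longrightarrow> p j * a * p i = a \<Longrightarrow> a \<noteq> 0 \<Longrightarrow>
       \<exists>b\<in>E. p i * b * p j = b \<and> b * a = p i \<and> a * b = p j"
begin

section \<open>Diagonalisation by isospectral moves\<close>

lemma p_E: "i \<in> I \<Longrightarrow> p i \<in> E" using p_D D_E by blast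

lemma sum_D: "finite J \<Longrightarrow> (\<And>i. i \<in> J \<Longrightarrow> f i \<in> D) \<Longrightarrow> sum f J \<in> D"
  by (induction J rule: finite_induct) (use sc_D[of 0] in \<open>auto simp: sc_zero add_D\<close>)


lemma sum_p_mult: 
  assumes "J \<subseteq> I" "i \<in> I" 
  shows "(\<Sum>j\<in>J. p j) * p i = (if i \<in> J then p i else 0)" "p i * (\<Sum>j\<in>J. p j) = (if i \<in> J then p i else 0)"
proof -
  have "finite J" using assms finite_I finite_subset by blast
  moreover have "p j * p i = (if j = i then p i else 0)" "p i * p j = (if i = j then p i else 0)" if "j \<in> J" for j
    using that assms p_idem p_orth by auto
  ultimately show "(\<Sum>j\<in>J. p j) * p i = (if i \<in> J then p i else 0)" "p i * (\<Sum>j\<in>J. p j) = (if i \<in> J then p i else 0)"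
    by (simp_all add: sum_distrib_left sum_distrib_right sum.delta sum.delta' cong: sum.cong)
qed

lemma sum_p_idem: "J \<subseteq> I \<Longrightarrow> (\<Sum>j\<in>J. p j) * (\<Sum>j\<in>J. p j) = (\<Sum>j\<in>J. p j)"
  using sum_p_mult(1)[of J] by (subst sum_distrib_left) (auto intro!: sum.cong)

text \<open>One eigenvector at a time: an eigen-element of the part of \<open>k\<close> that is not yet diagonal is moved by a
  shear onto some \<open>p i\<close>, and the remaining off-diagonal part of that column is scaled to \<open>0\<close>.\<close>

lemma isospectral_into_D:
  assumes "k \<in> E"
  shows "\<exists>d\<in>D. isospectral k d"
proof -
  \<comment> \<open>Induction on the number of corners still to be treated: \<open>J\<close>
    collects them, \<open>q\<close> is their sum, and on every other corner \<open>k\<close> is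
    already a scalar.\<close>
  have "\<exists>d\<in>D. isospectral k d"
    if "card J = n" "J \<subseteq> I" "k \<in> E" "q = (\<Sum>j\<in>J. p j)" "k = (\<Sum>i\<in>I-J. sc (c i) * p i) + q * k * q" for n J k q c
    using that
  proof (induction n arbitrary: J k q c)
    case 0
    moreover have "finite J" using 0 finite_I finite_subset by blast
    ultimately have "J = {}" by simp
    then have "k = (\<Sum>i\<in>I. sc (c i) * p i)" using 0 by simp
    then have "k \<in> D" using finite_I by (auto intro!: sum_D mult_D sc_D p_D)
    then show ?case using isospectral_refl D_E by blast
  next
    case (Suc n)
    have finJ: "finite J" using Suc.prems(2) finite_I finite_subset by blast
    define d where "d = (\<Sum>i\<in>I-J. sc (c i) * p i)"
    have kd: "k = d + q * k * q" using Suc.prems(5) by (simp add: d_def)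
    have qE: "q \<in> E" using Suc.prems by (auto intro!: sum_E p_E)
    have qq: "q * q = q" using Suc.prems sum_p_idem by blast
    have q_out: "p i * q = 0" "q * p i = 0" if "i \<in> I - J" for i using sum_p_mult[of J i] that Suc.prems by auto
    have dq: "d * q = 0" unfolding d_def using q_out by (simp add: sum_distrib_right mult.assoc)
    have "q * (sc (c i) * p i) = 0" if "i \<in> I - J" for i
      using q_out[OF that] sc_central[OF qE, of "c i"] by (metis mult.assoc mult_zero_right)
    then have qd: "q * d = 0" unfolding d_def by (simp add: sum_distrib_left)
    have "q * k = q * (d + q * k * q)" "k * q = (d + q * k * q) * q"
      by (rule arg_cong[OF kd])+
    then have qk: "q * k = q * k * q" "k * q = q * k * q"
      by (simp_all add: distrib_left distrib_right qd dq) (metis mult.assoc qq)+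
    show ?case
    \<comment> \<open>The idempotents \<open>p i\<close> may be zero, so \<open>q\<close> can vanish
      although \<open>J\<close> is not empty.\<close>
    proof (cases "q = 0")
      case True
      then have "k = d" using kd by (metis add.right_neutral mult_zero_left)
      then have "k \<in> D" unfolding d_def using finite_I by (auto intro!: sum_D mult_D sc_D p_D)
      then show ?thesis using isospectral_refl D_E by blast
    next
      case False
      obtain z e where e: "e \<in> E" "e \<noteq> 0" "k * e = sc z * e" "q * e = e" "e * q = e"
        using eigen_element[OF Suc.prems(3) qE False qq] qk by metis
      \<comment> \<open>A nonzero eigen-element has a nonzero entry \<open>p i * e * p j\<close>,
        and this entry is what \<open>schur\<close> can invert.\<close>
      have "e = q * e * q" using e(4,5) by simp
      also have "\<dots> = (\<Sum>j\<in>J. \<Sum>i\<in>J. p i * e * p j)"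
        unfolding Suc.prems(4) sum_distrib_left sum_distrib_right ..
      finally have "e = (\<Sum>j\<in>J. \<Sum>i\<in>J. p i * e * p j)" .
      then obtain i j where ij: "i \<in> J" "j \<in> J" "p i * e * p j \<noteq> 0"
        using e(2) by (metis (no_types, lifting) sum.neutral)
      have I: "i \<in> I" "j \<in> I" using ij Suc.prems(2) by auto
      have "p i * (p i * e * p j) * p j = p i * e * p j"
        using p_idem I by (metis mult.assoc)
      then obtain y where y: "y \<in> E" "p j * y * p i = y" "p i * e * p j * y = p i"
        using schur[of j i "p i * e * p j"] I ij(3) e(1) p_E by (metis mult_E)
      \<comment> \<open>Multiplying by the inverse \<open>y\<close> of the entry turns
        \<open>e\<close> into a single column \<open>w\<close>, still an eigen-element, with
        component exactly \<open>P\<close> in the corner \<open>i\<close>. This normalisation makes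
        \<open>w\<close> idempotent.\<close>
      define P w where "P = p i" and "w = e * y"
      have PE: "P \<in> E" and wE: "w \<in> E" using I p_E y e by (auto simp: P_def w_def intro!: mult_E)
      have "y * p i = y" "p j * y = y" using y(2) p_idem I by (metis mult.assoc)+
      then have w: "w * P = w" "P * w = P" "k * w = sc z * w" "q * w = w"
        using y(3) e by (auto simp: w_def P_def mult.assoc) (metis mult.assoc)+
      have PP: "P * P = P" and qP: "q * P = P" "P * q = P"
        using p_idem I sum_p_mult[of J i] Suc.prems ij by (auto simp: P_def)
      have ww: "w * w = w" using w by (metis mult.assoc)
      have wq: "w * q = w" using w(1) qP(2) by (metis mult.assoc)
      \<comment> \<open>From \<open>P * w = P\<close> and \<open>w * P = w\<close> it follows that
        \<open>m\<close> squares to zero, and \<open>1 - m\<close> carries \<open>P\<close> to the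
        eigen-element \<open>w\<close>. After the shear \<open>P\<close> itself is an
        eigen-element.\<close>
      define m where "m = P - w"
      have mE: "m \<in> E" and mm: "m * m = 0" and qm: "q * m = m" "m * q = m"
        unfolding m_def by (auto simp: algebra_simps PP w ww qP wq intro!: E_closed PE wE)
      define k1 where "k1 = (1 + m) * k * (1 - m)"
      have k1E: "k1 \<in> E" unfolding k1_def by (intro E_closed mE Suc.prems)
      have mw: "m * w = P - w" "(1 - m) * P = w" unfolding m_def by (auto simp: algebra_simps w ww PP)
      have "k1 * P = (1 + m) * (k * w)" unfolding k1_def using mw(2) by (simp add: mult.assoc)
      also have "\<dots> = sc z * ((1 + m) * w)"
        using w(3) sc_central[of "1 + m" z] mE by (metis E_closed(2,4) mult.assoc)
      also have "(1 + m) * w = P" by (simp add: distrib_right mw)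
      finally have k1P: "k1 * P = sc z * P" .
      have md: "m * d = 0" "d * m = 0" using qm qd dq by (metis mult.assoc mult_zero_left mult_zero_right)+
      \<comment> \<open>The shear lives in the corner of \<open>q\<close> and therefore leaves the
        finished part \<open>d\<close> alone.\<close>
      have k1: "k1 = d + q * k1 * q"
      proof -
        have "(1 + m) * (q * k * q) * (1 - m) = q * ((1 + m) * k * (1 - m)) * q"
        proof -
          have "(1 + m) * q = q * (1 + m)" "q * (1 - m) = (1 - m) * q" using qm by (auto simp: algebra_simps)
          then show ?thesis by (metis mult.assoc)
        qed
        moreover have "(1 + m) * d * (1 - m) = d" using md by (simp add: algebra_simps)
        moreover have "k1 = (1 + m) * d * (1 - m) + (1 + m) * (q * k * q) * (1 - m)"
          unfolding k1_def by (subst kd) (simp only: distrib_left distrib_right)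
        ultimately show ?thesis by (simp add: k1_def)
      qed
      define k2 where "k2 = sc z * P + (1 - P) * k1 * (1 - P)"
      have k2E: "k2 \<in> E" unfolding k2_def by (intro E_closed PE k1E)
      have q': "(\<Sum>j\<in>J-{i}. p j) = q - P"
        using finJ ij(1) Suc.prems(4) by (simp add: P_def sum_diff1)
      have Pd: "P * d = 0" "d * P = 0" using qP qd dq by (metis mult.assoc mult_zero_left mult_zero_right)+
      have "(1 - P) * k1 * (1 - P) = (1 - P) * d * (1 - P) + (1 - P) * (q * k1 * q) * (1 - P)"
        by (subst k1) (simp only: distrib_left distrib_right)
      also have "(1 - P) * d * (1 - P) = d" using Pd by (simp add: algebra_simps)
      also have "(1 - P) * (q * k1 * q) * (1 - P) = ((1 - P) * q) * k1 * (q * (1 - P))" by (simp only: mult.assoc)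
      also have "(1 - P) * q = q - P" by (simp add: algebra_simps qP)
      also have "q * (1 - P) = q - P" by (simp add: algebra_simps qP)
      finally have c1: "(1 - P) * k1 * (1 - P) = d + (q - P) * k1 * (q - P)" .
      have c2: "(q - P) * k2 * (q - P) = (q - P) * k1 * (q - P)"
      proof -
        have "(q - P) * (sc z * P) = sc z * ((q - P) * P)"
          using sc_central[of "q - P" z] qE PE by (metis diff_E mult.assoc)
        then have "(q - P) * (sc z * P) = 0" by (simp add: algebra_simps PP qP)
        moreover have "(q - P) * (1 - P) = q - P" "(1 - P) * (q - P) = q - P" by (auto simp: algebra_simps PP qP)
        ultimately show ?thesis unfolding k2_def by (simp add: distrib_left distrib_right) (metis mult.assoc)
      qed
      have ins: "I - (J - {i}) = insert i (I - J)" using I ij by auto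
      have "k2 = (\<Sum>l\<in>I - (J - {i}). sc ((c(i := z)) l) * p l) + (q - P) * k2 * (q - P)"
      proof -
        have "(\<Sum>l\<in>I - (J - {i}). sc ((c(i := z)) l) * p l) = sc z * p i + (\<Sum>l\<in>I - J. sc ((c(i := z)) l) * p l)"
          unfolding ins using finite_I ij by simp
        also have "(\<Sum>l\<in>I - J. sc ((c(i := z)) l) * p l) = d"
          unfolding d_def using ij by (intro sum.cong) auto
        finally show ?thesis using c1 c2 by (simp add: k2_def P_def add.assoc)
      qed
      moreover have "card (J - {i}) = n" using Suc.prems(1) ij finJ by simp
      ultimately obtain d' where "d' \<in> D" "isospectral k2 d'"
        using Suc.IH[of "J - {i}" k2 "q - P" "c(i := z)"] k2E q' Suc.prems(2) by auto
      moreover have "isospectral k k1" unfolding k1_def by (rule isospectral_shear[OF Suc.prems(3) mE mm])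
      moreover have "isospectral k1 k2" unfolding k2_def by (rule isospectral_compress[OF k1E PE PP k1P])
      ultimately show ?thesis using isospectral_trans by blast
    qed
  qed
  from this[of I _ k 1] show ?thesis using assms p_sum by auto
qed

end

section \<open>Homogeneous spaces of unit groups\<close>

text \<open>
  A square with bottom edge at \<open>b\<close>, sides \<open>f\<close> and \<open>g\<close>, and top edge running along \<open>\<gamma>\<close> from \<open>s\<close> to \<open>t\<close> at a
  speed of its own. Glueing such squares takes the place of the groupoid laws for path homotopies, which the
  library only has in normed spaces.
\<close>

definition sweeps :: "'s::topological_space set \<Rightarrow> 's \<Rightarrow> (real \<Rightarrow> 's) \<Rightarrow> real \<Rightarrow> (real \<Rightarrow> 's) \<Rightarrow> real \<Rightarrow> (real \<Rightarrow> 's) \<Rightarrow> bool" where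
  "sweeps S b \<gamma> s f t g \<longleftrightarrow> (\<exists>\<theta> K. continuous_on {0..1} \<theta> \<and> \<theta> ` {0..1} \<subseteq> {0..1::real} \<and> \<theta> 0 = s \<and> \<theta> 1 = t \<and>
     continuous_on ({0..1} \<times> {0..1}) K \<and> K ` ({0..1} \<times> {0..1}) \<subseteq> S \<and>
     (\<forall>r\<in>{0..1}. K (0, r) = f r \<and> K (1, r) = g r) \<and>
     (\<forall>\<tau>\<in>{0..1::real}. K (\<tau>, 0::real) = b \<and> K (\<tau>, 1) = \<gamma> (\<theta> \<tau>)))"

lemma sweepsI:
  assumes "continuous_on {0..1} \<theta>" "\<And>\<tau>. \<tau> \<in> {0..1} \<Longrightarrow> \<theta> \<tau> \<in> {0..1::real}" "\<theta> 0 = s" "\<theta> 1 = t"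
    and "continuous_on ({0..1} \<times> {0..1}) K" "\<And>\<tau> r. \<tau> \<in> {0..1} \<Longrightarrow> r \<in> {0..1} \<Longrightarrow> K (\<tau>, r) \<in> S"
    and "\<And>r. r \<in> {0..1} \<Longrightarrow> K (0, r) = f r" "\<And>r. r \<in> {0..1} \<Longrightarrow> K (1, r) = g r"
    and "\<And>\<tau>. \<tau> \<in> {0..1::real} \<Longrightarrow> K (\<tau>, 0::real) = b" "\<And>\<tau>. \<tau> \<in> {0..1} \<Longrightarrow> K (\<tau>, 1) = \<gamma> (\<theta> \<tau>)"
  shows "sweeps S b \<gamma> s f t g"
  unfolding sweeps_def using assms by (intro exI[of _ \<theta>] exI[of _ K]) auto

text \<open>The squares are glued along their common side; joining the two speeds keeps the combined
  top edge on \<open>\<gamma>\<close>.\<close>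

lemma sweeps_trans:
  assumes "sweeps S b \<gamma> s f t g" "sweeps S b \<gamma> t g u h"
  shows "sweeps S b \<gamma> s f u h"
proof -
  let ?Q = "{0..1::real} \<times> {0..1::real}"
  obtain \<theta> K where K: "continuous_on {0..1} \<theta>" "\<theta> ` {0..1} \<subseteq> {0..1}" "\<theta> 0 = s" "\<theta> 1 = t"
      "continuous_on ?Q K" "K ` ?Q \<subseteq> S" "\<And>r. r \<in> {0..1} \<Longrightarrow> K (0, r) = f r \<and> K (1, r) = g r"
      "\<And>\<tau>. \<tau> \<in> {0..1} \<Longrightarrow> K (\<tau>, 0) = b \<and> K (\<tau>, 1) = \<gamma> (\<theta> \<tau>)"
    using assms(1) unfolding sweeps_def by blast
  obtain \<eta> L where L: "continuous_on {0..1} \<eta>" "\<eta> ` {0..1} \<subseteq> {0..1}" "\<eta> 0 = t" "\<eta> 1 = u"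
      "continuous_on ?Q L" "L ` ?Q \<subseteq> S" "\<And>r. r \<in> {0..1} \<Longrightarrow> L (0, r) = g r \<and> L (1, r) = h r"
      "\<And>\<tau>. \<tau> \<in> {0..1} \<Longrightarrow> L (\<tau>, 0) = b \<and> L (\<tau>, 1) = \<gamma> (\<eta> \<tau>)"
    using assms(2) unfolding sweeps_def by blast
  let ?M = "\<lambda>x::real \<times> real. if fst x \<le> 1/2 then K (2 * fst x, snd x) else L (2 * fst x - 1, snd x)"
  have M: "continuous_on ?Q ?M"
  proof (rule continuous_on_cases_le)
    show "continuous_on {x \<in> ?Q. fst x \<le> 1/2} (\<lambda>x. K (2 * fst x, snd x))"
      by (rule continuous_on_compose2[OF K(5)]) (auto intro!: continuous_intros)
    show "continuous_on {x \<in> ?Q. 1/2 \<le> fst x} (\<lambda>x. L (2 * fst x - 1, snd x))"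
      by (rule continuous_on_compose2[OF L(5)]) (auto intro!: continuous_intros)
    fix x assume x: "x \<in> ?Q" "fst x = 1/2"
    have "2 * fst x = 1" using x(2) by simp
    then show "K (2 * fst x, snd x) = L (2 * fst x - 1, snd x)"
      using K(7)[of "snd x"] L(7)[of "snd x"] x(1) by (simp add: mem_Times_iff)
  qed (auto intro!: continuous_intros)
  have \<theta>\<eta>: "continuous_on {0..1} (\<theta> +++ \<eta>)"
    using path_join[of \<theta> \<eta>] K(1,4) L(1,3) by (simp add: path_def pathfinish_def pathstart_def)
  show ?thesis
  proof (rule sweepsI[OF \<theta>\<eta> _ _ _ M])
    fix \<tau> r :: real assume "\<tau> \<in> {0..1}" "r \<in> {0..1}"
    then show "?M (\<tau>, r) \<in> S" using K(6) L(6) by (auto simp: image_subset_iff)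
  next
    fix \<tau> :: real assume "\<tau> \<in> {0..1}"
    then show "(\<theta> +++ \<eta>) \<tau> \<in> {0..1}" using K(2) L(2) by (auto simp: joinpaths_def image_subset_iff)
  qed (use K L in \<open>auto simp: joinpaths_def\<close>)
qed

text \<open>Removes the speed that a sweep imposes on its top edge.\<close>

lemma homotopic_loops_reparametrize:
  fixes \<gamma> :: "real \<Rightarrow> 's::topological_space"
  assumes \<gamma>: "path \<gamma>" "path_image \<gamma> \<subseteq> S" "pathfinish \<gamma> = pathstart \<gamma>"
    and \<theta>: "continuous_on {0..1} \<theta>" "\<theta> ` {0..1} \<subseteq> {0..1}" "\<theta> 0 = 0" "\<theta> 1 = 1"
  shows "homotopic_loops S \<gamma> (\<gamma> \<circ> \<theta>)"
  using \<gamma> \<theta> by (intro homotopic_paths_imp_homotopic_loops homotopic_paths_reparametrize[where f = \<theta>])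
    (auto simp: pathfinish_def pathstart_def)

text \<open>A presentation of the homogeneous space by its projection: the fibres of
  \<open>\<pi>\<close> are the left cosets of the units in \<open>D\<close>, and the local sections
  take over the role of the quotient topology.\<close>

locale orbit_map = split_subalgebra E sc \<delta> iv D I p
  for E :: "'r::{ring_1,topological_space} set" and sc \<delta> iv D and I :: "'i set" and p +
  fixes \<pi> :: "'r \<Rightarrow> 's::topological_space" and S :: "'s set"
  assumes continuous_\<pi>: "continuous_on units \<pi>"
    and \<pi>_image: "\<pi> ` units = S"
    and \<pi>_eq_iff: "a \<in> units \<Longrightarrow> b \<in> units \<Longrightarrow> \<pi> a = \<pi> b \<longleftrightarrow> iv a * b \<in> D"
    and sections: "a \<in> units \<Longrightarrow> \<exists>U s. openin (top_of_set S) U \<and> \<pi> a \<in> U \<and> continuous_on U s \<and> s ` U \<subseteq> units \<and> (\<forall>x\<in>U. \<pi> (s x) = x)"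
begin

section \<open>Lifting loops and sweeping them along complex lines\<close>

lemma \<pi>_mult_D: assumes "a \<in> units" "b \<in> units" "b \<in> D" shows "\<pi> (a * b) = \<pi> a"
  using \<pi>_eq_iff[OF assms(1) mult_units[OF assms(1,2)]] assms by (simp add: iv_units_left flip: mult.assoc)

lemma \<pi>_S: "a \<in> units \<Longrightarrow> \<pi> a \<in> S" using \<pi>_image by blast

lemma continuous_on_\<pi>: "continuous_on T f \<Longrightarrow> f ` T \<subseteq> units \<Longrightarrow> continuous_on T (\<lambda>x. \<pi> (f x))"
  using continuous_on_compose2[OF continuous_\<pi>] by blast

lemma line_units: "k \<in> E \<Longrightarrow> 1 + sc z * k \<in> units \<longleftrightarrow> \<delta> (1 + sc z * k) \<noteq> 0"
  by (auto simp: units_def intro!: E_closed)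

lemma complex_line_path:
  assumes a: "a \<in> units"
  obtains g where "path g" "pathstart g = 0" "pathfinish g = 1" "\<And>r. r \<in> {0..1} \<Longrightarrow> 1 + sc (g r) * (a - 1) \<in> units"
proof -
  let ?Z = "{z. \<delta> (1 + sc z * (a - 1)) = 0}"
  have aE: "a - 1 \<in> E" using a by (intro E_closed units_E)
  have "path_connected (- ?Z)"
    using finite_singular[OF aE] by (intro path_connected_complement_countable) (auto simp: countable_finite)
  moreover have "0 \<in> - ?Z" "1 \<in> - ?Z" using a by (auto simp: sc_zero sc_one \<delta>_one units_def)
  ultimately obtain g where "path g" "path_image g \<subseteq> - ?Z" "pathstart g = 0" "pathfinish g = 1"
    unfolding path_connected_def by blast
  moreover have "1 + sc (g r) * (a - 1) \<in> units" if "r \<in> {0..1}" for r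
    using that \<open>path_image g \<subseteq> - ?Z\<close> aE by (auto simp: path_image_def line_units image_subset_iff)
  ultimately show ?thesis using that[of g] by blast
qed

text \<open>Local sections lift short pieces, and bisection (\<open>Bolzano\<close>) joins them. The
  property \<open>P\<close> asks for a lift from every point over the start, so that the lift of a
  second piece can begin where the first one ended.\<close>

lemma lift_path:
  assumes \<gamma>: "path \<gamma>" "path_image \<gamma> \<subseteq> S"
  obtains a where "path a" "path_image a \<subseteq> units" "\<And>t. t \<in> {0..1} \<Longrightarrow> \<pi> (a t) = \<gamma> t"
proof -
  define P where "P s t \<longleftrightarrow> (0 \<le> s \<and> t \<le> 1 \<longrightarrow> (\<forall>a0\<in>units. \<pi> a0 = \<gamma> s \<longrightarrow>
     (\<exists>a. continuous_on {s..t} a \<and> a s = a0 \<and> (\<forall>r\<in>{s..t}. a r \<in> units \<and> \<pi> (a r) = \<gamma> r))))" for s t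
  have "P 0 1"
  proof (rule Bolzano)
    fix r s t assume trans: "P r s" "P s t" "r \<le> s" "s \<le> t"
    show "P r t" unfolding P_def
    proof (intro impI ballI)
      fix a0 assume *: "0 \<le> r \<and> t \<le> 1" "a0 \<in> units" "\<pi> a0 = \<gamma> r"
      have bounds: "0 \<le> r \<and> s \<le> 1" "0 \<le> s \<and> t \<le> 1" using trans(3,4) * by auto
      obtain a where a: "continuous_on {r..s} a" "a r = a0" "\<And>x. x\<in>{r..s} \<Longrightarrow> a x \<in> units \<and> \<pi> (a x) = \<gamma> x"
        using trans(1)[unfolded P_def, rule_format, OF bounds(1) *(2,3)] by blast
      have as: "a s \<in> units" "\<pi> (a s) = \<gamma> s" using a(3)[of s] trans by auto
      obtain b where b: "continuous_on {s..t} b" "b s = a s" "\<And>x. x\<in>{s..t} \<Longrightarrow> b x \<in> units \<and> \<pi> (b x) = \<gamma> x"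
        using trans(2)[unfolded P_def, rule_format, OF bounds(2) as] by blast
      have "continuous_on ({r..s} \<union> {s..t}) (\<lambda>x. if x \<le> s then a x else b x)"
        by (rule continuous_on_cases) (use a b in auto)
      then have "continuous_on {r..t} (\<lambda>x. if x \<le> s then a x else b x)"
        using trans by (simp add: ivl_disj_un_two_touch)
      then show "\<exists>a. continuous_on {r..t} a \<and> a r = a0 \<and> (\<forall>x\<in>{r..t}. a x \<in> units \<and> \<pi> (a x) = \<gamma> x)"
        using a b trans by (intro exI[of _ "\<lambda>x. if x \<le> s then a x else b x"]) auto
    qed
  next
    fix x :: real assume local: "0 \<le> x" "x \<le> 1"
    then have "\<gamma> x \<in> S" using \<gamma>(2) by (auto simp: path_image_def)
    then obtain a1 where "a1 \<in> units" "\<pi> a1 = \<gamma> x" using \<pi>_image by (metis imageE)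
    then obtain U \<sigma> where U: "openin (top_of_set S) U" "\<gamma> x \<in> U" "continuous_on U \<sigma>" "\<sigma> ` U \<subseteq> units" "\<And>y. y\<in>U \<Longrightarrow> \<pi> (\<sigma> y) = y"
      using sections by metis
    have "openin (top_of_set {0..1}) ({0..1} \<inter> \<gamma> -` U)"
      using \<gamma> U(1) unfolding path_def path_image_def by (intro continuous_openin_preimage) auto
    moreover have "x \<in> {0..1} \<inter> \<gamma> -` U" using U(2) local by auto
    ultimately obtain d where d: "d > 0" "\<And>y. y \<in> {0..1} \<Longrightarrow> dist y x < d \<Longrightarrow> \<gamma> y \<in> U"
      unfolding openin_euclidean_subtopology_iff by (metis Int_iff vimage_eq)
    show "\<exists>d>0. \<forall>s t. s \<le> x \<and> x \<le> t \<and> t - s < d \<longrightarrow> P s t"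
    proof (intro exI[of _ d] conjI allI impI)
      fix s t assume st: "s \<le> x \<and> x \<le> t \<and> t - s < d"
      show "P s t" unfolding P_def
      proof (intro impI ballI)
        fix a0 assume *: "0 \<le> s \<and> t \<le> 1" "a0 \<in> units" "\<pi> a0 = \<gamma> s"
        have \<gamma>U: "\<gamma> y \<in> U" if "y \<in> {s..t}" for y using that st * d(2)[of y] by (auto simp: dist_real_def)
        \<comment> \<open>The lift through the section starts at
          \<open>\<sigma> (\<gamma> s)\<close>, which lies over the same point as \<open>a0\<close>;
          right multiplication by \<open>c\<close>, an element of \<open>D\<close>, moves the start
          to \<open>a0\<close> without changing the image.\<close>
        define c where "c = iv (\<sigma> (\<gamma> s)) * a0"
        have s: "\<sigma> (\<gamma> s) \<in> units" "\<pi> (\<sigma> (\<gamma> s)) = \<gamma> s" using \<gamma>U[of s] st U(4,5) by auto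
        have c: "c \<in> units" "c \<in> D"
          using \<pi>_eq_iff[OF s(1) *(2)] s(2) *(3) unfolding c_def by (simp_all only: mult_units iv_units s(1) *(2) simp_thms)
        have "continuous_on {s..t} \<gamma>"
          using continuous_on_subset[OF \<gamma>(1)[unfolded path_def]] * by auto
        then have cont: "continuous_on {s..t} (\<lambda>y. \<sigma> (\<gamma> y))"
          by (rule continuous_on_compose2[OF U(3)]) (use \<gamma>U in auto)
        have "continuous_on {s..t} (\<lambda>y. \<sigma> (\<gamma> y) * c)"
          by (intro continuous_on_mult_E cont continuous_on_const) (use \<gamma>U U(4) c units_E in \<open>auto simp: image_subset_iff\<close>)
        moreover have "\<sigma> (\<gamma> s) * c = a0"
          using iv_units_right[OF s(1)] by (simp add: c_def flip: mult.assoc)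
        moreover have "\<sigma> (\<gamma> y) * c \<in> units \<and> \<pi> (\<sigma> (\<gamma> y) * c) = \<gamma> y" if "y \<in> {s..t}" for y
          using \<gamma>U[OF that] U(4,5) c by (auto simp: image_subset_iff mult_units \<pi>_mult_D)
        ultimately show "\<exists>a. continuous_on {s..t} a \<and> a s = a0 \<and> (\<forall>r\<in>{s..t}. a r \<in> units \<and> \<pi> (a r) = \<gamma> r)"
          by (intro exI[of _ "\<lambda>y. \<sigma> (\<gamma> y) * c"]) auto
      qed
    qed (rule d(1))
  qed simp
  moreover have "\<exists>a0\<in>units. \<pi> a0 = \<gamma> 0"
    using \<gamma>(2) \<pi>_image by (auto simp: path_image_def image_subset_iff) (metis atLeastAtMost_iff image_iff order_refl zero_le_one)
  ultimately obtain a where "continuous_on {0..1} a" "\<And>r. r\<in>{0..1} \<Longrightarrow> a r \<in> units \<and> \<pi> (a r) = \<gamma> r"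
    unfolding P_def by blast
  then show ?thesis using that[of a] by (auto simp: path_def path_image_def image_subset_iff)
qed

text \<open>The parameter rests at 1 on the second half of the interval. This leaves time to undo a
  deformation of the direction \<open>a - 1\<close> before the end point \<open>a\<close> has to be
  reached.\<close>

definition line_paths :: "'r \<Rightarrow> (real \<Rightarrow> complex) set" where
  "line_paths a = {w. continuous_on {0..1} w \<and> w 0 = 0 \<and> (\<forall>r\<in>{1/2..1}. w r = 1) \<and> (\<forall>r\<in>{0..1}. 1 + sc (w r) * (a - 1) \<in> units)}"

lemma line_paths_nonempty: assumes "a \<in> units" shows "line_paths a \<noteq> {}"
proof -
  obtain g where g: "path g" "pathstart g = 0" "pathfinish g = 1" "\<And>r. r \<in> {0..1} \<Longrightarrow> 1 + sc (g r) * (a - 1) \<in> units"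
    using complex_line_path[OF assms] by blast
  have "continuous_on {0..1} (\<lambda>r. g (min 1 (2 * r)))"
    by (rule continuous_on_compose2[OF g(1)[unfolded path_def]]) (auto intro!: continuous_intros)
  then have "(\<lambda>r. g (min 1 (2 * r))) \<in> line_paths a"
    using g(2-) by (auto simp: line_paths_def pathstart_def pathfinish_def min_def)
  then show ?thesis by blast
qed

text \<open>The path \<open>1 + w (a - 1)\<close> is deformed along \<open>\<kappa>\<close> into \<open>D\<close>, where its image becomes constant, and the
  other one is unfolded from there; the factor \<open>2 - 2 r\<close> cancels the motion of the end point.\<close>

lemma sweeps_line_paths:
  assumes a: "a \<in> units" and w: "w \<in> line_paths a" "w' \<in> line_paths a"
    and s: "s \<in> {0..1}" "\<gamma> s = \<pi> a"
  shows "sweeps S (\<pi> 1) \<gamma> s (\<lambda>r. \<pi> (1 + sc (w r) * (a - 1))) s (\<lambda>r. \<pi> (1 + sc (w' r) * (a - 1)))"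
proof -
  let ?Q = "{0..1::real} \<times> {0..1::real}"
  have aE: "a - 1 \<in> E" using a by (intro E_closed units_E)
  then obtain d \<kappa> where d: "d \<in> D" and \<kappa>: "path \<kappa>" "path_image \<kappa> \<subseteq> E" "pathstart \<kappa> = a - 1" "pathfinish \<kappa> = d"
     "\<And>l z. l \<in> path_image \<kappa> \<Longrightarrow> \<delta> (1 + sc z * l) = \<delta> (1 + sc z * (a - 1))"
    using isospectral_into_D[OF aE] unfolding isospectral_def by blast
  have \<kappa>E: "\<kappa> r \<in> E" if "r \<in> {0..1}" for r using that \<kappa>(2) by (auto simp: path_image_def)
  have unit: "1 + sc (v r) * \<kappa> t \<in> units" if "v \<in> {w, w'}" "r \<in> {0..1}" "t \<in> {0..1}" for v r t
  proof -
    have "1 + sc (v r) * (a - 1) \<in> units" using that w by (auto simp: line_paths_def)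
    then show ?thesis using \<kappa>(5)[of "\<kappa> t" "v r"] that \<kappa>E[OF that(3)] aE by (auto simp: line_units path_image_def)
  qed
  \<comment> \<open>\<open>m\<close> vanishes on both sides and on the top edge of the square, where
    nothing may be deformed. It is 1 on the lower half of the middle line, the part where the
    parameters still move.\<close>
  define m where "m x = min (min (2 * fst x) (2 - 2 * fst x)) (2 - 2 * snd x)" for x :: "real \<times> real"
  define L where "L v x = \<pi> (1 + sc (v (snd x)) * \<kappa> (m x))" for v x
  have m: "m x \<in> {0..1}" if "x \<in> ?Q" for x using that by (auto simp: m_def)
  have L: "continuous_on ?Q (L v)" if "v \<in> {w, w'}" for v
  proof -
    have "continuous_on ?Q (\<lambda>x. v (snd x))"
      by (rule continuous_on_compose2[of "{0..1}" v])
        (use that w in \<open>auto simp: line_paths_def intro!: continuous_intros\<close>)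
    moreover have "continuous_on ?Q (\<lambda>x. \<kappa> (m x))"
      by (rule continuous_on_compose2[OF \<kappa>(1)[unfolded path_def]])
        (use m in \<open>auto simp: m_def[abs_def] intro!: continuous_intros\<close>)
    ultimately show ?thesis unfolding L_def[abs_def]
      by (intro continuous_on_\<pi> continuous_on_line) (use unit[OF that] m \<kappa>E in auto)
  qed
  let ?K = "\<lambda>x. if fst x \<le> 1/2 then L w x else L w' x"
  \<comment> \<open>On the lower half of the middle line both elements lie in \<open>D\<close> and
    have image \<open>\<pi> 1\<close>; on the upper half both parameters are 1.\<close>
  have mid: "L w x = L w' x" if "x \<in> ?Q" "fst x = 1/2" for x
  proof (cases "snd x \<le> 1/2")
    case True
    then have "m x = 1" using that by (auto simp: m_def)
    then have "\<kappa> (m x) \<in> D" using d \<kappa>(4) by (simp add: pathfinish_def)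
    then have "1 + sc z * \<kappa> (m x) \<in> D" for z using sc_D[of 1] by (simp add: sc_one add_D mult_D sc_D)
    then have "\<pi> (1 + sc (v (snd x)) * \<kappa> (m x)) = \<pi> 1" if "v \<in> {w,w'}" for v
      using unit[of v "snd x" "m x"] m[OF \<open>x \<in> ?Q\<close>] \<open>x \<in> ?Q\<close> that \<pi>_mult_D[OF one_units] by fastforce
    then show ?thesis by (simp add: L_def)
  next
    case False
    then have "w (snd x) = 1" "w' (snd x) = 1" using that w by (auto simp: line_paths_def)
    then show ?thesis by (simp add: L_def)
  qed
  have K: "continuous_on ?Q ?K"
    by (rule continuous_on_cases_le)
      (use L mid in \<open>auto intro!: continuous_intros intro: continuous_on_subset[OF L]\<close>)
  have w1: "w 0 = 0" "w' 0 = 0" "w 1 = 1" "w' 1 = 1" using w by (auto simp: line_paths_def)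
  have \<kappa>0: "\<kappa> 0 = a - 1" using \<kappa>(3) by (simp add: pathstart_def)
  show ?thesis
  proof (rule sweepsI[OF _ _ _ _ K])
    fix \<tau> r :: real assume "\<tau> \<in> {0..1}" "r \<in> {0..1}"
    then show "?K (\<tau>, r) \<in> S" using unit m[of "(\<tau>, r)"] by (auto simp: L_def intro!: \<pi>_S)
  next
    show "continuous_on {0..1::real} (\<lambda>_. s)" by (rule continuous_on_const)
    fix r :: real assume "r \<in> {0..1}"
    then show "?K (0, r) = \<pi> (1 + sc (w r) * (a - 1))" "?K (1, r) = \<pi> (1 + sc (w' r) * (a - 1))"
      using \<kappa>0 by (auto simp: L_def m_def min_def)
  qed (use s w1 \<kappa>0 in \<open>auto simp: L_def m_def min_def sc_zero sc_one\<close>)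
qed

text \<open>A line path that avoids the singular points for \<open>a x\<close> also avoids them for
  all nearby \<open>a t\<close>, by the tube lemma over the compact parameter interval, and
  following it while \<open>t\<close> moves is a sweep. Between such pieces the line path is
  exchanged by \<open>sweeps_line_paths\<close>; bisection puts everything together.\<close>

lemma sweeps_lifted_path:
  assumes a: "path a" "path_image a \<subseteq> units" and \<gamma>: "\<And>t. t \<in> {0..1} \<Longrightarrow> \<gamma> t = \<pi> (a t)"
    and w: "w \<in> line_paths (a 0)" "w' \<in> line_paths (a 1)"
  shows "sweeps S (\<pi> 1) \<gamma> 0 (\<lambda>r. \<pi> (1 + sc (w r) * (a 0 - 1))) 1 (\<lambda>r. \<pi> (1 + sc (w' r) * (a 1 - 1)))"
proof -
  let ?f = "\<lambda>w t r. \<pi> (1 + sc (w r) * (a t - 1))"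
  let ?Q = "{0..1::real} \<times> {0..1::real}"
  have au: "a t \<in> units" if "t \<in> {0..1}" for t using a(2) that by (auto simp: path_image_def)
  define P where "P s t \<longleftrightarrow> (0 \<le> s \<and> t \<le> 1 \<longrightarrow> (\<forall>w\<in>line_paths (a s). \<forall>w'\<in>line_paths (a t).
    sweeps S (\<pi> 1) \<gamma> s (?f w s) t (?f w' t)))" for s t
  have "P 0 1"
  proof (rule Bolzano)
    fix r s t assume trans: "P r s" "P s t" "r \<le> s" "s \<le> t"
    show "P r t" unfolding P_def
    proof (intro impI ballI)
      fix w w' assume *: "0 \<le> r \<and> t \<le> 1" "w \<in> line_paths (a r)" "w' \<in> line_paths (a t)"
      have bounds: "0 \<le> r \<and> s \<le> 1" "0 \<le> s \<and> t \<le> 1" using trans(3,4) * by auto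
      obtain v where v: "v \<in> line_paths (a s)" using line_paths_nonempty[OF au, of s] bounds by auto
      show "sweeps S (\<pi> 1) \<gamma> r (?f w r) t (?f w' t)"
        using trans(1)[unfolded P_def, rule_format, OF bounds(1) *(2) v]
          trans(2)[unfolded P_def, rule_format, OF bounds(2) v *(3)] by (rule sweeps_trans)
    qed
  next
    fix x :: real assume local: "0 \<le> x" "x \<le> 1"
    then obtain v where v: "v \<in> line_paths (a x)" using line_paths_nonempty[OF au, of x] by auto
    have vcont: "continuous_on {0..1} v" using v by (simp add: line_paths_def)
    have "continuous_on ?Q (\<lambda>y. a (fst y))"
      by (rule continuous_on_compose2[OF a(1)[unfolded path_def]]) (auto intro!: continuous_intros)
    moreover have "continuous_on ?Q (\<lambda>y. v (snd y))"
      by (rule continuous_on_compose2[OF vcont]) (auto intro!: continuous_intros)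
    \<comment> \<open>Continuity is available for sums, so subtracting 1 is written as adding
      \<open>sc (-1)\<close>.\<close>
    ultimately have cont: "continuous_on ?Q (\<lambda>y. 1 + sc (v (snd y)) * (a (fst y) + sc (-1)))"
      by (intro continuous_on_line continuous_on_add_E continuous_on_const)
        (auto intro!: E_closed units_E[OF au])
    then have contl: "continuous_on ?Q (\<lambda>y. 1 + sc (v (snd y)) * (a (fst y) - 1))"
      by (simp add: sc_minus sc_one)
    have inE: "1 + sc (v (snd y)) * (a (fst y) - 1) \<in> E" if "y \<in> ?Q" for y
      using that by (auto intro!: E_closed units_E[OF au])
    have cont\<delta>: "continuous_on ?Q (\<lambda>y. \<delta> (1 + sc (v (snd y)) * (a (fst y) - 1)))"
      by (intro continuous_on_\<delta> contl) (use inE in auto)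
    have "\<exists>d>0. \<forall>t\<in>{0..1}. dist t x < d \<longrightarrow> v \<in> line_paths (a t)"
    proof -
      have "openin (top_of_set ?Q) (?Q \<inter> (\<lambda>y. \<delta> (1 + sc (v (snd y)) * (a (fst y) - 1))) -` (- {0}))"
        by (intro continuous_openin_preimage_gen cont\<delta>) auto
      then obtain T where T: "open T" "?Q \<inter> (\<lambda>y. \<delta> (1 + sc (v (snd y)) * (a (fst y) - 1))) -` (- {0}) = ?Q \<inter> T"
        unfolding openin_open by blast
      have "{x} \<times> {0..1} \<subseteq> T"
      proof
        fix y assume y: "y \<in> {x} \<times> {0..1::real}"
        then have "y \<in> ?Q" using local by auto
        moreover have "\<delta> (1 + sc (v (snd y)) * (a (fst y) - 1)) \<noteq> 0"
          using v y by (auto simp: line_paths_def units_def)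
        ultimately show "y \<in> T" using T(2) by blast
      qed
      then obtain X0 where X0: "x \<in> X0" "open X0" "X0 \<times> {0..1} \<subseteq> T"
        using Elementary_Topology.tube_lemma[of "{0..1::real}" T x] T(1) by auto
      obtain d where d: "d > 0" "ball x d \<subseteq> X0" using X0 open_contains_ball by blast
      have "v \<in> line_paths (a t)" if t: "t \<in> {0..1}" "dist t x < d" for t
      proof -
        have "1 + sc (v r) * (a t - 1) \<in> units" if "r \<in> {0..1}" for r
        proof -
          have "(t, r) \<in> ?Q \<inter> T" using t that d X0 by (auto simp: dist_commute subset_iff)
          then have "\<delta> (1 + sc (v r) * (a t - 1)) \<noteq> 0" using T(2) by (auto simp: set_eq_iff)
          then show ?thesis using inE[of "(t, r)"] t that by (auto simp: units_def)
        qed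
        then show ?thesis using v by (auto simp: line_paths_def)
      qed
      then show ?thesis using d(1) by blast
    qed
    then obtain d where d: "d > 0" "\<And>t. t \<in> {0..1} \<Longrightarrow> dist t x < d \<Longrightarrow> v \<in> line_paths (a t)" by blast
    show "\<exists>d>0. \<forall>s t. s \<le> x \<and> x \<le> t \<and> t - s < d \<longrightarrow> P s t"
    proof (intro exI[of _ d] conjI allI impI)
      fix s t assume st: "s \<le> x \<and> x \<le> t \<and> t - s < d"
      show "P s t" unfolding P_def
      proof (intro impI ballI)
        fix w w' assume *: "0 \<le> s \<and> t \<le> 1" and w: "w \<in> line_paths (a s)" "w' \<in> line_paths (a t)"
        have vin: "v \<in> line_paths (a r)" if "r \<in> {s..t}" for r using d(2)[of r] that st * by (auto simp: dist_real_def)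
        have s01: "s \<in> {0..1}" "t \<in> {0..1}" using st * by auto
        define \<theta> where "\<theta> \<tau> = s + \<tau> * (t - s)" for \<tau>
        have \<theta>: "\<theta> \<tau> \<in> {s..t}" if "\<tau> \<in> {0..1}" for \<tau>
          using that st by (auto simp: \<theta>_def mult_left_le_one_le) (metis add.commute diff_ge_0_iff_ge le_diff_eq mult_left_le_one_le order.trans)
        have "sweeps S (\<pi> 1) \<gamma> s (?f v s) t (?f v t)"
        proof (rule sweepsI[where K = "\<lambda>x. \<pi> (1 + sc (v (snd x)) * (a (\<theta> (fst x)) - 1))"])
          show "continuous_on {0..1} \<theta>" unfolding \<theta>_def[abs_def] by (intro continuous_intros)
          have "continuous_on ?Q (\<lambda>x. (\<theta> (fst x), snd x))" unfolding \<theta>_def[abs_def] by (intro continuous_intros)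
          moreover have "(\<theta> (fst x), snd x) \<in> ?Q" if "x \<in> ?Q" for x
            using \<theta>[of "fst x"] s01 that by (auto simp: mem_Times_iff)
          ultimately have "continuous_on ?Q (\<lambda>x. 1 + sc (v (snd x)) * (a (\<theta> (fst x)) - 1))"
            using continuous_on_compose2[OF contl, of ?Q "\<lambda>x. (\<theta> (fst x), snd x)"]
            by (simp add: image_subset_iff)
          moreover have u: "1 + sc (v r) * (a (\<theta> \<tau>) - 1) \<in> units" if "\<tau> \<in> {0..1}" "r \<in> {0..1}" for \<tau> r
            using vin[OF \<theta>[OF that(1)]] that(2) by (auto simp: line_paths_def)
          ultimately show "continuous_on ?Q (\<lambda>x. \<pi> (1 + sc (v (snd x)) * (a (\<theta> (fst x)) - 1)))"
            by (intro continuous_on_\<pi>) auto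
          show "\<pi> (1 + sc (v (snd (\<tau>, r))) * (a (\<theta> (fst (\<tau>, r))) - 1)) \<in> S" if "\<tau> \<in> {0..1}" "r \<in> {0..1}" for \<tau> r
            using u[OF that] by (simp add: \<pi>_S)
          show "\<theta> \<tau> \<in> {0..1}" if "\<tau> \<in> {0..1}" for \<tau> using \<theta>[OF that] s01 by auto
          fix \<tau> :: real assume "\<tau> \<in> {0..1}"
          then have "\<theta> \<tau> \<in> {0..1}" using \<theta>[of \<tau>] s01 by auto
          then show "\<pi> (1 + sc (v (snd (\<tau>, 1))) * (a (\<theta> (fst (\<tau>, 1))) - 1)) = \<gamma> (\<theta> \<tau>)"
            using v \<gamma> by (auto simp: line_paths_def sc_one)
        qed (use v in \<open>auto simp: \<theta>_def line_paths_def sc_zero\<close>)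
        moreover have "sweeps S (\<pi> 1) \<gamma> s (?f w s) s (?f v s)" "sweeps S (\<pi> 1) \<gamma> t (?f v t) t (?f w' t)"
          using vin st s01 w au \<gamma> by (auto intro!: sweeps_line_paths)
        ultimately show "sweeps S (\<pi> 1) \<gamma> s (?f w s) t (?f w' t)"
          by (blast intro: sweeps_trans)
      qed
    qed (rule d(1))
  qed simp
  then show ?thesis using w by (simp add: P_def)
qed

text \<open>For a closed lift the two sides of the sweep can be taken equal. With its coordinates
  exchanged the sweep is then a homotopy of loops from the constant loop at \<open>\<pi> 1\<close>
  to a reparametrisation of the given one.\<close>

theorem simply_connected_orbit: "simply_connected S"
proof -
  have null: "homotopic_loops S \<gamma> (\<lambda>_. \<pi> 1)"
    if \<gamma>: "path \<gamma>" "path_image \<gamma> \<subseteq> S" "pathfinish \<gamma> = pathstart \<gamma>" for \<gamma>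
  proof -
    obtain a where a: "path a" "path_image a \<subseteq> units" "\<And>t. t \<in> {0..1} \<Longrightarrow> \<pi> (a t) = \<gamma> t"
      using lift_path[OF \<gamma>(1,2)] by blast
    define b where "b = iv (a 1) * a 0"
    have au: "a t \<in> units" if "t \<in> {0..1}" for t using a(2) that by (auto simp: path_image_def)
    have "\<pi> (a 1) = \<pi> (a 0)" using a(3) \<gamma>(3) by (simp add: pathfinish_def pathstart_def)
    then have b: "b \<in> units" "b \<in> D" using au \<pi>_eq_iff[of "a 1" "a 0"] by (auto simp: b_def mult_units iv_units)
    obtain g where g: "path g" "pathstart g = 0" "pathfinish g = 1" "\<And>r. r \<in> {0..1} \<Longrightarrow> 1 + sc (g r) * (b - 1) \<in> units"
      using complex_line_path[OF b(1)] by blast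
    \<comment> \<open>The whole line through 1 and \<open>b\<close> lies in the algebra
      \<open>D\<close>, so the path \<open>c\<close> that closes up the lift has constant
      image.\<close>
    have bD: "1 + sc z * (b - 1) \<in> D" for z
      using b(2) add_D[OF sc_D[of 1] mult_D[OF sc_D[of z] add_D[OF b(2) sc_D[of "-1"]]]] by (simp add: sc_one sc_minus)
    define c where "c r = a 1 * (1 + sc (g r) * (b - 1))" for r
    have cu: "c r \<in> units" "\<pi> (c r) = \<pi> (a 1)" if "r \<in> {0..1}" for r
      using g(4)[OF that] au[of 1] bD[of "g r"] by (auto simp: c_def mult_units \<pi>_mult_D)
    have "b \<in> E" "a 1 \<in> E" using b(1) au[of 1] units_E by auto
    then have pc: "path c" using g(1) unfolding path_def c_def[abs_def]
      by (intro continuous_on_mult_E continuous_on_line continuous_on_const) (auto intro!: E_closed)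
    have c01: "pathstart c = a 1" "pathfinish c = a 0"
      using g(2,3) iv_units_right[OF au[of 1]]
      by (auto simp: c_def b_def pathstart_def pathfinish_def sc_zero sc_one simp flip: mult.assoc)
    have "path (a +++ c)"
      using a(1) pc c01 by (intro path_join_imp) (auto simp: pathfinish_def)
    moreover have "path_image (a +++ c) \<subseteq> units"
      using au cu by (auto simp: path_image_def joinpaths_def)
    ultimately have ac: "path (a +++ c)" "path_image (a +++ c) \<subseteq> units" "(a +++ c) 0 = a 0" "(a +++ c) 1 = a 0"
      using c01 by (auto simp: joinpaths_def pathfinish_def)
    \<comment> \<open>The closed lift \<open>a +++ c\<close> lies over \<open>\<gamma>\<close> run
      at double speed and then resting at its end point.\<close>
    define \<theta> :: "real \<Rightarrow> real" where "\<theta> r = min 1 (2 * r)" for r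
    have \<theta>: "continuous_on {0..1} \<theta>" "\<theta> ` {0..1} \<subseteq> {0..1}" "\<theta> 0 = 0" "\<theta> 1 = 1"
      unfolding \<theta>_def[abs_def] by (auto intro!: continuous_intros)
    have "(\<gamma> \<circ> \<theta>) t = \<pi> ((a +++ c) t)" if "t \<in> {0..1}" for t
      using that a(3)[of "2 * t"] a(3)[of 1] cu[of "2 * t - 1"] by (auto simp: \<theta>_def joinpaths_def)
    moreover obtain w where "w \<in> line_paths (a 0)" using line_paths_nonempty[OF au[of 0]] by auto
    ultimately have "sweeps S (\<pi> 1) (\<gamma> \<circ> \<theta>) 0 (\<lambda>r. \<pi> (1 + sc (w r) * (a 0 - 1))) 1 (\<lambda>r. \<pi> (1 + sc (w r) * (a 0 - 1)))"
      using sweeps_lifted_path[OF ac(1,2), of "\<gamma> \<circ> \<theta>" w w] ac by auto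
    then obtain \<eta> :: "real \<Rightarrow> real" and K :: "real \<times> real \<Rightarrow> _" where K: "continuous_on {0..1} \<eta>" "\<eta> ` {0..1} \<subseteq> {0..1}" "\<eta> 0 = 0" "\<eta> 1 = 1"
      "continuous_on ({0..1} \<times> {0..1}) K" "K ` ({0..1} \<times> {0..1}) \<subseteq> S"
      "\<forall>r\<in>{0..1}. K (0, r) = \<pi> (1 + sc (w r) * (a 0 - 1)) \<and> K (1, r) = \<pi> (1 + sc (w r) * (a 0 - 1))"
      "\<forall>\<tau>\<in>{0..1}. K (\<tau>, 0) = \<pi> 1 \<and> K (\<tau>, 1) = (\<gamma> \<circ> \<theta>) (\<eta> \<tau>)"
      unfolding sweeps_def by blast
    have "homotopic_loops S (\<lambda>_. \<pi> 1) (\<gamma> \<circ> (\<theta> \<circ> \<eta>))"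
      unfolding homotopic_loops
    proof (intro exI[of _ "\<lambda>x. K (snd x, fst x)"] conjI)
      show "continuous_on ({0..1} \<times> {0..1}) (\<lambda>x. K (snd x, fst x))"
        by (intro continuous_on_compose2[OF K(5)] continuous_intros) auto
    qed (use K in \<open>auto simp: pathfinish_def pathstart_def image_subset_iff\<close>)
    moreover have "homotopic_loops S \<gamma> (\<gamma> \<circ> (\<theta> \<circ> \<eta>))"
      by (rule homotopic_loops_reparametrize[OF \<gamma>])
        (use \<theta> K(1-4) in \<open>auto intro: continuous_on_compose2 simp: image_subset_iff\<close>)
    ultimately show ?thesis using homotopic_loops_trans homotopic_loops_sym by blast
  qed
  then show ?thesis
    unfolding simply_connected_def by (metis homotopic_loops_trans homotopic_loops_sym)
qed

end

section \<open>Matrices as operators on sequences\<close>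

definition cscale :: "complex \<Rightarrow> (nat \<Rightarrow> complex) \<Rightarrow> nat \<Rightarrow> complex" where
  "cscale c v = (\<lambda>i. c * v i)"

lemma cscale_apply [simp]: "cscale c v i = c * v i" by (simp add: cscale_def)

lemma sum_seq_apply: "(sum f A :: nat \<Rightarrow> complex) i = (\<Sum>a\<in>A. f a i)"
  by (induction A rule: infinite_finite_induct) auto

global_interpretation seq: vector_space cscale
  by unfold_locales (auto simp: cscale_def plus_fun_def algebra_simps)

global_interpretation seqs: vector_space_pair cscale cscale ..

text \<open>The size \<open>N\<close> of the matrices is found inside a proof and cannot be part of
  a type. Operators on all sequences give one ring that serves every \<open>N\<close>.\<close>

typedef lop = "{f. Vector_Spaces.linear cscale cscale f}"
  morphisms app Abs_lop
  using seq.linear_id by (auto simp: id_def)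

lemma linear_app: "Vector_Spaces.linear cscale cscale (app f)"
  using app by simp

lemma app_add [simp]: "app f (u + v) = app f u + app f v"
  and app_scale [simp]: "app f (cscale c u) = cscale c (app f u)"
  and app_zero [simp]: "app f 0 = 0"
  and app_diff [simp]: "app f (u - v) = app f u - app f v"
  and app_uminus [simp]: "app f (- u) = - app f u"
  and app_sum: "app f (sum g J) = (\<Sum>j\<in>J. app f (g j))"
  using linear_app[of f] by (auto simp: seqs.linear_add seqs.linear_scale seqs.linear_0 seqs.linear_diff seqs.linear_neg seqs.linear_sum)

lemma linear_cscale_iff:
  "Vector_Spaces.linear cscale cscale f \<longleftrightarrow> (\<forall>u v. f (u + v) = f u + f v) \<and> (\<forall>c u. f (cscale c u) = cscale c (f u))"
  using seq.vector_space_axioms by (auto simp: Vector_Spaces.linear_iff)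

lemma app_Abs_lop: "Vector_Spaces.linear cscale cscale f \<Longrightarrow> app (Abs_lop f) = f"
  by (rule Abs_lop_inverse) simp

lemma lop_eqI: "(\<And>v. app f v = app g v) \<Longrightarrow> f = g"
  by (metis app_inject ext)

instantiation lop :: ring_1
begin
definition zero_lop :: lop where "zero_lop = Abs_lop (\<lambda>_. 0)"
definition one_lop :: lop where "one_lop = Abs_lop (\<lambda>v. v)"
definition plus_lop :: "lop \<Rightarrow> lop \<Rightarrow> lop" where "plus_lop f g = Abs_lop (\<lambda>v. app f v + app g v)"
definition minus_lop :: "lop \<Rightarrow> lop \<Rightarrow> lop" where "minus_lop f g = Abs_lop (\<lambda>v. app f v - app g v)"
definition uminus_lop :: "lop \<Rightarrow> lop" where "uminus_lop f = Abs_lop (\<lambda>v. - app f v)"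
definition times_lop :: "lop \<Rightarrow> lop \<Rightarrow> lop" where "times_lop f g = Abs_lop (\<lambda>v. app f (app g v))"

lemma app_0 [simp]: "app 0 v = 0"
  and app_1 [simp]: "app 1 v = v"
  and app_plus [simp]: "app (f + g) v = app f v + app g v"
  and app_minus [simp]: "app (f - g) v = app f v - app g v"
  and app_neg [simp]: "app (- f) v = - app f v"
  and app_times [simp]: "app (f * g) v = app f (app g v)"
  unfolding zero_lop_def one_lop_def plus_lop_def minus_lop_def uminus_lop_def times_lop_def
  by (subst app_Abs_lop; simp add: linear_cscale_iff fun_eq_iff algebra_simps)+

instance
proof
  fix a b c :: lop
  show "a * b * c = a * (b * c)" by (rule lop_eqI) simp
  show "1 * a = a" by (rule lop_eqI) simp
  show "a * 1 = a" by (rule lop_eqI) simp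
  show "a + b + c = a + (b + c)" by (rule lop_eqI) (simp add: add.assoc)
  show "a + b = b + a" by (rule lop_eqI) (simp add: add.commute)
  show "0 + a = a" by (rule lop_eqI) simp
  show "- a + a = 0" by (rule lop_eqI) simp
  show "a - b = a + - b" by (rule lop_eqI) simp
  show "(a + b) * c = a * c + b * c" by (rule lop_eqI) simp
  show "a * (b + c) = a * b + a * c" by (rule lop_eqI) simp
  have "app 0 (\<lambda>_. 1) 0 \<noteq> app 1 (\<lambda>_. 1) 0"
    by simp
  then show "(0::lop) \<noteq> 1" by metis
qed
end

lemma app_sum_lop: "app (sum f J) v = (\<Sum>j\<in>J. app (f j) v)"
  by (induction J rule: infinite_finite_induct) auto

section \<open>Scalars, matrix entries and the entrywise topology\<close>

definition scal :: "complex \<Rightarrow> lop" where "scal c = Abs_lop (cscale c)"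

lemma app_scal [simp]: "app (scal c) v = cscale c v"
  unfolding scal_def by (subst app_Abs_lop) (auto simp: linear_cscale_iff fun_eq_iff algebra_simps)

lemma scal_1: "scal 1 = 1" and scal_add: "scal (z + w) = scal z + scal w" and scal_mult: "scal (z * w) = scal z * scal w"
  and scal_uminus: "scal (- z) = - scal z"
  by (auto intro!: lop_eqI simp: fun_eq_iff algebra_simps)

lemma scal_central: "f * scal z = scal z * f"
  by (rule lop_eqI) simp

definition unit_seq :: "nat \<Rightarrow> nat \<Rightarrow> complex" where
  "unit_seq j = (\<lambda>i. if i = j then 1 else 0)"

definition ent :: "lop \<Rightarrow> nat \<Rightarrow> nat \<Rightarrow> complex" where
  "ent f i j = app f (unit_seq j) i"

text \<open>Entries do not determine an operator on infinite sequences, so this topology does not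
  separate all operators; it does separate those in \<open>blocks N\<close>, which are given by
  finitely many entries.\<close>

instantiation lop :: topological_space
begin
definition open_lop :: "lop set \<Rightarrow> bool" where
  "open_lop U \<longleftrightarrow> (\<exists>V. open V \<and> U = ent -` V)"
instance
proof
  show "open (UNIV :: lop set)" unfolding open_lop_def by (intro exI[of _ UNIV]) auto
  fix S T :: "lop set" assume "open S" "open T"
  then obtain V W where "open V" "S = ent -` V" "open W" "T = ent -` W" unfolding open_lop_def by blast
  then show "open (S \<inter> T)" unfolding open_lop_def by (intro exI[of _ "V \<inter> W"]) auto
next
  fix K :: "lop set set" assume "\<forall>S\<in>K. open S"
  then obtain V where "\<And>S. S \<in> K \<Longrightarrow> open (V S) \<and> S = ent -` V S" unfolding open_lop_def by metis
  then show "open (\<Union> K)" unfolding open_lop_def by (intro exI[of _ "\<Union> (V ` K)"]) auto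
qed
end

lemma continuous_on_lop_iff:
  "continuous_on T f \<longleftrightarrow> (\<forall>i j. continuous_on T (\<lambda>x. ent (f x) i j))"
proof -
  have "continuous_on T f \<longleftrightarrow> continuous_on T (\<lambda>x. ent (f x))"
  proof
    assume "continuous_on T f"
    moreover have "continuous_on UNIV ent"
      unfolding continuous_on_open_vimage[OF open_UNIV] open_lop_def by auto
    ultimately show "continuous_on T (\<lambda>x. ent (f x))"
      using continuous_on_compose2[of UNIV ent T f] by auto
  next
    assume c: "continuous_on T (\<lambda>x. ent (f x))"
    show "continuous_on T f" unfolding continuous_on_open_invariant
    proof (intro allI impI)
      fix B :: "lop set" assume "open B"
      then obtain V where "open V" "B = ent -` V" unfolding open_lop_def by blast
      then show "\<exists>A. open A \<and> A \<inter> T = f -` B \<inter> T"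
        using c unfolding continuous_on_open_invariant by (auto simp: vimage_def)
    qed
  qed
  then show ?thesis
    using continuous_on_product_then_coordinatewise[of T "\<lambda>x. ent (f x)"]
      continuous_on_product_then_coordinatewise[of T "\<lambda>x. ent (f x) i" for i]
    by (auto intro!: continuous_on_coordinatewise_then_product)
qed

definition cutop :: "nat \<Rightarrow> lop" where "cutop N = Abs_lop (\<lambda>v i. if i < N then v i else 0)"

lemma app_cutop: "app (cutop N) v = (\<lambda>i. if i < N then v i else 0)"
  unfolding cutop_def by (subst app_Abs_lop) (auto simp: linear_cscale_iff fun_eq_iff)

lemma cutop_idem: "cutop N * cutop N = cutop N"
  by (rule lop_eqI) (simp add: app_cutop fun_eq_iff)

text \<open>Operators acting as an \<open>N \<times> N\<close> matrix on the first \<open>N\<close> coordinates and as a scalar on the others; the scalar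
  makes this an algebra containing the unit of \<open>lop\<close>.\<close>

definition blocks :: "nat \<Rightarrow> lop set" where
  "blocks N = {f. f * cutop N = cutop N * f \<and> (\<exists>c. f * (1 - cutop N) = scal c * (1 - cutop N))}"

lemma blocks_scal: "scal z \<in> blocks N"
  by (auto simp: blocks_def scal_central[symmetric])

lemma blocks_cutop: "cutop N \<in> blocks N"
proof -
  have "cutop N * (1 - cutop N) = scal 0 * (1 - cutop N)"
    by (rule lop_eqI) (simp add: app_cutop fun_eq_iff)
  then show ?thesis by (auto simp: blocks_def)
qed

lemma blocks_add: assumes "f \<in> blocks N" "g \<in> blocks N" shows "f + g \<in> blocks N"
proof -
  obtain c d where "f * (1 - cutop N) = scal c * (1 - cutop N)" "g * (1 - cutop N) = scal d * (1 - cutop N)"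
    using assms by (auto simp: blocks_def)
  then have "(f + g) * (1 - cutop N) = scal (c + d) * (1 - cutop N)" by (simp add: distrib_right scal_add)
  then show ?thesis using assms by (auto simp: blocks_def distrib_left distrib_right)
qed

lemma blocks_mult: assumes "f \<in> blocks N" "g \<in> blocks N" shows "f * g \<in> blocks N"
proof -
  obtain c d where f: "f * (1 - cutop N) = scal c * (1 - cutop N)" and g: "g * (1 - cutop N) = scal d * (1 - cutop N)"
    using assms by (auto simp: blocks_def)
  have "f * g * (1 - cutop N) = f * scal d * (1 - cutop N)" using g by (simp add: mult.assoc)
  also have "\<dots> = scal d * (scal c * (1 - cutop N))" using f by (simp add: scal_central mult.assoc)
  finally have "f * g * (1 - cutop N) = scal (d * c) * (1 - cutop N)" by (simp add: scal_mult mult.assoc)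
  moreover have "f * g * cutop N = cutop N * (f * g)" using assms by (simp add: blocks_def) (metis mult.assoc)
  ultimately show ?thesis by (auto simp: blocks_def)
qed

lemma blocks_one: "1 \<in> blocks N" using blocks_scal[of 1] by (simp add: scal_1)

lemma blocks_uminus: "f \<in> blocks N \<Longrightarrow> - f \<in> blocks N"
  using blocks_mult[OF blocks_scal[of "-1"], of f N] by (simp add: scal_1 scal_uminus)

lemma blocks_diff: "f \<in> blocks N \<Longrightarrow> g \<in> blocks N \<Longrightarrow> f - g \<in> blocks N"
  using blocks_add[of f N "- g"] blocks_uminus by simp

lemma seq_expand: "app (cutop N) v = (\<Sum>j<N. cscale (v j) (unit_seq j))"
  by (auto simp: app_cutop fun_eq_iff sum_seq_apply unit_seq_def if_distrib cong: if_cong)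

text \<open>\<open>N\<close> is the first index outside the block, so \<open>ent f N N\<close> is
  the scalar by which \<open>f\<close> acts there.\<close>

lemma blocks_app:
  assumes f: "f \<in> blocks N"
  shows "app f v i = (if i < N then (\<Sum>j<N. ent f i j * v j) else ent f N N * v i)"
proof -
  obtain c where c: "f * (1 - cutop N) = scal c * (1 - cutop N)" and comm: "f * cutop N = cutop N * f"
    using f by (auto simp: blocks_def)
  have 1: "app f (u - app (cutop N) u) = cscale c (u - app (cutop N) u)" for u
    using arg_cong[OF c, of "\<lambda>h. app h u"] by (simp add: seq.scale_right_diff_distrib)
  have 2: "app f (app (cutop N) u) = app (cutop N) (app f u)" for u
    using arg_cong[OF comm, of "\<lambda>h. app h u"] by simp
  have "unit_seq N - app (cutop N) (unit_seq N) = unit_seq N" by (auto simp: app_cutop unit_seq_def fun_eq_iff)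
  then have cN: "c = ent f N N" using 1[of "unit_seq N"] by (simp add: ent_def unit_seq_def)
  show ?thesis
  proof (cases "i < N")
    case True
    then have "app f v i = app (cutop N) (app f v) i" by (simp add: app_cutop)
    also have "\<dots> = (\<Sum>j<N. ent f i j * v j)"
      unfolding 2[symmetric] by (simp add: seq_expand app_sum ent_def sum_seq_apply mult.commute)
    finally show ?thesis using True by simp
  next
    case False
    have "app f v i = app f (app (cutop N) v) i + app f (v - app (cutop N) v) i" by simp
    also have "app f (app (cutop N) v) i = 0" unfolding 2 using False by (simp add: app_cutop)
    finally show ?thesis unfolding 1 using False cN by (simp add: app_cutop)
  qed
qed

lemma ent_blocks:
  assumes "f \<in> blocks N"
  shows "ent f i j = (if i < N then if j < N then ent f i j else 0 else if i = j then ent f N N else 0)"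
  using blocks_app[OF assms, of "unit_seq j" i]
  by (auto simp: ent_def[of f i j] unit_seq_def if_distrib cong: if_cong)

lemma blocks_eqI:
  assumes "f \<in> blocks N" "g \<in> blocks N" "\<And>i j. i < N \<Longrightarrow> j < N \<Longrightarrow> ent f i j = ent g i j" "ent f N N = ent g N N"
  shows "f = g"
  by (rule lop_eqI) (auto simp: fun_eq_iff blocks_app[OF assms(1)] blocks_app[OF assms(2)] assms)

lemma continuous_on_blocks:
  assumes "f ` T \<subseteq> blocks N" "\<And>i j. i < N \<Longrightarrow> j < N \<Longrightarrow> continuous_on T (\<lambda>x. ent (f x) i j)" "continuous_on T (\<lambda>x. ent (f x) N N)"
  shows "continuous_on T f"
  unfolding continuous_on_lop_iff
proof (intro allI)
  fix i j
  have "continuous_on T (\<lambda>x. ent (f x) i j) \<longleftrightarrow> continuous_on T (\<lambda>x. if i < N then if j < N then ent (f x) i j else 0 else if i = j then ent (f x) N N else 0)"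
    using assms(1) by (intro continuous_on_cong refl ent_blocks) auto
  also have \<dots> using assms(2,3) by (cases "i < N"; cases "j < N"; cases "i = j") auto
  finally show "continuous_on T (\<lambda>x. ent (f x) i j)" .
qed

lemma continuous_on_ent: "continuous_on T f \<Longrightarrow> continuous_on T (\<lambda>x. ent (f x) i j)"
  by (simp add: continuous_on_lop_iff)

definition block_op :: "nat \<Rightarrow> (nat \<Rightarrow> nat \<Rightarrow> complex) \<Rightarrow> complex \<Rightarrow> lop" where
  "block_op N m c = Abs_lop (\<lambda>v i. if i < N then (\<Sum>j<N. m i j * v j) else c * v i)"

lemma app_block_op: "app (block_op N m c) v = (\<lambda>i. if i < N then (\<Sum>j<N. m i j * v j) else c * v i)"
proof -
  have "Vector_Spaces.linear cscale cscale (\<lambda>v i. if i < N then (\<Sum>j<N. m i j * v j) else c * v i)"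
    by (auto simp: linear_cscale_iff fun_eq_iff algebra_simps sum.distrib sum_distrib_left)
  then show ?thesis unfolding block_op_def by (simp add: app_Abs_lop)
qed

lemma block_op_blocks: "block_op N m c \<in> blocks N"
  unfolding blocks_def
  by (auto intro!: lop_eqI exI[of _ c] simp: app_block_op app_cutop fun_eq_iff)

lemma ent_block_op:
  "i < N \<Longrightarrow> j < N \<Longrightarrow> ent (block_op N m c) i j = m i j" "ent (block_op N m c) N N = c"
  by (auto simp: ent_def app_block_op unit_seq_def if_distrib cong: if_cong)

lemma ent_one: "ent 1 i j = (if i = j then 1 else 0)" by (auto simp: ent_def unit_seq_def)
lemma ent_scal: "ent (scal c) i j = (if i = j then c else 0)" by (auto simp: ent_def unit_seq_def)
lemma ent_add: "ent (f + g) i j = ent f i j + ent g i j" by (simp add: ent_def)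
lemma ent_diff: "ent (f - g) i j = ent f i j - ent g i j" by (simp add: ent_def)
lemma ent_scal_mult: "ent (scal c * f) i j = c * ent f i j" by (simp add: ent_def)

lemma ent_mult:
  assumes "f \<in> blocks N"
  shows "i < N \<Longrightarrow> ent (f * g) i j = (\<Sum>l<N. ent f i l * ent g l j)" "ent (f * g) N N = ent f N N * ent g N N"
  by (simp_all add: ent_def[of "f * g"] ent_def[of g] blocks_app[OF assms])

section \<open>Determinants and inverses of block operators\<close>

definition matr :: "nat \<Rightarrow> lop \<Rightarrow> complex mat" where
  "matr N f = mat N N (\<lambda>(i, j). ent f i j)"

lemma matr_carrier [simp]: "matr N f \<in> carrier_mat N N" by (simp add: matr_def)

lemma matr_mult: "f \<in> blocks N \<Longrightarrow> matr N (f * g) = matr N f * matr N g"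
  by (rule eq_matI) (auto simp: matr_def ent_mult scalar_prod_def lessThan_atLeast0)

lemma matr_one: "matr N 1 = 1\<^sub>m N"
  by (rule eq_matI) (auto simp: matr_def ent_one)

definition of_matr :: "nat \<Rightarrow> complex mat \<Rightarrow> complex \<Rightarrow> lop" where
  "of_matr N A c = block_op N (\<lambda>i j. A $$ (i, j)) c"

lemma ent_of_matr:
  "i < N \<Longrightarrow> j < N \<Longrightarrow> ent (of_matr N A c) i j = A $$ (i, j)" "ent (of_matr N A c) N N = c"
  by (simp_all add: of_matr_def ent_block_op)

lemma of_matr_blocks: "of_matr N A c \<in> blocks N" by (simp add: of_matr_def block_op_blocks)

lemma of_matr_matr: "f \<in> blocks N \<Longrightarrow> of_matr N (matr N f) (ent f N N) = f"
  by (rule blocks_eqI) (auto simp: of_matr_blocks ent_of_matr matr_def)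

lemma of_matr_mult:
  assumes "A \<in> carrier_mat N N" "B \<in> carrier_mat N N"
  shows "of_matr N A c * of_matr N B d = of_matr N (A * B) (c * d)"
proof (rule blocks_eqI)
  show "of_matr N A c * of_matr N B d \<in> blocks N" "of_matr N (A * B) (c * d) \<in> blocks N"
    by (intro blocks_mult of_matr_blocks)+
qed (use assms in \<open>auto simp: ent_mult[OF of_matr_blocks] ent_of_matr scalar_prod_def lessThan_atLeast0\<close>)

lemma of_matr_one: "of_matr N (1\<^sub>m N) 1 = 1"
  by (rule blocks_eqI[OF of_matr_blocks blocks_one]) (auto simp: ent_of_matr ent_one)

text \<open>The scalar outside the block is counted once; that suffices for multiplicativity and for
  nonvanishing to mean invertibility in \<open>blocks N\<close>.\<close>

definition bdet :: "nat \<Rightarrow> lop \<Rightarrow> complex" where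
  "bdet N f = Determinant.det (matr N f) * ent f N N"

text \<open>The adjugate formula displays the inverse as a rational function of the entries, from
  which continuity is read off.\<close>

definition binv :: "nat \<Rightarrow> lop \<Rightarrow> lop" where
  "binv N f = of_matr N ((1 / Determinant.det (matr N f)) \<cdot>\<^sub>m adj_mat (matr N f)) (1 / ent f N N)"

lemma bdet_one: "bdet N 1 = 1" by (simp add: bdet_def matr_one ent_one)

lemma bdet_mult: "f \<in> blocks N \<Longrightarrow> bdet N (f * g) = bdet N f * bdet N g"
  unfolding bdet_def matr_mult ent_mult by (subst det_mult[of _ N]) (auto simp: ent_mult(2))

lemma binv:
  assumes f: "f \<in> blocks N" and d: "bdet N f \<noteq> 0"
  shows "binv N f \<in> blocks N" "f * binv N f = 1" "binv N f * f = 1"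
proof -
  show "binv N f \<in> blocks N" by (simp add: binv_def of_matr_blocks)
  let ?A = "matr N f" and ?c = "ent f N N"
  let ?B = "(1 / Determinant.det ?A) \<cdot>\<^sub>m adj_mat ?A"
  have nz: "Determinant.det ?A \<noteq> 0" "?c \<noteq> 0" using d by (auto simp: bdet_def)
  have B: "?B \<in> carrier_mat N N" using adj_mat(1)[OF matr_carrier] by simp
  have "?A * ?B = 1\<^sub>m N" "?B * ?A = 1\<^sub>m N"
    using adj_mat[OF matr_carrier[of N f]] nz
    by (auto simp: mult_smult_distrib[OF matr_carrier adj_mat(1)[OF matr_carrier]]
        mult_smult_assoc_mat[OF adj_mat(1)[OF matr_carrier] matr_carrier] intro!: eq_matI)
  then have "of_matr N ?A ?c * of_matr N ?B (1 / ?c) = 1" "of_matr N ?B (1 / ?c) * of_matr N ?A ?c = 1"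
    using nz by (simp_all add: of_matr_mult[OF matr_carrier B] of_matr_mult[OF B matr_carrier] of_matr_one)
  then show "f * binv N f = 1" "binv N f * f = 1"
    by (simp_all add: of_matr_matr[OF f] binv_def)
qed

lemma continuous_on_det:
  fixes A :: "'a::topological_space \<Rightarrow> nat \<Rightarrow> nat \<Rightarrow> complex"
  assumes "\<And>i j. i < n \<Longrightarrow> j < n \<Longrightarrow> continuous_on T (\<lambda>x. A x i j)"
  shows "continuous_on T (\<lambda>x. Determinant.det (mat n n (\<lambda>(i, j). A x i j)))"
proof -
  have "Determinant.det (mat n n (\<lambda>(i, j). A x i j)) = (\<Sum> p \<in> {p. p permutes {0 ..< n}}. signof p * (\<Prod> i = 0 ..< n. A x i (p i)))" for x
    by (subst det_def'[of _ n]) (auto intro!: sum.cong prod.cong arg_cong2[where f = "(*)"] dest: permutes_in_image)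
  moreover have "continuous_on T (\<lambda>x. \<Sum> p \<in> {p. p permutes {0 ..< n}}. signof p * (\<Prod> i = 0 ..< n. A x i (p i)))"
    by (intro continuous_intros assms) (auto dest: permutes_in_image)
  ultimately show ?thesis by simp
qed

lemma continuous_on_bdet: "continuous_on T f \<Longrightarrow> continuous_on T (\<lambda>x. bdet N (f x))"
  unfolding bdet_def matr_def by (intro continuous_intros continuous_on_det continuous_on_ent)

lemma continuous_on_binv:
  assumes f: "continuous_on T f" "\<And>x. x \<in> T \<Longrightarrow> bdet N (f x) \<noteq> 0"
  shows "continuous_on T (\<lambda>x. binv N (f x))"
proof (rule continuous_on_blocks)
  show "(\<lambda>x. binv N (f x)) ` T \<subseteq> blocks N" by (auto simp: binv_def of_matr_blocks)
  have nz: "Determinant.det (matr N (f x)) \<noteq> 0" "ent (f x) N N \<noteq> 0" if "x \<in> T" for x using f(2)[OF that] by (auto simp: bdet_def)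
  have d: "continuous_on T (\<lambda>x. Determinant.det (matr N (f x)))"
    unfolding matr_def by (intro continuous_on_det continuous_on_ent f)
  show "continuous_on T (\<lambda>x. ent (binv N (f x)) N N)"
    unfolding binv_def ent_of_matr by (intro continuous_intros continuous_on_ent f) (use nz in auto)
  fix i j assume ij: "i < N" "j < N"
  \<comment> \<open>A cofactor is, up to sign, a determinant of size \<open>N - 1\<close> in entries
    that skip row \<open>j\<close> and column \<open>i\<close>, so \<open>continuous_on_det\<close>
    applies to it.\<close>
  have "cofactor (matr N (f x)) j i = (-1) ^ (j + i) * Determinant.det (mat (N - 1) (N - 1)
      (\<lambda>(i', j'). ent (f x) (if i' < j then i' else Suc i') (if j' < i then j' else Suc j')))" for x
    unfolding cofactor_def mat_delete_def
    by (intro arg_cong2[where f = "(*)"] arg_cong[where f = Determinant.det] refl eq_matI) (auto simp: matr_def)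
  then have "continuous_on T (\<lambda>x. cofactor (matr N (f x)) j i)"
    by (simp only:) (intro continuous_intros continuous_on_det continuous_on_ent f)
  then have "continuous_on T (\<lambda>x. 1 / Determinant.det (matr N (f x)) * cofactor (matr N (f x)) j i)"
    by (intro continuous_intros d) (use nz in auto)
  moreover have "ent (binv N (f x)) i j = 1 / Determinant.det (matr N (f x)) * cofactor (matr N (f x)) j i" for x
    using ij by (simp add: binv_def ent_of_matr adj_mat_def matr_def)
  ultimately show "continuous_on T (\<lambda>x. ent (binv N (f x)) i j)" by simp
qed

text \<open>\<open>bdet N (1 + scal z * b)\<close> is a polynomial in \<open>z\<close>: the
  determinant of a matrix with linear polynomials as entries, times one linear factor for the
  outside scalar. Its value at 0 is 1, so it is not the zero polynomial.\<close>

lemma finite_singular_line: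
  assumes "b \<in> blocks N"
  shows "finite {z. bdet N (1 + scal z * b) = 0}"
proof -
  let ?M = "mat N N (\<lambda>(i, j). [:if i = j then 1 else 0, ent b i j:])"
  let ?P = "Determinant.det ?M * [:1, ent b N N:]"
  have *: "bdet N (1 + scal z * b) = poly ?P z" for z
  proof -
    have hom: "comm_ring_hom (\<lambda>p. poly p z)" by unfold_locales auto
    have "map_mat (\<lambda>p. poly p z) ?M = matr N (1 + scal z * b)"
      by (rule eq_matI) (auto simp: matr_def ent_add ent_one ent_scal_mult)
    then show ?thesis
      using comm_ring_hom.hom_det[OF hom, of ?M] by (simp add: bdet_def ent_add ent_one ent_scal_mult algebra_simps)
  qed
  have "poly ?P 0 = 1" using *[of 0] scal_add[of 0 0] by (simp add: bdet_one)
  then have "?P \<noteq> 0" by (metis poly_0 zero_neq_one)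
  then show ?thesis unfolding * by (rule poly_roots_finite)
qed

text \<open>Cayley-Hamilton by Schur decomposition: for the triangular conjugate \<open>b\<close>,
  subtracting the diagonal entries one after another shortens the support of a vector step by
  step.\<close>

lemma annihilated_blocks:
  assumes k: "k \<in> blocks N"
  shows "\<exists>zs. foldr (\<lambda>z x. (k - scal z) * x) zs 1 = 0"
proof -
  let ?A = "matr N k"
  obtain es where "char_poly ?A = (\<Prod>a\<leftarrow>es. [:- a, 1:])" using char_poly_factorized[OF matr_carrier] by blast
  then obtain B where B: "B \<in> carrier_mat N N" "upper_triangular B" "similar_mat ?A B"
    using schur_decomposition_exists[OF matr_carrier] by blast
  then obtain P Q where PQ: "similar_mat_wit ?A B P Q" by (auto simp: similar_mat_def)
  then have PQ: "P \<in> carrier_mat N N" "Q \<in> carrier_mat N N" "P * Q = 1\<^sub>m N" "Q * P = 1\<^sub>m N" "?A = P * B * Q"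
    unfolding similar_mat_wit_def Let_def by (auto simp: matr_def)
  define c where "c = ent k N N"
  define p b q where "p = of_matr N P 1" and "b = of_matr N B c" and "q = of_matr N Q 1"
  have kpq: "k = p * b * q"
    using PQ B(1) of_matr_matr[OF k] by (simp add: p_def b_def q_def c_def of_matr_mult)
  have pq: "q * p = 1" "p * q = 1"
    using PQ by (auto simp: p_def q_def of_matr_mult of_matr_one)
  have shift: "k - scal z = p * (b - scal z) * q" for z
  proof -
    have "p * scal z * q = scal z" using pq by (simp add: scal_central mult.assoc)
    then show ?thesis by (simp add: kpq algebra_simps)
  qed
  have conj: "foldr (\<lambda>z x. (k - scal z) * x) zs 1 = p * foldr (\<lambda>z x. (b - scal z) * x) zs 1 * q" for zs
  proof (induction zs)
    case (Cons z zs)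
    let ?F = "foldr (\<lambda>z x. (b - scal z) * x) zs 1"
    have "(k - scal z) * (p * ?F * q) = p * (b - scal z) * (q * p) * ?F * q" unfolding shift by (simp only: mult.assoc)
    then show ?case using Cons pq by (simp add: mult.assoc)
  qed (simp add: pq)
  have bB: "b \<in> blocks N" and ent_b: "\<And>i j. i < N \<Longrightarrow> j < N \<Longrightarrow> ent b i j = B $$ (i, j)" "ent b N N = c"
    by (auto simp: b_def of_matr_blocks) (auto simp: ent_of_matr)
  \<comment> \<open>The innermost factor \<open>b - scal c\<close> acts first and clears the
    coordinates from \<open>N\<close> on; the diagonal entries with indices \<open>N - 1\<close>
    down to \<open>m\<close> then clear one further coordinate each.\<close>
  have kill: "app (foldr (\<lambda>z x. (b - scal z) * x) (map (\<lambda>i. B $$ (i, i)) [m..<N]) (b - scal c)) v i = 0"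
    if "m \<le> N" "i \<ge> m" for m v i
    using that
  proof (induction "N - m" arbitrary: m i)
    case 0
    then have "m = N" by simp
    then show ?case using 0 blocks_app[OF bB] ent_b by simp
  next
    case (Suc n)
    then have m: "m < N" by simp
    let ?u = "app (foldr (\<lambda>z x. (b - scal z) * x) (map (\<lambda>i. B $$ (i, i)) [Suc m..<N]) (b - scal c)) v"
    have u: "?u l = 0" if "l \<ge> Suc m" for l using Suc.hyps(1)[of "Suc m" l] Suc.hyps(2) m that by simp
    have "app b ?u i = B $$ (m, m) * ?u i"
    proof (cases "i < N")
      case True
      have "app b ?u i = (\<Sum>j<N. ent b i j * ?u j)" using blocks_app[OF bB] True by simp
      also have "\<dots> = (\<Sum>j<N. if j = m then B $$ (i, m) * ?u m else 0)"
      proof (rule sum.cong)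
        fix j assume j: "j \<in> {..<N}"
        show "ent b i j * ?u j = (if j = m then B $$ (i, m) * ?u m else 0)"
        proof (cases "j < m")
          case True
          then have "B $$ (i, j) = 0" using upper_triangularD[OF B(2), of j i] Suc.prems \<open>i < N\<close> B(1) by auto
          then show ?thesis using True \<open>i < N\<close> j ent_b by auto
        qed (use u j ent_b \<open>i < N\<close> in \<open>auto simp: not_less Suc_le_eq\<close>)
      qed simp
      also have "\<dots> = B $$ (i, m) * ?u m" using m by simp
      also have "\<dots> = B $$ (m, m) * ?u i"
        using upper_triangularD[OF B(2), of m i] u[of i] B(1) True Suc.prems by (cases "i = m") auto
      finally show ?thesis .
    next
      case False
      then show ?thesis using blocks_app[OF bB] u[of i] m by simp
    qed
    then show ?case using m by (simp add: upt_conv_Cons)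
  qed
  have "foldr (\<lambda>z x. (b - scal z) * x) (map (\<lambda>i. B $$ (i, i)) [0..<N]) (b - scal c) = 0"
    by (rule lop_eqI) (use kill[of 0] in \<open>auto simp: fun_eq_iff\<close>)
  then have "foldr (\<lambda>z x. (b - scal z) * x) (map (\<lambda>i. B $$ (i, i)) [0..<N] @ [c]) 1 = 0" by simp
  then show ?thesis using conj by (metis mult_zero_left mult_zero_right)
qed

section \<open>Complete reducibility of bounded representations\<close>

definition commutant :: "nat \<Rightarrow> ('g \<Rightarrow> lop) \<Rightarrow> 'g set \<Rightarrow> lop set" where
  "commutant N R S = {f \<in> blocks N. \<forall>g\<in>S. f * R g = R g * f}"

lemma commutant_blocks: "f \<in> commutant N R S \<Longrightarrow> f \<in> blocks N" by (simp add: commutant_def)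

lemma commutantD: "f \<in> commutant N R S \<Longrightarrow> g \<in> S \<Longrightarrow> f * R g = R g * f" by (simp add: commutant_def)

lemma commutant_scal: "scal z \<in> commutant N R S"
  by (simp add: commutant_def blocks_scal scal_central)

lemma commutant_add: "f \<in> commutant N R S \<Longrightarrow> f' \<in> commutant N R S \<Longrightarrow> f + f' \<in> commutant N R S"
  by (simp add: commutant_def blocks_add distrib_left distrib_right)

lemma commutant_mult: "f \<in> commutant N R S \<Longrightarrow> f' \<in> commutant N R S \<Longrightarrow> f * f' \<in> commutant N R S"
  by (simp add: commutant_def blocks_mult) (metis mult.assoc)

lemma commutant_one: "1 \<in> commutant N R S" using commutant_scal[of 1] by (simp add: scal_1)

lemma commutant_diff: "f \<in> commutant N R S \<Longrightarrow> f' \<in> commutant N R S \<Longrightarrow> f - f' \<in> commutant N R S"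
  by (simp add: commutant_def blocks_diff left_diff_distrib right_diff_distrib)

lemma commutant_sum: "(\<And>j. j \<in> J \<Longrightarrow> f j \<in> commutant N R S) \<Longrightarrow> sum f J \<in> commutant N R S"
  using commutant_scal[of 0] scal_add[of 0 0]
  by (induction J rule: infinite_finite_induct) (auto intro: commutant_add)

lemma commutant_cutop: "(\<And>g. g \<in> S \<Longrightarrow> R g \<in> blocks N) \<Longrightarrow> cutop N \<in> commutant N R S"
  by (simp add: commutant_def blocks_cutop) (simp add: blocks_def)

lemma continuous_on_blocks_add:
  assumes "continuous_on T f" "continuous_on T g"
  shows "continuous_on T (\<lambda>x. f x + g x :: lop)"
  unfolding continuous_on_lop_iff ent_add using assms by (auto intro!: continuous_intros continuous_on_ent)

lemma continuous_on_blocks_mult: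
  assumes "continuous_on T f" "continuous_on T g" "f ` T \<subseteq> blocks N" "g ` T \<subseteq> blocks N"
  shows "continuous_on T (\<lambda>x. f x * g x)"
proof (rule continuous_on_blocks)
  show "(\<lambda>x. f x * g x) ` T \<subseteq> blocks N" using assms by (auto intro: blocks_mult)
  have e: "ent (f x * g x) N N = ent (f x) N N * ent (g x) N N"
     "\<And>i j. i < N \<Longrightarrow> ent (f x * g x) i j = (\<Sum>l<N. ent (f x) i l * ent (g x) l j)" if "x \<in> T" for x
    using assms(3) that ent_mult[of "f x" N] by auto
  show "continuous_on T (\<lambda>x. ent (f x * g x) N N)"
    using e(1) by (simp cong: continuous_on_cong) (intro continuous_intros continuous_on_ent assms)
  fix i j assume "i < N" "j < N"
  then show "continuous_on T (\<lambda>x. ent (f x * g x) i j)"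
    using e(2) by (simp cong: continuous_on_cong) (intro continuous_intros continuous_on_ent assms)
qed

lemma matrix_like_commutant:
  assumes R: "\<And>g. g \<in> S \<Longrightarrow> R g \<in> blocks N"
  shows "matrix_like_algebra (commutant N R S) scal (bdet N) (binv N)"
proof
  let ?E = "commutant N R S"
  show "continuous_on (?E \<times> ?E) (\<lambda>x. fst x + snd x)"
    by (intro continuous_on_blocks_add continuous_intros)
  show "continuous_on (?E \<times> ?E) (\<lambda>x. fst x * snd x)"
    by (intro continuous_on_blocks_mult[where N = N] continuous_intros) (auto simp: commutant_def)
  show "continuous_on UNIV scal"
    unfolding continuous_on_lop_iff ent_scal by (intro allI) (case_tac "i = j"; simp add: continuous_intros)
  show "continuous_on ?E (bdet N)" by (intro continuous_on_bdet continuous_on_id)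
  show "continuous_on {a \<in> ?E. bdet N a \<noteq> 0} (binv N)"
    by (intro continuous_on_binv continuous_on_id) auto
  fix a assume a: "a \<in> ?E"
  show "finite {z. bdet N (1 + scal z * a) = 0}" "\<exists>zs. foldr (\<lambda>z x. (a - scal z) * x) zs 1 = 0"
    using finite_singular_line annihilated_blocks commutant_blocks[OF a] by blast+
  assume d: "bdet N a \<noteq> 0"
  have i: "binv N a \<in> blocks N" "a * binv N a = 1" "binv N a * a = 1"
    using binv[OF commutant_blocks[OF a] d] by auto
  then show "binv N a * a = 1" "a * binv N a = 1" by auto
  have "binv N a * R g = R g * binv N a" if "g \<in> S" for g
  proof -
    have "binv N a * R g = binv N a * (R g * a) * binv N a" using i(2) by (simp add: mult.assoc)
    also have "\<dots> = (binv N a * a) * R g * binv N a" using commutantD[OF a that] by (simp add: mult.assoc)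
    finally show ?thesis using i(3) by simp
  qed
  then show "binv N a \<in> ?E" using i(1) by (simp add: commutant_def)
qed (auto simp: commutant_scal commutant_add commutant_mult scal_1 scal_add scal_mult bdet_one
   intro: scal_central bdet_mult commutant_blocks)

text \<open>The squared Hilbert-Schmidt norm of the block; the outside scalar is left out.\<close>

definition frob :: "nat \<Rightarrow> lop \<Rightarrow> real" where
  "frob N f = (\<Sum>i<N. \<Sum>j<N. (cmod (ent f i j))\<^sup>2)"

lemma frob_nonneg: "0 \<le> frob N f" by (simp add: frob_def sum_nonneg)

lemma frob_parallelogram: "frob N (f + g) + frob N (f - g) = 2 * frob N f + 2 * frob N g"
proof -
  have "(cmod (x + y))\<^sup>2 + (cmod (x - y))\<^sup>2 = 2 * (cmod x)\<^sup>2 + 2 * (cmod y)\<^sup>2" for x y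
    unfolding cmod_power2 by (simp add: power2_eq_square algebra_simps)
  then show ?thesis
    unfolding frob_def ent_add ent_diff sum_distrib_left sum.distrib[symmetric] by (simp only:)
qed

lemma frob_scal: "frob N (scal c * f) = (cmod c)\<^sup>2 * frob N f"
  by (simp add: frob_def ent_scal_mult norm_mult power_mult_distrib sum_distrib_left)

lemma frob_mult: assumes "f \<in> blocks N" shows "frob N (f * g) \<le> frob N f * frob N g"
proof -
  have "(cmod (ent (f * g) i j))\<^sup>2 \<le> (\<Sum>l<N. (cmod (ent f i l))\<^sup>2) * (\<Sum>l<N. (cmod (ent g l j))\<^sup>2)" if "i < N" for i j
  proof -
    have "cmod (ent (f * g) i j) \<le> (\<Sum>l<N. cmod (ent f i l) * cmod (ent g l j))"
      unfolding ent_mult(1)[OF assms that] by (intro order.trans[OF norm_sum]) (simp add: norm_mult)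
    then have "(cmod (ent (f * g) i j))\<^sup>2 \<le> (\<Sum>l<N. cmod (ent f i l) * cmod (ent g l j))\<^sup>2"
      by (intro power_mono) auto
    also have "\<dots> \<le> (\<Sum>l<N. (cmod (ent f i l))\<^sup>2) * (\<Sum>l<N. (cmod (ent g l j))\<^sup>2)"
      by (rule Cauchy_Schwarz_ineq_sum)
    finally show ?thesis .
  qed
  then have "frob N (f * g) \<le> (\<Sum>i<N. \<Sum>j<N. (\<Sum>l<N. (cmod (ent f i l))\<^sup>2) * (\<Sum>l<N. (cmod (ent g l j))\<^sup>2))"
    unfolding frob_def by (intro sum_mono) auto
  also have "\<dots> = frob N f * (\<Sum>j<N. \<Sum>l<N. (cmod (ent g l j))\<^sup>2)"
    unfolding frob_def sum_product ..
  also have "(\<Sum>j<N. \<Sum>l<N. (cmod (ent g l j))\<^sup>2) = frob N g"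
    unfolding frob_def by (rule sum.swap)
  finally show ?thesis .
qed

lemma frob_entry: "i < N \<Longrightarrow> j < N \<Longrightarrow> (cmod (ent f i j))\<^sup>2 \<le> frob N f"
  unfolding frob_def
  by (rule order.trans[OF _ member_le_sum[of i]], rule member_le_sum[of j "{..<N}" "\<lambda>j. (cmod (ent f i j))\<^sup>2"])
    (auto intro: sum_nonneg)

text \<open>The bound \<open>B\<close> is the form in which the compactness of the group
  enters.\<close>

locale bounded_block_rep = group G for G :: "('g, 'r) monoid_scheme" (structure) +
  fixes N :: nat and R :: "'g \<Rightarrow> lop" and B :: real
  assumes R_blocks: "g \<in> carrier G \<Longrightarrow> R g \<in> blocks N"
    and R_mult: "g \<in> carrier G \<Longrightarrow> h \<in> carrier G \<Longrightarrow> R (g \<otimes> h) = R g * R h"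
    and R_one: "R \<one> = 1"
    and R_bounded: "g \<in> carrier G \<Longrightarrow> frob N (R g) \<le> B"
begin

section \<open>Invariant projections by convexity\<close>

abbreviation "D \<equiv> commutant N R (carrier G)"

text \<open>The supremum over all conjugates is invariant under conjugation by the group, finite on
  block operators by the bound, and it inherits uniform convexity from the squared norm.\<close>

definition orbit_norm :: "lop \<Rightarrow> real" where
  "orbit_norm f = (SUP g\<in>carrier G. frob N (R g * f * R (inv g)))"

lemma R_inv: "g \<in> carrier G \<Longrightarrow> R g * R (inv g) = 1" "g \<in> carrier G \<Longrightarrow> R (inv g) * R g = 1"
  by (simp_all add: R_one flip: R_mult)

lemma B_nonneg: "0 \<le> B"
  using R_bounded[OF one_closed] frob_nonneg[of N "R \<one>"] by simp

lemma frob_conj: assumes "f \<in> blocks N" "g \<in> carrier G" shows "frob N (R g * f * R (inv g)) \<le> B\<^sup>2 * frob N f"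
proof -
  have "frob N (R g * f * R (inv g)) \<le> frob N (R g * f) * frob N (R (inv g))"
    using assms by (intro frob_mult blocks_mult R_blocks)
  also have "\<dots> \<le> (frob N (R g) * frob N f) * frob N (R (inv g))"
    using assms by (intro mult_right_mono frob_mult frob_nonneg R_blocks)
  also have "\<dots> \<le> (B * frob N f) * B"
    using assms by (intro mult_mono R_bounded frob_nonneg mult_nonneg_nonneg B_nonneg order.refl) auto
  finally show ?thesis by (simp add: power2_eq_square mult_ac)
qed

lemma frob_le_orbit_norm:
  assumes "f \<in> blocks N" "g \<in> carrier G"
  shows "frob N (R g * f * R (inv g)) \<le> orbit_norm f"
  unfolding orbit_norm_def
  by (intro cSUP_upper bdd_aboveI2[where M = "B\<^sup>2 * frob N f"] frob_conj assms)

lemma orbit_norm_le: "(\<And>g. g \<in> carrier G \<Longrightarrow> frob N (R g * f * R (inv g)) \<le> c) \<Longrightarrow> orbit_norm f \<le> c"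
  unfolding orbit_norm_def by (intro cSUP_least) auto

text \<open>Strict convexity of the orbit norm, which makes its minimisers over invariant convex sets invariant.\<close>

lemma orbit_norm_midpoint:
  assumes f: "f \<in> blocks N" and f': "f' \<in> blocks N"
  shows "4 * (B\<^sup>2 + 1) * orbit_norm (scal (1/2) * (f + f')) \<le> 2 * (B\<^sup>2 + 1) * (orbit_norm f + orbit_norm f') - frob N (f - f')"
proof -
  have pos: "0 < B\<^sup>2 + 1" by (simp add: add_nonneg_pos)
  have "orbit_norm (scal (1/2) * (f + f')) \<le> (orbit_norm f + orbit_norm f') / 2 - frob N (f - f') / (4 * (B\<^sup>2 + 1))"
  proof (rule orbit_norm_le)
    have arith: "(2 * a + 2 * b - x) / 4 \<le> (u + v) / 2 - d / 4" if "d \<le> x" "a \<le> u" "b \<le> v" for a b d u v x :: real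
      using that by (simp add: field_simps)
    fix g assume g: "g \<in> carrier G"
    let ?c = "\<lambda>f. R g * f * R (inv g)"
    have diff: "?c f - ?c f' = ?c (f - f')" by (simp add: left_diff_distrib right_diff_distrib)
    \<comment> \<open>Conjugating back bounds \<open>frob N (f - f')\<close> by a multiple of the
      norm of the conjugate. The gain from the parallelogram law is thus independent of
      \<open>g\<close> and survives the supremum.\<close>
    have "R (inv g) * ?c (f - f') * R (inv (inv g)) = (R (inv g) * R g) * (f - f') * (R (inv g) * R g)"
      using g by (simp add: mult.assoc)
    then have "frob N (f - f') \<le> B\<^sup>2 * frob N (?c (f - f'))"
      using frob_conj[of "?c (f - f')" "inv g"] g f f' by (simp add: R_inv R_blocks blocks_mult blocks_diff)
    \<comment> \<open>\<open>B\<^sup>2 + 1\<close> is positive even for \<open>B = 0\<close>, so it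
      can be divided by.\<close>
    also have "\<dots> \<le> (B\<^sup>2 + 1) * frob N (?c (f - f'))" by (simp add: mult_right_mono frob_nonneg)
    finally have le: "frob N (f - f') \<le> (B\<^sup>2 + 1) * frob N (?c (f - f'))" .
    define d where "d = frob N (f - f') / (B\<^sup>2 + 1)"
    have d: "d \<le> frob N (?c (f - f'))" "frob N (f - f') / (4 * (B\<^sup>2 + 1)) = d / 4"
      using pos le by (simp_all add: d_def divide_le_eq mult.commute)
    have "?c (scal (1/2) * (f + f')) = scal (1/2) * (?c f + ?c f')"
      using scal_central[of "R g" "1/2"] by (simp add: distrib_left distrib_right) (metis mult.assoc)
    then have mid: "frob N (?c (scal (1/2) * (f + f'))) = (2 * frob N (?c f) + 2 * frob N (?c f') - frob N (?c (f - f'))) / 4"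
      using frob_parallelogram[of N "?c f" "?c f'"] diff by (simp add: frob_scal power2_eq_square)
    show "frob N (?c (scal (1/2) * (f + f'))) \<le> (orbit_norm f + orbit_norm f') / 2 - frob N (f - f') / (4 * (B\<^sup>2 + 1))"
      unfolding d(2) mid using d(1) frob_le_orbit_norm[OF f g] frob_le_orbit_norm[OF f' g] by (rule arith)
  qed
  then show ?thesis using pos by (simp add: field_simps)
qed

text \<open>The projections with the range of \<open>P0\<close> form a convex set that conjugation
  by the group preserves, as this range is invariant. By uniform convexity a minimising sequence for
  the orbit norm is Cauchy, and its limit, the unique minimiser, commutes with the group.\<close>

lemma equivariant_projection:
  assumes P0: "P0 \<in> blocks N" "P0 * P0 = P0" "P0 * cutop N = P0"
    and inv: "\<And>g. g \<in> carrier G \<Longrightarrow> P0 * R g * P0 = R g * P0"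
  shows "\<exists>P\<in>D. P0 * P = P \<and> P * P0 = P0 \<and> P * cutop N = P"
proof -
  let ?e = "cutop N"
  \<comment> \<open>\<open>P0 * P = P\<close> and \<open>P * P0 = P0\<close> say that
    \<open>P\<close> is idempotent with the same range as \<open>P0\<close>, and they are affine
    conditions on \<open>P\<close>.\<close>
  define K where "K = {P \<in> blocks N. P0 * P = P \<and> P * P0 = P0 \<and> P * ?e = P}"
  have Kb: "P \<in> blocks N" if "P \<in> K" for P using that by (simp add: K_def)
  have P0K: "P0 \<in> K" using P0 by (simp add: K_def)
  have Kmid: "scal (1/2) * (P + Q) \<in> K" if "P \<in> K" "Q \<in> K" for P Q
  proof -
    have "scal (1/2) * (x + x) = x" for x :: lop by (rule lop_eqI) (auto simp: fun_eq_iff)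
    moreover have "P0 * (scal (1/2) * (P + Q)) = scal (1/2) * (P0 * (P + Q))"
      by (metis scal_central mult.assoc)
    ultimately show ?thesis using that
      by (simp add: K_def blocks_mult blocks_add blocks_scal mult.assoc distrib_right distrib_left)
  qed
  have Kconj: "R g * P * R (inv g) \<in> K" if "P \<in> K" "g \<in> carrier G" for P g
  proof -
    have P: "P \<in> blocks N" "P0 * P = P" "P * P0 = P0" "P * ?e = P" using that by (auto simp: K_def)
    have "P0 * (R g * P * R (inv g)) = (P0 * R g * P0) * P * R (inv g)" using P(2) by (simp add: mult.assoc)
    also have "\<dots> = R g * P * R (inv g)" using inv that P(2) by (simp add: mult.assoc)
    finally have 1: "P0 * (R g * P * R (inv g)) = R g * P * R (inv g)" .
    have "R g * P * R (inv g) * P0 = R g * P * (P0 * R (inv g) * P0)" using inv that by (simp add: mult.assoc)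
    also have "\<dots> = R g * (P * P0) * R (inv g) * P0" by (simp add: mult.assoc)
    also have "\<dots> = R g * (P0 * R (inv g) * P0)" using P(3) by (simp add: mult.assoc)
    also have "\<dots> = (R g * R (inv g)) * P0" using inv that by (simp add: mult.assoc)
    finally have 2: "R g * P * R (inv g) * P0 = P0" using that by (simp add: R_inv)
    have "R (inv g) * ?e = ?e * R (inv g)" using R_blocks[of "inv g"] that by (simp add: blocks_def)
    then have "R g * P * R (inv g) * ?e = R g * (P * ?e) * R (inv g)" by (simp add: mult.assoc)
    then show ?thesis using 1 2 P that by (simp add: K_def blocks_mult R_blocks)
  qed
  define m where "m = (INF P\<in>K. orbit_norm P)"
  have orbit_nonneg: "0 \<le> orbit_norm P" if "P \<in> K" for P
    using frob_le_orbit_norm[OF Kb[OF that] one_closed] frob_nonneg order.trans by blast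
  have m_le: "m \<le> orbit_norm P" if "P \<in> K" for P
    unfolding m_def using that by (intro cINF_lower bdd_belowI2[where m = 0] orbit_nonneg)
  \<comment> \<open>The midpoint of \<open>P\<close> and \<open>Q\<close> is again in
    \<open>K\<close> and has orbit norm at least \<open>m\<close>, so the convexity estimate limits
    the distance of two near-minimisers.\<close>
  have close: "frob N (P - Q) \<le> 2 * (B\<^sup>2 + 1) * (orbit_norm P + orbit_norm Q - 2 * m)" if "P \<in> K" "Q \<in> K" for P Q
  proof -
    have "4 * (B\<^sup>2 + 1) * m \<le> 4 * (B\<^sup>2 + 1) * orbit_norm (scal (1/2) * (P + Q))"
      using m_le[OF Kmid[OF that]] by (intro mult_left_mono) auto
    then show ?thesis using orbit_norm_midpoint[OF Kb Kb, OF that] by (simp add: algebra_simps)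
  qed
  have "\<exists>P\<in>K. orbit_norm P < m + 1 / real (Suc n)" for n
    using P0K cINF_less_iff[of K orbit_norm "m + 1 / real (Suc n)"] bdd_belowI2[of K 0 orbit_norm, OF orbit_nonneg]
    by (auto simp: m_def)
  then obtain a where a: "\<And>n. a n \<in> K" "\<And>n. orbit_norm (a n) < m + 1 / real (Suc n)" by metis
  have cauchy: "Cauchy (\<lambda>n. ent (a n) i j)" if ij: "i < N" "j < N" for i j
  proof (rule CauchyI)
    fix \<epsilon> :: real assume \<epsilon>: "0 < \<epsilon>"
    have pos: "0 < B\<^sup>2 + 1" by (simp add: add_nonneg_pos)
    obtain M :: nat where M: "4 * (B\<^sup>2 + 1) / \<epsilon>\<^sup>2 < real M" using reals_Archimedean2 by blast
    show "\<exists>M. \<forall>k\<ge>M. \<forall>n\<ge>M. norm (ent (a k) i j - ent (a n) i j) < \<epsilon>"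
    proof (intro exI allI impI)
      fix k n assume kn: "M \<le> k" "M \<le> n"
      have "(cmod (ent (a k - a n) i j))\<^sup>2 \<le> frob N (a k - a n)" by (rule frob_entry[OF ij])
      also have "\<dots> \<le> 2 * (B\<^sup>2 + 1) * (orbit_norm (a k) + orbit_norm (a n) - 2 * m)" by (rule close[OF a(1) a(1)])
      also have "\<dots> \<le> 2 * (B\<^sup>2 + 1) * (1 / real (Suc k) + 1 / real (Suc n))"
        using a(2)[of k] a(2)[of n] pos by (intro mult_left_mono) auto
      also have "\<dots> \<le> 2 * (B\<^sup>2 + 1) * (1 / real (Suc M) + 1 / real (Suc M))"
        using kn pos by (intro mult_left_mono add_mono divide_left_mono) auto
      also have "\<dots> = 4 * (B\<^sup>2 + 1) / real (Suc M)" by simp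
      also have "\<dots> < \<epsilon>\<^sup>2"
        using M \<epsilon> by (simp add: field_simps) (smt (verit) zero_less_power)
      finally show "norm (ent (a k) i j - ent (a n) i j) < \<epsilon>"
        using \<epsilon> by (simp add: ent_diff power2_less_imp_less)
    qed
  qed
  define P where "P = block_op N (\<lambda>i j. lim (\<lambda>n. ent (a n) i j)) 0"
  have Pb: "P \<in> blocks N" by (simp add: P_def block_op_blocks)
  have ab: "a n \<in> blocks N" for n using a(1) Kb by blast
  define conv where "conv b Q \<longleftrightarrow> (\<forall>i<N. \<forall>j<N. (\<lambda>n. ent (b n) i j) \<longlonglongrightarrow> ent Q i j)" for b Q
  have conv_a: "conv a P"
    unfolding conv_def P_def
    by (simp add: ent_block_op Cauchy_convergent_iff[symmetric] cauchy convergent_LIMSEQ_iff[THEN iffD1])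
  have conv_left: "conv (\<lambda>n. f * b n) (f * Q)" if "conv b Q" "f \<in> blocks N" for b Q f
    using that by (auto simp: conv_def ent_mult[where N = N] intro!: tendsto_intros)
  have conv_right: "conv (\<lambda>n. b n * f) (Q * f)" if "conv b Q" "\<And>n. b n \<in> blocks N" "Q \<in> blocks N" for b Q f
    using that by (auto simp: conv_def ent_mult[where N = N] intro!: tendsto_intros)
  have conv_unique: "ent Q i j = ent Q' i j" if "conv b Q" "conv b Q'" "i < N" "j < N" for b Q Q' i j
    using that LIMSEQ_unique unfolding conv_def by blast
  \<comment> \<open>\<open>conv\<close> sees only the entries inside the block. Outside it the
    operators involved have scalar 0, which settles the remaining entry in
    \<open>blocks_eqI\<close>.\<close>
  have P0N: "ent P0 N N = 0"
  proof -
    have "ent (P0 * ?e) N N = 0" using P0(1) by (simp add: ent_mult(2) ent_def[of ?e] app_cutop)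
    then show ?thesis using P0(3) by simp
  qed
  have PN: "ent P N N = 0" by (simp add: P_def ent_block_op)
  have eN: "ent ?e N N = 0" by (simp add: ent_def app_cutop)
  have aK: "P0 * a n = a n" "a n * P0 = P0" "a n * ?e = a n" for n using a(1)[of n] by (auto simp: K_def)
  have "P0 * P = P"
    using conv_unique[OF conv_left[OF conv_a P0(1)], of P] conv_a P0N PN P0(1) Pb
    by (intro blocks_eqI[of _ N]) (auto simp: aK blocks_mult ent_mult[where N = N])
  moreover have "conv (\<lambda>n. P0) P0" by (simp add: conv_def)
  then have "P * P0 = P0"
    using conv_unique[OF conv_right[OF conv_a ab Pb], of P0 P0] P0N PN P0(1) Pb
    by (intro blocks_eqI[of _ N]) (auto simp: aK blocks_mult ent_mult[where N = N])
  moreover have "P * ?e = P"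
    using conv_unique[OF conv_right[OF conv_a ab Pb], of ?e P] conv_a P0N PN eN Pb
    by (intro blocks_eqI[of _ N]) (auto simp: aK blocks_mult blocks_cutop ent_mult[where N = N])
  ultimately have PK: "P \<in> K" using Pb by (simp add: K_def)
  \<comment> \<open>The orbit norm is a supremum of continuous functions, so the bounds along the
    sequence pass to its limit.\<close>
  have oP: "orbit_norm P \<le> m"
  proof (rule orbit_norm_le)
    fix g assume g: "g \<in> carrier G"
    have "conv (\<lambda>n. R g * a n * R (inv g)) (R g * P * R (inv g))"
      using g by (intro conv_left conv_right conv_a blocks_mult ab Pb R_blocks)
    then have lim1: "(\<lambda>n. frob N (R g * a n * R (inv g))) \<longlonglongrightarrow> frob N (R g * P * R (inv g))"
      unfolding frob_def conv_def by (intro tendsto_intros) auto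
    have lim2: "(\<lambda>n. m + 1 / real (Suc n)) \<longlonglongrightarrow> m + 0"
      by (intro tendsto_intros LIMSEQ_inverse_real_of_nat[unfolded inverse_eq_divide])
    have "frob N (R g * a n * R (inv g)) \<le> m + 1 / real (Suc n)" for n
      using frob_le_orbit_norm[OF ab g, of n] a(2)[of n] by simp
    then show "frob N (R g * P * R (inv g)) \<le> m"
      using LIMSEQ_le[OF lim1 lim2] by simp
  qed
  \<comment> \<open>The conjugate of \<open>P\<close> by \<open>R h\<close> is in \<open>K\<close>
    with orbit norm at most \<open>m\<close> as well, and \<open>close\<close> makes the two
    coincide.\<close>
  have "P * R h = R h * P" if h: "h \<in> carrier G" for h
  proof -
    let ?P' = "R h * P * R (inv h)"
    have "orbit_norm ?P' \<le> m"
    proof (rule orbit_norm_le)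
      fix g assume g: "g \<in> carrier G"
      have "R g * ?P' * R (inv g) = R (g \<otimes> h) * P * R (inv (g \<otimes> h))"
        using g h by (simp add: R_mult inv_mult_group mult.assoc)
      then show "frob N (R g * ?P' * R (inv g)) \<le> m"
        using frob_le_orbit_norm[OF Pb, of "g \<otimes> h"] oP g h by simp
    qed
    then have "2 * (B\<^sup>2 + 1) * (orbit_norm P + orbit_norm ?P' - 2 * m) \<le> 0"
      using oP by (intro mult_nonneg_nonpos) auto
    then have fr: "frob N (P - ?P') \<le> 0" using close[OF PK Kconj[OF PK h]] by linarith
    then have "ent P i j = ent ?P' i j" if "i < N" "j < N" for i j
      using order.trans[OF frob_entry[OF that, of "P - ?P'"] fr] by (simp add: ent_diff)
    moreover have "ent ?P' N N = 0" using h PN Pb by (simp add: ent_mult[where N = N] blocks_mult R_blocks)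
    ultimately have "P = ?P'"
      using PN h Pb by (intro blocks_eqI[of _ N]) (auto simp: blocks_mult R_blocks)
    then have "P * R h = R h * P * (R (inv h) * R h)" by (metis mult.assoc)
    then show ?thesis using h by (simp add: R_inv)
  qed
  then have "P \<in> D" using Pb by (simp add: commutant_def)
  then show ?thesis using PK by (auto simp: K_def)
qed

end

section \<open>Subrepresentations and Schur's lemma\<close>

definition subrep :: "nat \<Rightarrow> ('g \<Rightarrow> lop) \<Rightarrow> 'g set \<Rightarrow> (nat \<Rightarrow> complex) set \<Rightarrow> bool" where
  "subrep N R S Z \<longleftrightarrow> seq.subspace Z \<and> (\<forall>v\<in>Z. app (cutop N) v = v) \<and> (\<forall>g\<in>S. \<forall>v\<in>Z. app (R g) v \<in> Z)"

definition irreducible_subrep :: "nat \<Rightarrow> ('g \<Rightarrow> lop) \<Rightarrow> 'g set \<Rightarrow> (nat \<Rightarrow> complex) set \<Rightarrow> bool" where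
  "irreducible_subrep N R S Z \<longleftrightarrow> subrep N R S Z \<and> Z \<noteq> {0} \<and> (\<forall>Y. subrep N R S Y \<and> Y \<subseteq> Z \<longrightarrow> Y = {0} \<or> Y = Z)"

lemma scal_0: "scal 0 = 0"
  using scal_add[of 0 0] by simp

lemma corner_blocks: "f * cutop N = f \<Longrightarrow> cutop N * f = f \<Longrightarrow> f \<in> blocks N"
  by (auto simp: blocks_def right_diff_distrib scal_0 intro!: exI[of _ 0])

lemma subspace_range_app: "seq.subspace (range (app f))"
  by (rule seqs.linear_subspace_image[OF linear_app seq.subspace_UNIV])

lemma idem_app: "f * f = f \<Longrightarrow> v \<in> range (app f) \<Longrightarrow> app f v = v"
  by (metis app_times imageE)

text \<open>Kernel and image of \<open>x\<close> are subrepresentations, so irreducibility makes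
  \<open>x\<close> a bijection from the range of \<open>p\<close> onto the range of
  \<open>q\<close>. A linear left inverse of it, preceded by \<open>q\<close>, is the required
  \<open>y\<close>; equivariance and membership in the block carry over from \<open>x\<close>,
  \<open>p\<close> and \<open>q\<close>.\<close>

lemma schur_idempotents:
  assumes R: "\<And>g. g \<in> S \<Longrightarrow> R g \<in> blocks N"
    and p: "p \<in> commutant N R S" "p * p = p" "p * cutop N = p" and q: "q \<in> commutant N R S" "q * q = q" "q * cutop N = q"
    and irr: "irreducible_subrep N R S (range (app p))" "irreducible_subrep N R S (range (app q))"
    and x: "x \<in> commutant N R S" "q * x * p = x" "x \<noteq> 0"
  shows "\<exists>y\<in>commutant N R S. p * y * q = y \<and> y * x = p \<and> x * y = q"
proof -
  let ?V = "range (app p)" and ?U = "range (app q)"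
  have xp: "x * p = x" and qx: "q * x = x" using x(2) p(2) q(2) by (metis mult.assoc)+
  have fixp: "app p v = v" if "v \<in> ?V" for v using idem_app[OF p(2) that] .
  have Vs: "seq.subspace ?V" by (rule subspace_range_app)
  have xR: "app x (app (R g) v) = app (R g) (app x v)" if "g \<in> S" for g v
    using commutantD[OF x(1) that] by (metis app_times)
  have V: "app (R g) v \<in> ?V" if "g \<in> S" "v \<in> ?V" for g v
    using irr(1) that unfolding irreducible_subrep_def subrep_def by blast
  have Vc: "app (cutop N) v = v" if "v \<in> ?V" for v
    using irr(1) that unfolding irreducible_subrep_def subrep_def by blast
  have Uc: "app (cutop N) v = v" if "v \<in> ?U" for v
    using irr(2) that unfolding irreducible_subrep_def subrep_def by blast
  have xU: "app x v \<in> ?U" for v using qx by (metis app_times rangeI)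
  have ex: "\<exists>v\<in>?V. app x v \<noteq> 0"
  proof (rule ccontr)
    assume "\<not> ?thesis"
    then have "app x (app p v) = 0" for v by auto
    then have "x = 0" using xp by (intro lop_eqI) (metis app_0 app_times)
    then show False using x(3) by simp
  qed
  have "subrep N R S {v \<in> ?V. app x v = 0}"
    using Vs V Vc xR by (auto simp: subrep_def seq.subspace_def)
  then have "{v \<in> ?V. app x v = 0} = {0} \<or> {v \<in> ?V. app x v = 0} = ?V"
    using irr(1) unfolding irreducible_subrep_def by blast
  then have ker: "{v \<in> ?V. app x v = 0} = {0}" using ex by blast
  have inj: "inj_on (app x) ?V"
  proof (rule inj_onI)
    fix u v assume uv: "u \<in> ?V" "v \<in> ?V" "app x u = app x v"
    then have "u - v \<in> {v \<in> ?V. app x v = 0}" using seq.subspace_diff[OF Vs] by simp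
    then show "u = v" using ker by simp
  qed
  have "seq.subspace (app x ` ?V)"
    using Vs seqs.linear_subspace_image[OF linear_app] by blast
  then have "subrep N R S (app x ` ?V)"
    using xU Uc V by (auto simp: subrep_def simp flip: xR)
  moreover have "app x ` ?V \<subseteq> ?U" using xU by blast
  ultimately have "app x ` ?V = {0} \<or> app x ` ?V = ?U"
    using irr(2) unfolding irreducible_subrep_def by blast
  then have im: "app x ` ?V = ?U" using ex by blast
  obtain f where f: "range f \<subseteq> ?V" "Vector_Spaces.linear cscale cscale f" "\<And>v. v \<in> ?V \<Longrightarrow> f (app x v) = v"
    using seqs.linear_exists_left_inverse_on[OF linear_app Vs inj] by blast
  define y where "y = Abs_lop f * q"
  have y: "app y u = f (app q u)" for u using f(2) by (simp add: y_def app_Abs_lop)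
  have fV: "f u \<in> ?V" for u using f(1) by blast
  have py: "p * y = y" by (rule lop_eqI) (simp only: app_times y fixp[OF fV])
  have yq: "y * q = y" using q(2) by (simp add: y_def mult.assoc)
  have yx: "y * x = p"
  proof (rule lop_eqI)
    fix v
    have "app (y * x) v = f (app (q * x * p) v)" using y xp by (simp add: mult.assoc)
    also have "\<dots> = f (app x (app p v))" using qx by simp
    finally show "app (y * x) v = app p v" using f(3) by simp
  qed
  have xy: "x * y = q"
  proof (rule lop_eqI)
    fix u
    obtain v where v: "v \<in> ?V" "app q u = app x v" using im by (metis imageE rangeI)
    then show "app (x * y) u = app q u" using f(3) y by simp
  qed
  have "y * R g = R g * y" if g: "g \<in> S" for g
  proof (rule lop_eqI)
    fix u
    obtain v where v: "v \<in> ?V" "app q u = app x v" using im by (metis imageE rangeI)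
    have "app q (app (R g) u) = app (R g) (app q u)" using commutantD[OF q(1) g] by (metis app_times)
    also have "\<dots> = app x (app (R g) v)" using v xR g by simp
    finally show "app (y * R g) u = app (R g * y) u" using f(3) V[OF g] v by (simp add: y)
  qed
  moreover have "y \<in> blocks N"
  proof (rule corner_blocks)
    show "y * cutop N = y" using q(3) by (simp add: y_def mult.assoc)
    show "cutop N * y = y" by (rule lop_eqI) (simp only: app_times y Vc[OF fV])
  qed
  ultimately have "y \<in> commutant N R S" by (simp add: commutant_def)
  then show ?thesis using py yq yx xy by (metis mult.assoc)
qed

context bounded_block_rep
begin

text \<open>Some linear projection onto \<open>Y\<close> exists without regard to the group, and
  \<open>equivariant_projection\<close> replaces it by one in the commutant. Hence every
  subrepresentation is a direct summand.\<close>

lemma complement_subrep: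
  assumes Y: "subrep N R (carrier G) Y"
  shows "\<exists>P\<in>D. P * P = P \<and> P * cutop N = P \<and> range (app P) = Y"
proof -
  have Ys: "seq.subspace Y" and Yc: "\<And>v. v \<in> Y \<Longrightarrow> app (cutop N) v = v"
    and YR: "\<And>g v. g \<in> carrier G \<Longrightarrow> v \<in> Y \<Longrightarrow> app (R g) v \<in> Y"
    using Y by (auto simp: subrep_def)
  obtain f where f: "range f \<subseteq> Y" "Vector_Spaces.linear cscale cscale f" "\<And>v. v \<in> Y \<Longrightarrow> f v = v"
    using seqs.linear_exists_left_inverse_on[OF seq.linear_id Ys] by auto
  define P0 where "P0 = Abs_lop f * cutop N"
  have P0: "app P0 v = f (app (cutop N) v)" for v using f(2) by (simp add: P0_def app_Abs_lop)
  have P0Y: "app P0 v \<in> Y" for v using f(1) P0 by auto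
  have P0fix: "app P0 v = v" if "v \<in> Y" for v using that P0 f(3) Yc by simp
  have c: "P0 * cutop N = P0" by (simp add: P0_def mult.assoc cutop_idem)
  have "cutop N * P0 = P0" by (rule lop_eqI) (simp add: Yc P0Y)
  then have b: "P0 \<in> blocks N" using c corner_blocks by blast
  have "P0 * P0 = P0" by (rule lop_eqI) (simp add: P0fix P0Y)
  moreover have "P0 * R g * P0 = R g * P0" if "g \<in> carrier G" for g
    by (rule lop_eqI) (simp add: P0fix P0Y YR that)
  ultimately obtain P where P: "P \<in> D" "P0 * P = P" "P * P0 = P0" "P * cutop N = P"
    using equivariant_projection[OF b _ c] by blast
  have PY: "app P v \<in> Y" for v using P(2) P0Y by (metis app_times)
  have Pfix: "app P v = v" if "v \<in> Y" for v using P(3) P0fix[OF that] by (metis app_times)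
  have "P * P = P" by (rule lop_eqI) (simp add: Pfix PY)
  moreover have "range (app P) = Y" using PY Pfix by (auto simp: image_iff) metis
  ultimately show ?thesis using P by blast
qed

definition idempotents :: "lop set" where
  "idempotents = {p \<in> D. p * p = p \<and> p * cutop N = p \<and> p \<noteq> 0}"

text \<open>Such families are partial decompositions of the block into invariant summands; one of
  greatest size turns out to be a complete decomposition into irreducible ones.\<close>

definition orthogonal_family :: "lop set \<Rightarrow> bool" where
  "orthogonal_family I \<longleftrightarrow> finite I \<and> I \<subseteq> idempotents \<and> (\<forall>p\<in>I. \<forall>q\<in>I. p \<noteq> q \<longrightarrow> p * q = 0)"

section \<open>Decomposition into irreducible summands\<close>

lemma cutop_D: "cutop N \<in> D"
  by (intro commutant_cutop R_blocks)

lemma cutop_left: "p \<in> D \<Longrightarrow> p * cutop N = p \<Longrightarrow> cutop N * p = p"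
  by (simp add: commutant_def blocks_def)

text \<open>Each member fixes a nonzero vector. By orthogonality these vectors are independent, and
  they lie in the span of \<open>N\<close> unit sequences.\<close>

lemma card_orthogonal_family:
  assumes I: "orthogonal_family I"
  shows "card I \<le> N"
proof -
  have "\<exists>v. v \<noteq> 0 \<and> app p v = v" if "p \<in> I" for p
  proof -
    have p: "p \<noteq> 0" "p * p = p" using I that by (auto simp: orthogonal_family_def idempotents_def)
    then obtain u where "app p u \<noteq> 0" by (metis app_0 lop_eqI)
    then show ?thesis using p(2) by (metis app_times)
  qed
  then obtain v where v: "\<And>p. p \<in> I \<Longrightarrow> v p \<noteq> 0 \<and> app p (v p) = v p" by metis
  have orth: "app q (v p) = (if p = q then v p else 0)" if "p \<in> I" "q \<in> I" for p q
  proof (cases "p = q")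
    case False
    then have "q * p = 0" using I that by (auto simp: orthogonal_family_def)
    then show ?thesis using False v[OF that(1)] by (metis app_0 app_times)
  qed (use v that in auto)
  have inj: "inj_on v I" by (rule inj_onI) (metis orth v)
  have fin: "finite I" using I by (simp add: orthogonal_family_def)
  have "seq.independent (v ` I)"
  proof
    assume "seq.dependent (v ` I)"
    then obtain u where u: "\<exists>w\<in>v ` I. u w \<noteq> 0" "(\<Sum>w\<in>v ` I. cscale (u w) w) = 0"
      using fin by (auto simp: seq.dependent_finite)
    then obtain q where q: "q \<in> I" "u (v q) \<noteq> 0" by blast
    have "0 = app q (\<Sum>p\<in>I. cscale (u (v p)) (v p))"
      using u(2) inj by (simp add: sum.reindex)
    also have "\<dots> = (\<Sum>p\<in>I. cscale (u (v p)) (if p = q then v p else 0))"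
      by (simp add: app_sum orth q cong: sum.cong)
    also have "\<dots> = (\<Sum>p\<in>I. if p = q then cscale (u (v q)) (v q) else 0)"
      by (intro sum.cong) auto
    also have "\<dots> = cscale (u (v q)) (v q)" using q fin by simp
    finally show False using q v[OF q(1)] by (auto simp: fun_eq_iff)
  qed
  moreover have "v ` I \<subseteq> seq.span (unit_seq ` {..<N})"
  proof
    fix w assume "w \<in> v ` I"
    then obtain p where p: "p \<in> I" "w = v p" by blast
    have "p \<in> D" "p * cutop N = p" using I p(1) by (auto simp: orthogonal_family_def idempotents_def)
    then have "w = app (cutop N) w" using v[OF p(1)] p(2) cutop_left by (metis app_times)
    also have "\<dots> \<in> seq.span (unit_seq ` {..<N})"
      unfolding seq_expand by (intro seq.span_sum seq.span_scale seq.span_base) auto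
    finally show "w \<in> seq.span (unit_seq ` {..<N})" .
  qed
  ultimately have "card (v ` I) \<le> card (unit_seq ` {..<N})"
    using seq.independent_span_bound[of "unit_seq ` {..<N}"] by simp
  also have "\<dots> \<le> N" using card_image_le[of "{..<N}" unit_seq] by simp
  finally show ?thesis using inj by (simp add: card_image)
qed

lemma maximal_orthogonal_family:
  obtains I where "orthogonal_family I" "\<And>J. orthogonal_family J \<Longrightarrow> card J \<le> card I"
proof -
  have "orthogonal_family {}" by (simp add: orthogonal_family_def)
  then show ?thesis
    using ex_has_greatest_nat[of orthogonal_family "{}" card "Suc N"] card_orthogonal_family that
    by (metis le_imp_less_Suc)
qed

text \<open>The remainder \<open>cutop N - \<Sum>I\<close> is an idempotent of the commutant
  orthogonal to all of \<open>I\<close>; were it nonzero, it could be added to the family.\<close>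

lemma maximal_family_sum:
  assumes I: "orthogonal_family I" and max: "\<And>J. orthogonal_family J \<Longrightarrow> card J \<le> card I"
  shows "\<Sum>I = cutop N"
proof (rule ccontr)
  assume neq: "\<Sum>I \<noteq> cutop N"
  have fin: "finite I" and idem: "\<And>p. p \<in> I \<Longrightarrow> p \<in> D \<and> p * p = p \<and> p * cutop N = p \<and> cutop N * p = p"
    and orth: "\<And>p q. p \<in> I \<Longrightarrow> q \<in> I \<Longrightarrow> p \<noteq> q \<Longrightarrow> p * q = 0"
    using I cutop_left by (auto simp: orthogonal_family_def idempotents_def)
  have Sp: "\<Sum>I * p = p" "p * \<Sum>I = p" if "p \<in> I" for p
  proof -
    have "\<Sum>I * p = (\<Sum>q\<in>I. if q = p then p else 0)" "p * \<Sum>I = (\<Sum>q\<in>I. if q = p then p else 0)"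
      unfolding sum_distrib_left sum_distrib_right using that idem orth by (auto intro!: sum.cong)
    then show "\<Sum>I * p = p" "p * \<Sum>I = p" using that fin by auto
  qed
  define r where "r = cutop N - \<Sum>I"
  have rp: "r * p = 0" "p * r = 0" if "p \<in> I" for p
    using that Sp idem by (auto simp: r_def left_diff_distrib right_diff_distrib)
  have Sc: "\<Sum>I * cutop N = \<Sum>I" unfolding sum_distrib_right using idem by simp
  have "r * \<Sum>I = 0" unfolding sum_distrib_left using rp by simp
  moreover have rc: "r * cutop N = r" using Sc by (simp add: r_def left_diff_distrib cutop_idem)
  ultimately have rr: "r * r = r" by (subst (2) r_def) (simp add: right_diff_distrib)
  have "r \<in> D" unfolding r_def using idem by (intro commutant_diff cutop_D commutant_sum) auto
  then have "r \<in> idempotents" using rr rc neq by (auto simp: idempotents_def r_def)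
  then have "orthogonal_family (insert r I)" using I rp by (auto simp: orthogonal_family_def)
  moreover have "r \<notin> I" using rp(1)[of r] rr neq by (auto simp: r_def)
  ultimately show False using max[of "insert r I"] fin by simp
qed

text \<open>A proper nonzero subrepresentation would split \<open>p\<close> into two orthogonal
  idempotents \<open>e\<close> and \<open>p - e\<close>, and putting these in place of
  \<open>p\<close> would enlarge the family.\<close>

lemma maximal_family_irreducible:
  assumes I: "orthogonal_family I" and max: "\<And>J. orthogonal_family J \<Longrightarrow> card J \<le> card I" and p: "p \<in> I"
  shows "irreducible_subrep N R (carrier G) (range (app p))"
proof -
  have fin: "finite I" and idem: "\<And>p. p \<in> I \<Longrightarrow> p \<in> D \<and> p * p = p \<and> p * cutop N = p \<and> cutop N * p = p"
    and orth: "\<And>p q. p \<in> I \<Longrightarrow> q \<in> I \<Longrightarrow> p \<noteq> q \<Longrightarrow> p * q = 0"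
    using I cutop_left by (auto simp: orthogonal_family_def idempotents_def)
  have pD: "p \<in> D" "p * p = p" "p * cutop N = p" "cutop N * p = p" using idem[OF p] by auto
  have p0: "p \<noteq> 0" using I p by (auto simp: orthogonal_family_def idempotents_def)
  have "subrep N R (carrier G) (range (app p))"
    unfolding subrep_def
  proof (intro conjI ballI)
    fix v assume "v \<in> range (app p)"
    then obtain u where u: "v = app p u" by blast
    show "app (cutop N) v = v" unfolding u using pD(4) by (metis app_times)
    fix g assume "g \<in> carrier G"
    then show "app (R g) v \<in> range (app p)" unfolding u using commutantD[OF pD(1)] by (metis app_times rangeI)
  qed (rule subspace_range_app)
  moreover have "range (app p) \<noteq> {0}"
    using p0 lop_eqI[of p 0] by auto
  moreover have "Y = {0} \<or> Y = range (app p)" if Y: "subrep N R (carrier G) Y" "Y \<subseteq> range (app p)" for Y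
  proof -
    obtain P where P: "P \<in> D" "P * P = P" "P * cutop N = P" "range (app P) = Y"
      using complement_subrep[OF Y(1)] by blast
    have Pfix: "app P v = v" if "v \<in> Y" for v using idem_app[OF P(2)] P(4) that by simp
    have "app P v \<in> range (app p)" for v using Y(2) P(4) by blast
    then have pP: "p * P = P"
      by (intro lop_eqI) (simp only: app_times idem_app[OF pD(2)])
    \<comment> \<open>\<open>P\<close> projects onto \<open>Y\<close> but need not vanish where
      \<open>p\<close> does; the product with \<open>p\<close> still has range \<open>Y\<close> and
      lies in the corner of \<open>p\<close>, as a splitting of \<open>p\<close> requires.\<close>
    define e where "e = P * p"
    have e: "e \<in> D" "e * e = e" "e * p = e" "p * e = e" "e * cutop N = e"
      using P pD pP unfolding e_def by (auto intro!: commutant_mult) (metis mult.assoc)+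
    have zero: "q * e = 0" "e * q = 0" if "q \<in> I - {p}" for q
      using orth[of q p] orth[of p q] that p e(3,4) by (metis DiffE insertI1 mult.assoc mult_zero_left mult_zero_right)+
    have "e = 0 \<or> e = p"
    proof (rule ccontr)
      assume neq: "\<not> ?thesis"
      let ?J = "insert e (insert (p - e) (I - {p}))"
      have pe: "(p - e) * (p - e) = p - e" "(p - e) * e = 0" "e * (p - e) = 0" "(p - e) * cutop N = p - e"
        using e pD by (auto simp: left_diff_distrib right_diff_distrib)
      have "p - e \<in> D" using e pD by (intro commutant_diff) auto
      then have "e \<in> idempotents" "p - e \<in> idempotents" using e pe neq by (auto simp: idempotents_def)
      moreover have "q * (p - e) = 0" "(p - e) * q = 0" if "q \<in> I - {p}" for q
        using zero[OF that] orth[of q p] orth[of p q] that p by (auto simp: left_diff_distrib right_diff_distrib)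
      ultimately have "orthogonal_family ?J"
        using I pe zero orth by (auto simp: orthogonal_family_def)
      moreover have "e \<notin> I - {p}" using zero(1)[of e] e(2) neq by auto
      moreover have "p - e \<notin> I - {p}"
        using orth[of "p - e" p] p e(3) pD(2) neq by (auto simp: left_diff_distrib)
      moreover have "e \<noteq> p - e" using pe(3) e(2) neq by auto
      ultimately have "orthogonal_family ?J" "card ?J = Suc (card I)" using fin p
        by (simp_all add: card.insert_remove card_Diff_singleton) (metis Suc_pred card_gt_0_iff empty_iff)
      then show False using max[of ?J] by simp
    qed
    then show ?thesis
    proof
      assume "e = 0"
      have "v = 0" if "v \<in> Y" for v
      proof -
        have "app p v = v" using idem_app[OF pD(2)] Y(2) that by blast
        then have "app e v = v" using Pfix[OF that] by (simp add: e_def)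
        then show ?thesis by (simp add: \<open>e = 0\<close>)
      qed
      moreover have "0 \<in> Y" using Y(1) by (auto simp: subrep_def seq.subspace_def)
      ultimately show ?thesis by blast
    next
      assume "e = p"
      then have "app p v \<in> Y" for v using P(4) unfolding e_def by (metis app_times rangeI)
      then show ?thesis using Y(2) by blast
    qed
  qed
  ultimately show ?thesis unfolding irreducible_subrep_def by blast
qed

text \<open>The idempotents of the block add up to \<open>cutop N\<close>, so
  \<open>1 - cutop N\<close> joins them as a further corner. Elements of \<open>E\<close> are
  scalars on it and have no component between it and the block, so it behaves like a one-dimensional
  summand of its own type. Inside the block \<open>schur\<close> is Schur's lemma for
  \<open>H\<close>.\<close>

theorem split_commutants:
  assumes H: "H \<subseteq> carrier G"
    and irr: "\<And>Z. irreducible_subrep N R (carrier G) Z \<Longrightarrow> irreducible_subrep N R H Z"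
  shows "\<exists>I. split_subalgebra (commutant N R H) scal (bdet N) (binv N) D I (\<lambda>p. p)"
proof -
  obtain I where I: "orthogonal_family I" and max: "\<And>J. orthogonal_family J \<Longrightarrow> card J \<le> card I"
    using maximal_orthogonal_family by blast
  have fin: "finite I" and idem: "\<And>p. p \<in> I \<Longrightarrow> p \<in> D \<and> p * p = p \<and> p * cutop N = p \<and> cutop N * p = p"
    and orth: "\<And>p q. p \<in> I \<Longrightarrow> q \<in> I \<Longrightarrow> p \<noteq> q \<Longrightarrow> p * q = 0" and nz: "\<And>p. p \<in> I \<Longrightarrow> p \<noteq> 0"
    using I cutop_left by (auto simp: orthogonal_family_def idempotents_def)
  let ?E = "commutant N R H" and ?c = "1 - cutop N"
  have DE: "D \<subseteq> ?E" using H by (auto simp: commutant_def)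
  have cI: "?c * p = 0" "p * ?c = 0" if "p \<in> I" for p using idem[OF that] by (auto simp: left_diff_distrib right_diff_distrib)
  have cc: "?c * ?c = ?c" by (simp add: left_diff_distrib right_diff_distrib cutop_idem)
  have cnI: "?c \<notin> I" using cI nz cc by metis
  have cD: "?c \<in> D" by (intro commutant_diff commutant_one cutop_D)
  have schur: "\<exists>y\<in>?E. p * y * q = y \<and> y * x = p \<and> x * y = q"
    if pqx: "p \<in> insert ?c I" "q \<in> insert ?c I" "x \<in> ?E" "q * x * p = x" "x \<noteq> 0" for p q x
  proof -
    obtain z where z: "x * ?c = scal z * ?c" and xc: "x * cutop N = cutop N * x"
      using pqx(3) by (auto simp: commutant_def blocks_def)
    have comm: "x * ?c = ?c * x" using xc by (simp add: left_diff_distrib right_diff_distrib)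
    consider "p = ?c" "q = ?c" | "p = ?c" "q \<in> I" | "p \<in> I" "q = ?c" | "p \<in> I" "q \<in> I" using pqx(1,2) by blast
    then show ?thesis
    proof cases
      case 1
      then have x: "x = scal z * ?c" using pqx(4) z comm cc by (metis mult.assoc)
      then have z0: "z \<noteq> 0" using pqx(5) by (auto simp: scal_0)
      let ?y = "scal (1/z) * ?c"
      have s: "scal a * ?c * (scal b * ?c) = scal (a * b) * ?c" for a b
        using scal_central[of ?c b] cc by (metis mult.assoc scal_mult)
      have "?y \<in> ?E" using cD DE by (intro commutant_mult commutant_scal) auto
      moreover have "?y * x = ?c" "x * ?y = ?c" unfolding x s using z0 by (simp_all add: scal_1)
      moreover have "?c * ?y * ?c = ?y" using scal_central[of ?c "1/z"] cc by (metis mult.assoc)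
      ultimately show ?thesis using 1 by blast
    next
      case 2
      then have "x = q * ?c * x" using pqx(4) comm by (metis mult.assoc)
      then show ?thesis using pqx(5) cI[OF 2(2)] by simp
    next
      case 3
      then have "x = x * (?c * p)" using pqx(4) comm by (metis mult.assoc)
      then show ?thesis using pqx(5) cI[OF 3(1)] by simp
    next
      case 4
      show ?thesis
        by (rule schur_idempotents)
          (use idem 4 DE H pqx irr maximal_family_irreducible[OF I max] R_blocks in auto)
    qed
  qed
  have sum: "(\<Sum>p\<in>insert ?c I. p) = 1"
    using maximal_family_sum[OF I max] fin cnI by simp
  interpret matrix_like_algebra ?E scal "bdet N" "binv N"
    using H by (intro matrix_like_commutant R_blocks) auto
  have "split_subalgebra ?E scal (bdet N) (binv N) D (insert ?c I) (\<lambda>p. p)"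
    by unfold_locales
      (use DE fin idem cc cI orth cD sum schur in \<open>auto intro: commutant_scal commutant_add commutant_mult\<close>)
  then show ?thesis by blast
qed

end

section \<open>Coordinates on a fibre\<close>

lemma linear_mapD:
  fixes V :: "(complex, 'v) module" and W :: "(complex, 'w) module"
  assumes "linear_map class_ring V W T" "u \<in> carrier V"
  shows "T u \<in> carrier W" "T (c \<odot>\<^bsub>V\<^esub> u) = c \<odot>\<^bsub>W\<^esub> T u"
    and "v \<in> carrier V \<Longrightarrow> T (u \<oplus>\<^bsub>V\<^esub> v) = T u \<oplus>\<^bsub>W\<^esub> T v"
proof -
  interpret linear_map class_ring V W T by (rule assms(1))
  show "T u \<in> carrier W" "T (c \<odot>\<^bsub>V\<^esub> u) = c \<odot>\<^bsub>W\<^esub> T u"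
    and "v \<in> carrier V \<Longrightarrow> T (u \<oplus>\<^bsub>V\<^esub> v) = T u \<oplus>\<^bsub>W\<^esub> T v"
    using assms(2) T_smult[of c u] by auto
qed

lemma linear_mapI:
  fixes V :: "(complex, 'v) module" and W :: "(complex, 'w) module"
  assumes "vectorspace class_ring V" "vectorspace class_ring W"
    and "\<And>u. u \<in> carrier V \<Longrightarrow> T u \<in> carrier W"
    and "\<And>u v. u \<in> carrier V \<Longrightarrow> v \<in> carrier V \<Longrightarrow> T (u \<oplus>\<^bsub>V\<^esub> v) = T u \<oplus>\<^bsub>W\<^esub> T v"
    and "\<And>c u. u \<in> carrier V \<Longrightarrow> T (c \<odot>\<^bsub>V\<^esub> u) = c \<odot>\<^bsub>W\<^esub> T u"
  shows "linear_map class_ring V W T"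
  by (intro linear_map.intro mod_hom.intro mod_hom_axioms.intro assms vectorspace.axioms(1)[OF assms(1)] vectorspace.axioms(1)[OF assms(2)])
    (auto simp: module_hom_def assms)

lemma linear_map_vectorspaces:
  assumes "linear_map class_ring V W T"
  shows "vectorspace class_ring V" "vectorspace class_ring W"
  using assms by (auto simp: linear_map_def)

lemma linear_map_compose:
  fixes V :: "(complex, 'v) module" and W :: "(complex, 'w) module" and Z :: "(complex, 'z) module"
  assumes "linear_map class_ring V W T" "linear_map class_ring W Z T'"
  shows "linear_map class_ring V Z (\<lambda>u. T' (T u))"
  using linear_mapD[OF assms(1)] linear_mapD[OF assms(2)] linear_map_vectorspaces[OF assms(1)] linear_map_vectorspaces[OF assms(2)]
  by (intro linear_mapI) auto

lemma vectorspace_closed: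
  fixes V :: "(complex, 'v) module"
  assumes "vectorspace class_ring V" "u \<in> carrier V"
  shows "c \<odot>\<^bsub>V\<^esub> u \<in> carrier V" "v \<in> carrier V \<Longrightarrow> u \<oplus>\<^bsub>V\<^esub> v \<in> carrier V" "\<zero>\<^bsub>V\<^esub> \<in> carrier V"
proof -
  interpret vectorspace class_ring V by (rule assms(1))
  show "c \<odot>\<^bsub>V\<^esub> u \<in> carrier V" "v \<in> carrier V \<Longrightarrow> u \<oplus>\<^bsub>V\<^esub> v \<in> carrier V" "\<zero>\<^bsub>V\<^esub> \<in> carrier V"
    using assms(2) smult_closed[of c u] by auto
qed

lemma linear_iso_inverse:
  fixes V :: "(complex, 'v) module" and W :: "(complex, 'w) module"
  assumes "linear_iso V W T"
  shows "linear_iso W V (inv_into (carrier V) T)"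
proof -
  have T: "linear_map class_ring V W T" and bij: "bij_betw T (carrier V) (carrier W)"
    using assms by (auto simp: linear_iso_def)
  note vs = linear_map_vectorspaces[OF T]
  let ?S = "inv_into (carrier V) T"
  have S: "?S w \<in> carrier V" "T (?S w) = w" if "w \<in> carrier W" for w
    using bij that by (auto simp: bij_betw_def inv_into_into f_inv_into_f)
  have ST: "?S (T u) = u" if "u \<in> carrier V" for u
    using bij that by (auto simp: bij_betw_def)
  have "linear_map class_ring W V ?S"
  proof (rule linear_mapI)
    fix u v assume "u \<in> carrier W" "v \<in> carrier W"
    then show "?S (u \<oplus>\<^bsub>W\<^esub> v) = ?S u \<oplus>\<^bsub>V\<^esub> ?S v"
      using ST[of "?S u \<oplus>\<^bsub>V\<^esub> ?S v"] S linear_mapD(3)[OF T] vectorspace_closed[OF vs(1)] by simp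
  next
    fix c u assume "u \<in> carrier W"
    then show "?S (c \<odot>\<^bsub>W\<^esub> u) = c \<odot>\<^bsub>V\<^esub> ?S u"
      using ST[of "c \<odot>\<^bsub>V\<^esub> ?S u"] S linear_mapD(2)[OF T] vectorspace_closed[OF vs(1)] by simp
  qed (use vs S in auto)
  then show ?thesis using bij_betw_inv_into[OF bij] by (simp add: linear_iso_def)
qed

lemma linear_iso_compose:
  fixes V :: "(complex, 'v) module" and W :: "(complex, 'w) module" and Z :: "(complex, 'z) module"
  assumes "linear_iso V W T" "linear_iso W Z T'"
  shows "linear_iso V Z (\<lambda>u. T' (T u))"
  using assms linear_map_compose[of V W T Z T'] bij_betw_trans[of T "carrier V" "carrier W" T' "carrier Z"]
  by (auto simp: linear_iso_def comp_def)

lemma linear_isoI: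
  fixes V :: "(complex, 'v) module" and W :: "(complex, 'w) module"
  assumes "linear_map class_ring V W T" "\<And>w. w \<in> carrier W \<Longrightarrow> S w \<in> carrier V"
    "\<And>w. w \<in> carrier W \<Longrightarrow> T (S w) = w" "\<And>u. u \<in> carrier V \<Longrightarrow> S (T u) = u"
  shows "linear_iso V W T"
  unfolding linear_iso_def using assms linear_mapD(1)[OF assms(1)]
  by (auto intro!: bij_betw_byWitness[where f' = S])

definition corner :: "nat \<Rightarrow> (nat \<Rightarrow> complex) set" where
  "corner N = {v. app (cutop N) v = v}"

lemma cutop_corner: "app (cutop N) v \<in> corner N"
  using cutop_idem[of N] by (auto simp: corner_def) (metis app_times)

lemma cutop_fixes: "v \<in> corner N \<Longrightarrow> app (cutop N) v = v" by (simp add: corner_def)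

lemma corner_subspace: "seq.subspace (corner N)"
  by (auto simp: seq.subspace_def corner_def)

lemma blocks_corner: "f \<in> blocks N \<Longrightarrow> v \<in> corner N \<Longrightarrow> app f v \<in> corner N"
  by (simp add: blocks_def corner_def) (metis app_times)

lemma unit_seq_corner: "j < N \<Longrightarrow> unit_seq j \<in> corner N"
  by (auto simp: corner_def app_cutop unit_seq_def fun_eq_iff)

lemma continuous_on_app:
  assumes "continuous_on T f" "f ` T \<subseteq> blocks N"
  shows "continuous_on T (\<lambda>x. app (f x) v)"
proof (rule continuous_on_coordinatewise_then_product)
  fix i
  have "continuous_on T (\<lambda>x. if i < N then (\<Sum>j<N. ent (f x) i j * v j) else ent (f x) N N * v i)"
    by (cases "i < N") (auto intro!: continuous_intros continuous_on_ent assms)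
  moreover have "app (f x) v i = (if i < N then (\<Sum>j<N. ent (f x) i j * v j) else ent (f x) N N * v i)" if "x \<in> T" for x
    using blocks_app[of "f x" N] assms(2) that by auto
  ultimately show "continuous_on T (\<lambda>x. app (f x) v i)" by (simp cong: continuous_on_cong)
qed

text \<open>The inverse \<open>lam\<close> is a parameter beside \<open>\<kappa>\<close>, since
  continuity is later assumed for both directions.\<close>

locale coordinates =
  fixes V :: "(complex, 'v) module" and N :: nat and \<kappa> :: "'v \<Rightarrow> nat \<Rightarrow> complex" and lam :: "(nat \<Rightarrow> complex) \<Rightarrow> 'v"
  assumes vs: "vectorspace class_ring V"
    and \<kappa>_corner: "u \<in> carrier V \<Longrightarrow> \<kappa> u \<in> corner N"
    and \<kappa>_add: "u \<in> carrier V \<Longrightarrow> v \<in> carrier V \<Longrightarrow> \<kappa> (u \<oplus>\<^bsub>V\<^esub> v) = \<kappa> u + \<kappa> v"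
    and \<kappa>_scale: "u \<in> carrier V \<Longrightarrow> \<kappa> (c \<odot>\<^bsub>V\<^esub> u) = cscale c (\<kappa> u)"
    and lam_V: "w \<in> corner N \<Longrightarrow> lam w \<in> carrier V"
    and \<kappa>_lam: "w \<in> corner N \<Longrightarrow> \<kappa> (lam w) = w"
    and lam_\<kappa>: "u \<in> carrier V \<Longrightarrow> lam (\<kappa> u) = u"
begin

section \<open>Endomorphisms of a fibre as block operators\<close>

lemma lam_add: "v \<in> corner N \<Longrightarrow> w \<in> corner N \<Longrightarrow> lam (v + w) = lam v \<oplus>\<^bsub>V\<^esub> lam w"
  using lam_\<kappa>[of "lam v \<oplus>\<^bsub>V\<^esub> lam w"] vectorspace_closed[OF vs] by (simp add: \<kappa>_add \<kappa>_lam lam_V)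

lemma lam_scale: "v \<in> corner N \<Longrightarrow> lam (cscale c v) = c \<odot>\<^bsub>V\<^esub> lam v"
  using lam_\<kappa>[of "c \<odot>\<^bsub>V\<^esub> lam v"] vectorspace_closed[OF vs] by (simp add: \<kappa>_scale \<kappa>_lam lam_V)

text \<open>Outside the block the operator is the identity, so composition becomes multiplication
  and the identity becomes 1.\<close>

definition coord_op :: "('v \<Rightarrow> 'v) \<Rightarrow> lop" where
  "coord_op \<phi> = Abs_lop (\<lambda>v. \<kappa> (\<phi> (lam (app (cutop N) v))) + (v - app (cutop N) v))"

context
  fixes \<phi> assumes \<phi>: "linear_map class_ring V V \<phi>"
begin

lemma app_coord_op: "app (coord_op \<phi>) v = \<kappa> (\<phi> (lam (app (cutop N) v))) + (v - app (cutop N) v)"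
proof -
  have "Vector_Spaces.linear cscale cscale (\<lambda>v. \<kappa> (\<phi> (lam (app (cutop N) v))) + (v - app (cutop N) v))"
    by (auto simp: linear_cscale_iff lam_add lam_scale cutop_corner lam_V linear_mapD[OF \<phi>] \<kappa>_add \<kappa>_scale
        seq.scale_right_distrib seq.scale_right_diff_distrib)
  then show ?thesis by (simp add: coord_op_def app_Abs_lop)
qed

lemma coord_op_corner: "v \<in> corner N \<Longrightarrow> app (coord_op \<phi>) v = \<kappa> (\<phi> (lam v))"
  by (simp add: app_coord_op cutop_fixes)

lemma coord_op_\<kappa>: "u \<in> carrier V \<Longrightarrow> app (coord_op \<phi>) (\<kappa> u) = \<kappa> (\<phi> u)"
  by (simp add: coord_op_corner \<kappa>_corner lam_\<kappa>)

lemma coord_op_complement: "coord_op \<phi> * (1 - cutop N) = 1 - cutop N"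
proof (rule lop_eqI)
  fix v
  have 0: "0 \<in> corner N" by (rule seq.subspace_0[OF corner_subspace])
  have "\<phi> (lam (cscale 0 0)) = 0 \<odot>\<^bsub>V\<^esub> \<phi> (lam 0)"
    using 0 by (simp only: lam_scale linear_mapD[OF \<phi>] lam_V)
  then have "\<kappa> (\<phi> (lam 0)) = 0"
    using \<kappa>_scale[of "\<phi> (lam 0)" 0] linear_mapD(1)[OF \<phi>] lam_V[OF 0] by simp
  moreover have "app (cutop N) (v - app (cutop N) v) = 0" using cutop_fixes[OF cutop_corner] by simp
  ultimately show "app (coord_op \<phi> * (1 - cutop N)) v = app (1 - cutop N) v"
    by (simp only: app_times app_minus app_1 app_coord_op) simp
qed

lemma coord_op_blocks: "coord_op \<phi> \<in> blocks N"
proof -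
  have "coord_op \<phi> * cutop N = cutop N * coord_op \<phi>"
    by (rule lop_eqI) (simp add: app_coord_op cutop_fixes[OF cutop_corner] cutop_fixes[OF \<kappa>_corner] linear_mapD(1)[OF \<phi>] lam_V cutop_corner)
  then show ?thesis using coord_op_complement by (auto simp: blocks_def scal_1 intro!: exI[of _ 1])
qed

lemma ent_coord_op: "ent (coord_op \<phi>) N N = 1" "j < N \<Longrightarrow> ent (coord_op \<phi>) i j = \<kappa> (\<phi> (lam (unit_seq j))) i"
proof -
  have "app (1 - cutop N) (unit_seq N) = unit_seq N" by (auto simp: app_cutop unit_seq_def fun_eq_iff)
  then have "app (coord_op \<phi>) (unit_seq N) = unit_seq N"
    using arg_cong[OF coord_op_complement, of "\<lambda>f. app f (unit_seq N)"] by (metis app_times)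
  then show "ent (coord_op \<phi>) N N = 1" by (simp add: ent_def) (simp add: unit_seq_def)
  show "j < N \<Longrightarrow> ent (coord_op \<phi>) i j = \<kappa> (\<phi> (lam (unit_seq j))) i"
    by (simp add: ent_def coord_op_corner unit_seq_corner)
qed

end

lemma lop_eq_on_corner:
  assumes "f * (1 - cutop N) = g * (1 - cutop N)" "\<And>v. v \<in> corner N \<Longrightarrow> app f v = app g v"
  shows "f = g"
proof (rule lop_eqI)
  fix v
  have "app f v = app f (app (cutop N) v) + app (f * (1 - cutop N)) v" "app g v = app g (app (cutop N) v) + app (g * (1 - cutop N)) v"
    by simp_all
  then show "app f v = app g v" using assms cutop_corner by metis
qed

lemma coord_op_mult:
  assumes "linear_map class_ring V V \<phi>" "linear_map class_ring V V \<phi>'"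
  shows "coord_op \<phi> * coord_op \<phi>' = coord_op (\<lambda>u. \<phi> (\<phi>' u))"
proof (rule lop_eq_on_corner)
  note c = linear_map_compose[OF assms(2,1)]
  show "coord_op \<phi> * coord_op \<phi>' * (1 - cutop N) = coord_op (\<lambda>u. \<phi> (\<phi>' u)) * (1 - cutop N)"
    using coord_op_complement[OF assms(1)] coord_op_complement[OF assms(2)] coord_op_complement[OF c] by (simp add: mult.assoc)
  fix v assume "v \<in> corner N"
  then show "app (coord_op \<phi> * coord_op \<phi>') v = app (coord_op (\<lambda>u. \<phi> (\<phi>' u))) v"
    using assms c by (simp add: coord_op_corner coord_op_\<kappa> linear_mapD(1)[OF assms(2)] lam_V)
qed

lemma coord_op_eqI:
  assumes "linear_map class_ring V V \<phi>" "f \<in> blocks N" "ent f N N = 1" "\<And>u. u \<in> carrier V \<Longrightarrow> app f (\<kappa> u) = \<kappa> (\<phi> u)"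
  shows "f = coord_op \<phi>"
proof (rule blocks_eqI[OF assms(2) coord_op_blocks[OF assms(1)]])
  fix i j assume "i < N" "j < N"
  then show "ent f i j = ent (coord_op \<phi>) i j"
    using assms(4)[OF lam_V[OF unit_seq_corner]] by (simp add: ent_coord_op(2)[OF assms(1)] ent_def[of f] \<kappa>_lam unit_seq_corner)
qed (simp add: assms ent_coord_op)

lemma linear_map_of_blocks:
  assumes "f \<in> blocks N"
  shows "linear_map class_ring V V (\<lambda>u. lam (app f (\<kappa> u)))"
  by (intro linear_mapI vs) (simp_all add: \<kappa>_add \<kappa>_scale lam_add lam_scale \<kappa>_corner blocks_corner[OF assms] lam_V)

end

text \<open>\<open>T0\<close> is the \<open>H\<close>-isomorphism that the representation extension
  provides at \<open>x\<close>; \<open>\<kappa>\<close> and \<open>lam\<close> come from a local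
  trivialisation, which gives their continuity.\<close>

locale clutching_coordinates = group G + coordinates "fibre F x" N \<kappa> lam
  for TG :: "'g topology" and G :: "'g monoid" (structure) and X :: "'x set" and act :: "'g \<Rightarrow> 'x \<Rightarrow> 'x"
    and F :: "('e::topological_space, 'x) vector_bundle" and \<alpha> :: "'g \<Rightarrow> 'e \<Rightarrow> 'e"
    and W :: "(complex, 'w) module" and \<rho> :: "'g \<Rightarrow> 'w \<Rightarrow> 'w" and x :: 'x
    and N \<kappa> lam and T0 :: "'w \<Rightarrow> 'e" +
  assumes compact_TG: "compact_space TG" and topspace_TG: "topspace TG = carrier G"
    and finite_X: "finite X" and x_X: "x \<in> X"
    and transitive: "transitive_action G X act"
    and equivariant: "equivariant_vector_bundle TG G (discrete_topology X) act F \<alpha>"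
    and \<rho>_action: "group_action G (carrier W) \<rho>" and \<rho>_linear: "g \<in> carrier G \<Longrightarrow> linear_map class_ring W W (\<rho> g)"
    and T0: "linear_iso W (fibre F x) T0"
    and T0_equivariant: "g \<in> stabilizer G act x \<Longrightarrow> w \<in> carrier W \<Longrightarrow> T0 (\<rho> g w) = \<alpha> g (T0 w)"
    and continuous_\<kappa>: "continuous_on (carrier (fibre F x)) \<kappa>"
    and continuous_lam: "continuous_on (corner N) lam"
    and irreducible_restriction: "invariant_subspace G W \<rho> U \<Longrightarrow> irreducible_rep G (W\<lparr>carrier := U\<rparr>) \<rho> \<Longrightarrow>
           irreducible_rep (isotropy_group G act x) (W\<lparr>carrier := U\<rparr>) \<rho>"
begin

abbreviation "V \<equiv> fibre F x"
abbreviation "H \<equiv> stabilizer G act x"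

section \<open>Rules for the actions on base, bundle and fibre\<close>

lemma H_G: "g \<in> H \<Longrightarrow> g \<in> carrier G" and H_x: "g \<in> H \<Longrightarrow> act g x = x" and H_I: "g \<in> carrier G \<Longrightarrow> act g x = x \<Longrightarrow> g \<in> H"
  by (auto simp: stabilizer_def)

lemma act_action: "group_action G X act"
  using transitive by (simp add: transitive_action_def)

lemma act_X: "g \<in> carrier G \<Longrightarrow> y \<in> X \<Longrightarrow> act g y \<in> X"
  using group_action.element_image[OF act_action] by blast

lemma act_mult: "g \<in> carrier G \<Longrightarrow> h \<in> carrier G \<Longrightarrow> y \<in> X \<Longrightarrow> act (g \<otimes> h) y = act g (act h y)"
  using group_action.composition_rule[OF act_action] by blast

lemma act_inv: "g \<in> carrier G \<Longrightarrow> y \<in> X \<Longrightarrow> act (inv g) (act g y) = y"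
  using group_action.orbit_sym_aux[OF act_action] by blast

lemma \<alpha>_action: "group_action G (total F) \<alpha>"
  using equivariant by (simp add: equivariant_vector_bundle_def continuous_action_def)

lemma fibre: "y \<in> X \<Longrightarrow> carrier (fibre F y) = {u \<in> total F. proj F u = y}"
  and fibre_vs: "y \<in> X \<Longrightarrow> vectorspace class_ring (fibre F y)"
  and proj_X: "u \<in> total F \<Longrightarrow> proj F u \<in> X"
  using equivariant by (auto simp: equivariant_vector_bundle_def complex_vector_bundle_def continuous_map_def)

lemma \<alpha>_linear: "g \<in> carrier G \<Longrightarrow> y \<in> X \<Longrightarrow> linear_map class_ring (fibre F y) (fibre F (act g y)) (\<alpha> g)"
  using equivariant by (auto simp: equivariant_vector_bundle_def)

lemma fibre_total: "y \<in> X \<Longrightarrow> u \<in> carrier (fibre F y) \<Longrightarrow> u \<in> total F"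
  using fibre by auto

lemma \<alpha>_fibre: "g \<in> carrier G \<Longrightarrow> y \<in> X \<Longrightarrow> u \<in> carrier (fibre F y) \<Longrightarrow> \<alpha> g u \<in> carrier (fibre F (act g y))"
  using linear_mapD(1)[OF \<alpha>_linear] by blast

lemma \<alpha>_mult: "g \<in> carrier G \<Longrightarrow> h \<in> carrier G \<Longrightarrow> u \<in> total F \<Longrightarrow> \<alpha> (g \<otimes> h) u = \<alpha> g (\<alpha> h u)"
  using group_action.composition_rule[OF \<alpha>_action] by blast

lemma \<alpha>_inv: "g \<in> carrier G \<Longrightarrow> u \<in> total F \<Longrightarrow> \<alpha> (inv g) (\<alpha> g u) = u"
  using group_action.orbit_sym_aux[OF \<alpha>_action] by blast

lemma \<alpha>_inv': "g \<in> carrier G \<Longrightarrow> u \<in> total F \<Longrightarrow> \<alpha> g (\<alpha> (inv g) u) = u"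
  using \<alpha>_inv[of "inv g" u] by simp

lemma \<alpha>_one: "u \<in> total F \<Longrightarrow> \<alpha> \<one> u = u"
  using group_action.id_eq_one[OF \<alpha>_action] by (metis restrict_apply')

lemma \<alpha>_inv_fibre: "g \<in> carrier G \<Longrightarrow> y \<in> X \<Longrightarrow> u \<in> carrier (fibre F (act g y)) \<Longrightarrow> \<alpha> (inv g) u \<in> carrier (fibre F y)"
  using \<alpha>_fibre[of "inv g" "act g y" u] act_X act_inv by simp

lemma \<alpha>_continuous: "continuous_map (prod_topology TG (top_of_set (total F))) (top_of_set (total F)) (\<lambda>(g, u). \<alpha> g u)"
  using equivariant by (simp add: equivariant_vector_bundle_def continuous_action_def)

lemma continuous_on_\<alpha>:
  assumes "g \<in> carrier G" shows "continuous_on (total F) (\<alpha> g)"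
proof -
  have "continuous_map (top_of_set (total F)) (prod_topology TG (top_of_set (total F))) (\<lambda>u. (g, u))"
    using assms topspace_TG by (auto intro!: continuous_map_pairedI)
  from continuous_map_compose[OF this \<alpha>_continuous]
  have "continuous_map (top_of_set (total F)) (top_of_set (total F)) (\<alpha> g)" by (simp add: comp_def)
  then show ?thesis by (simp add: continuous_map_in_subtopology)
qed

lemma continuous_map_\<alpha>_orbit:
  assumes "u \<in> total F" shows "continuous_map TG (top_of_set (total F)) (\<lambda>g. \<alpha> g u)"
proof -
  have "continuous_map TG (prod_topology TG (top_of_set (total F))) (\<lambda>g. (g, u))"
    using assms by (auto intro!: continuous_map_pairedI)
  from continuous_map_compose[OF this \<alpha>_continuous] show ?thesis by (simp add: comp_def)
qed

text \<open>The action on \<open>W\<close> carried over to the fibre at \<open>x\<close>. On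
  \<open>H\<close> it agrees with \<open>\<alpha>\<close> because \<open>T0\<close> is
  \<open>H\<close>-equivariant; hence elements of \<open>E\<close> commute with the action that the
  bundle gives.\<close>

definition \<rho>V :: "'g \<Rightarrow> 'e \<Rightarrow> 'e" where
  "\<rho>V g u = T0 (\<rho> g (inv_into (carrier W) T0 u))"

definition R :: "'g \<Rightarrow> lop" where "R g = coord_op (\<rho>V g)"

lemma T0_linear: "linear_map class_ring W V T0" and T0_bij: "bij_betw T0 (carrier W) (carrier V)"
  using T0 by (auto simp: linear_iso_def)

lemma T0i: "u \<in> carrier V \<Longrightarrow> inv_into (carrier W) T0 u \<in> carrier W" "u \<in> carrier V \<Longrightarrow> T0 (inv_into (carrier W) T0 u) = u"
  "w \<in> carrier W \<Longrightarrow> inv_into (carrier W) T0 (T0 w) = w"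
  using T0_bij by (auto simp: bij_betw_def inv_into_into f_inv_into_f)

lemma T0_V: "w \<in> carrier W \<Longrightarrow> T0 w \<in> carrier V"
  using linear_mapD(1)[OF T0_linear] .

lemma \<rho>V_linear: "g \<in> carrier G \<Longrightarrow> linear_map class_ring V V (\<rho>V g)"
  unfolding \<rho>V_def[abs_def] using linear_iso_inverse[OF T0]
  by (intro linear_map_compose[OF _ T0_linear] linear_map_compose[OF _ \<rho>_linear]) (auto simp: linear_iso_def)

lemma \<rho>_W: "g \<in> carrier G \<Longrightarrow> w \<in> carrier W \<Longrightarrow> \<rho> g w \<in> carrier W"
  using linear_mapD(1)[OF \<rho>_linear] .

lemma \<rho>V_T0: "w \<in> carrier W \<Longrightarrow> \<rho>V g (T0 w) = T0 (\<rho> g w)"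
  by (simp add: \<rho>V_def T0i)

lemma \<rho>V_mult: "g \<in> carrier G \<Longrightarrow> h \<in> carrier G \<Longrightarrow> u \<in> carrier V \<Longrightarrow> \<rho>V (g \<otimes> h) u = \<rho>V g (\<rho>V h u)"
  using group_action.composition_rule[OF \<rho>_action] by (simp add: \<rho>V_def T0i \<rho>_W)

lemma \<rho>V_one: "u \<in> carrier V \<Longrightarrow> \<rho>V \<one> u = u"
  using group_action.id_eq_one[OF \<rho>_action] T0i by (metis \<rho>V_def restrict_apply')

lemma \<rho>V_H: "g \<in> H \<Longrightarrow> u \<in> carrier V \<Longrightarrow> \<rho>V g u = \<alpha> g u"
  by (simp add: \<rho>V_def T0_equivariant T0i)

lemma R_blocks: "g \<in> carrier G \<Longrightarrow> R g \<in> blocks N"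
  by (simp add: R_def coord_op_blocks \<rho>V_linear)

lemma R_\<kappa>: "g \<in> carrier G \<Longrightarrow> u \<in> carrier V \<Longrightarrow> app (R g) (\<kappa> u) = \<kappa> (\<rho>V g u)"
  by (simp add: R_def coord_op_\<kappa> \<rho>V_linear)

lemma R_NN: "g \<in> carrier G \<Longrightarrow> ent (R g) N N = 1"
  by (simp add: R_def ent_coord_op \<rho>V_linear)

lemma R_mult: assumes "g \<in> carrier G" "h \<in> carrier G" shows "R (g \<otimes> h) = R g * R h"
proof -
  have "R g * R h = coord_op (\<lambda>u. \<rho>V g (\<rho>V h u))" unfolding R_def using assms by (intro coord_op_mult \<rho>V_linear)
  also have "\<dots> = R (g \<otimes> h)"
  proof -
    have "R (g \<otimes> h) = coord_op (\<lambda>u. \<rho>V g (\<rho>V h u))"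
      using assms by (intro coord_op_eqI linear_map_compose[OF \<rho>V_linear \<rho>V_linear] R_blocks R_NN) (auto simp: R_\<kappa> \<rho>V_mult)
    then show ?thesis by simp
  qed
  finally show ?thesis by simp
qed

lemma R_one: "R \<one> = 1"
proof -
  have "1 = coord_op (\<rho>V \<one>)"
    by (intro coord_op_eqI \<rho>V_linear blocks_one) (auto simp: ent_one \<rho>V_one)
  then show ?thesis by (simp add: R_def)
qed

lemma R_H_lam: "g \<in> H \<Longrightarrow> v \<in> corner N \<Longrightarrow> lam (app (R g) v) = \<alpha> g (lam v)"
  using R_\<kappa>[of g "lam v"] H_G lam_V \<kappa>_lam \<rho>V_H lam_\<kappa> linear_mapD(1)[OF \<rho>V_linear] by metis

text \<open>By transitivity \<open>X\<close> is \<open>G/H\<close>, and \<open>t\<close> picks a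
  representative of each coset.\<close>

definition t :: "'x \<Rightarrow> 'g" where
  "t y = (SOME g. g \<in> carrier G \<and> act g x = y)"

lemma t: "y \<in> X \<Longrightarrow> t y \<in> carrier G" "y \<in> X \<Longrightarrow> act (t y) x = y"
proof -
  assume "y \<in> X"
  then have "\<exists>g. g \<in> carrier G \<and> act g x = y"
    using transitive_action.unique_orbit[OF transitive x_X] by blast
  then show "t y \<in> carrier G" "act (t y) x = y" unfolding t_def by (metis (mono_tags, lifting) someI_ex)+
qed

lemma coset_H: "g \<in> carrier G \<Longrightarrow> h \<in> carrier G \<Longrightarrow> act g x = act h x \<Longrightarrow> inv g \<otimes> h \<in> H"
  using act_inv[of g x] act_mult[of "inv g" h x] x_X by (intro H_I) auto

abbreviation "E \<equiv> commutant N R H"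
abbreviation "D \<equiv> commutant N R (carrier G)"

text \<open>\<open>H\<close> is the preimage of a point under a continuous map to a discrete space,
  hence closed and compact, and the entries of \<open>R\<close> on \<open>H\<close> are continuous
  because they can be computed from \<open>\<alpha>\<close>. The finitely many coset representatives
  contribute finitely many further factors.\<close>

lemma frob_bounded: "\<exists>B. \<forall>g\<in>carrier G. frob N (R g) \<le> B"
proof -
  have "continuous_map TG (discrete_topology X) (\<lambda>g. act g x)"
  proof -
    have c: "continuous_map (prod_topology TG (discrete_topology X)) (discrete_topology X) (\<lambda>(g, y). act g y)"
      using equivariant by (simp add: equivariant_vector_bundle_def continuous_action_def)
    have "continuous_map TG (prod_topology TG (discrete_topology X)) (\<lambda>g. (g, x))"
      using x_X by (auto intro!: continuous_map_pairedI)
    from continuous_map_compose[OF this c] show ?thesis by (simp add: comp_def)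
  qed
  then have "closedin TG {g \<in> topspace TG. act g x \<in> {x}}"
    using x_X by (intro closedin_continuous_map_preimage) auto
  then have "closedin TG H" by (simp add: stabilizer_def topspace_TG)
  then have cH: "compactin TG H" using compact_TG closedin_compact_space by blast
  have "\<exists>C. \<forall>g\<in>H. (cmod (ent (R g) i j))\<^sup>2 \<le> C" if "i < N" "j < N" for i j
  proof -
    let ?u = "lam (unit_seq j)"
    have u: "?u \<in> carrier V" using that by (intro lam_V unit_seq_corner)
    have "continuous_map (subtopology TG H) (top_of_set (carrier V)) (\<lambda>g. \<alpha> g ?u)"
      using continuous_map_\<alpha>_orbit[OF fibre_total[OF x_X u]] \<alpha>_fibre[OF H_G x_X u] H_x
      by (auto simp: continuous_map_in_subtopology continuous_map_from_subtopology)
    from this have "continuous_map (subtopology TG H) euclideanreal ((\<lambda>u. (cmod (\<kappa> u i))\<^sup>2) \<circ> (\<lambda>g. \<alpha> g ?u))"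
    proof (rule continuous_map_compose)
      show "continuous_map (top_of_set (carrier V)) euclideanreal (\<lambda>u. (cmod (\<kappa> u i))\<^sup>2)"
      using continuous_on_product_then_coordinatewise[OF continuous_\<kappa>, of i]
        by (simp add: continuous_intros)
    qed
    then have "continuous_map (subtopology TG H) euclideanreal (\<lambda>g. (cmod (\<kappa> (\<alpha> g ?u) i))\<^sup>2)"
      by (simp add: comp_def)
    then have "compactin euclideanreal ((\<lambda>g. (cmod (\<kappa> (\<alpha> g ?u) i))\<^sup>2) ` H)"
      using cH by (intro image_compactin[of "subtopology TG H"]) (auto simp: compactin_subtopology)
    then have "bdd_above ((\<lambda>g. (cmod (\<kappa> (\<alpha> g ?u) i))\<^sup>2) ` H)"
      by (simp add: bounded_imp_bdd_above compact_imp_bounded)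
    then obtain C where "\<forall>g\<in>H. (cmod (\<kappa> (\<alpha> g ?u) i))\<^sup>2 \<le> C" by (auto simp: bdd_above_def)
    moreover have "ent (R g) i j = \<kappa> (\<alpha> g ?u) i" if "g \<in> H" for g
      using that \<open>j < N\<close> u by (simp add: R_def ent_coord_op \<rho>V_linear H_G \<rho>V_H)
    ultimately show ?thesis by auto
  qed
  then obtain C where C: "\<And>i j g. i < N \<Longrightarrow> j < N \<Longrightarrow> g \<in> H \<Longrightarrow> (cmod (ent (R g) i j))\<^sup>2 \<le> C i j" by metis
  define B where "B = (\<Sum>i<N. \<Sum>j<N. C i j)"
  have B: "frob N (R g) \<le> B" if "g \<in> H" for g
    unfolding frob_def B_def using that by (intro sum_mono C) auto
  have "frob N (R g) \<le> (\<Sum>y\<in>X. frob N (R (t y))) * B" if g: "g \<in> carrier G" for g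
  proof -
    let ?y = "act g x"
    have y: "?y \<in> X" using g x_X act_X by blast
    have h: "inv (t ?y) \<otimes> g \<in> H" using coset_H[of "t ?y" g] t[OF y] g by simp
    have "R g = R (t ?y) * R (inv (t ?y) \<otimes> g)" using t[OF y] g by (simp add: R_mult[symmetric] m_assoc[symmetric])
    then have "frob N (R g) \<le> frob N (R (t ?y)) * frob N (R (inv (t ?y) \<otimes> g))"
      using frob_mult[OF R_blocks] t[OF y] by metis
    also have "\<dots> \<le> (\<Sum>y\<in>X. frob N (R (t y))) * B"
      using y finite_X by (intro mult_mono B[OF h] member_le_sum frob_nonneg sum_nonneg) (auto intro: frob_nonneg)
    finally show ?thesis .
  qed
  then show ?thesis by blast
qed

text \<open>The hypothesis speaks of subspaces of the module \<open>W\<close>, the decomposition of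
  subspaces of sequences. The equivariant bijection \<open>crd\<close> from \<open>W\<close> onto
  the corner translates subspaces in both directions.\<close>

lemma irreducible_subrep_H:
  assumes Z: "irreducible_subrep N R (carrier G) Z"
  shows "irreducible_subrep N R H Z"
proof -
  define crd where "crd w = \<kappa> (T0 w)" for w
  have crd_corner: "crd w \<in> corner N" if "w \<in> carrier W" for w using that by (simp add: crd_def \<kappa>_corner T0_V)
  have crd_add: "crd (v \<oplus>\<^bsub>W\<^esub> w) = crd v + crd w" if "v \<in> carrier W" "w \<in> carrier W" for v w
    using that by (simp add: crd_def \<kappa>_add T0_V linear_mapD[OF T0_linear])
  have crd_scale: "crd (c \<odot>\<^bsub>W\<^esub> w) = cscale c (crd w)" if "w \<in> carrier W" for c w
    using that by (simp add: crd_def \<kappa>_scale T0_V linear_mapD[OF T0_linear])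
  have crd_\<rho>: "app (R g) (crd w) = crd (\<rho> g w)" if "g \<in> carrier G" "w \<in> carrier W" for g w
    using that by (simp add: crd_def R_\<kappa> T0_V \<rho>V_T0)
  have crd_surj: "\<exists>w\<in>carrier W. v = crd w" if "v \<in> corner N" for v
    using that T0i(1,2)[OF lam_V] \<kappa>_lam by (metis crd_def)
  have crd_inj: "v = w" if "crd v = crd w" "v \<in> carrier W" "w \<in> carrier W" for v w
    using that lam_\<kappa> T0_V T0i(3) unfolding crd_def by metis
  have Wvs: "vectorspace class_ring W" using linear_map_vectorspaces[OF T0_linear] by blast
  have crd_0: "crd \<zero>\<^bsub>W\<^esub> = 0"
  proof -
    interpret vectorspace class_ring W by (rule Wvs)
    have "crd \<zero>\<^bsub>W\<^esub> = crd (\<zero>\<^bsub>W\<^esub> \<oplus>\<^bsub>W\<^esub> \<zero>\<^bsub>W\<^esub>)" by simp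
    also have "\<dots> = crd \<zero>\<^bsub>W\<^esub> + crd \<zero>\<^bsub>W\<^esub>" by (intro crd_add) auto
    finally show ?thesis by simp
  qed
  have W0: "\<zero>\<^bsub>W\<^esub> \<in> carrier W"
  proof -
    interpret vectorspace class_ring W by (rule Wvs)
    show ?thesis by simp
  qed
  define \<Lambda> where "\<Lambda> Y = {w \<in> carrier W. crd w \<in> Y}" for Y
  have crd_\<Lambda>: "crd ` \<Lambda> Y = Y" if "Y \<subseteq> corner N" for Y
    using that crd_surj by (auto simp: \<Lambda>_def image_iff)
  have sub_corner: "Y \<subseteq> corner N" if "subrep N R S Y" for S Y
    using that by (auto simp: subrep_def corner_def)
  have module_W: "module class_ring W" using Wvs by (simp add: vectorspace_def)
  have inv_sub: "VectorSpace.subspace class_ring (\<Lambda> Y) W" if "subrep N R S Y" for S Y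
    using that Wvs module_W crd_0 W0 crd_add crd_scale vectorspace_closed[OF Wvs]
    by (auto simp: VectorSpace.subspace_def submodule_def \<Lambda>_def subrep_def seq.subspace_def)
  have \<rho>_\<Lambda>: "\<rho> g ` \<Lambda> Y \<subseteq> \<Lambda> Y" if "subrep N R S Y" "g \<in> S" "g \<in> carrier G" for S Y g
  proof
    fix v assume "v \<in> \<rho> g ` \<Lambda> Y"
    then obtain w where w: "v = \<rho> g w" "w \<in> carrier W" "crd w \<in> Y" by (auto simp: \<Lambda>_def)
    have "app (R g) (crd w) \<in> Y" using that(1,2) w(3) unfolding subrep_def by blast
    then show "v \<in> \<Lambda> Y" using crd_\<rho>[OF that(3) w(2)] \<rho>_W[OF that(3) w(2)] w(1) by (simp add: \<Lambda>_def)
  qed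
  have vs\<Lambda>: "vectorspace class_ring (W\<lparr>carrier := \<Lambda> Y\<rparr>)" if "subrep N R S Y" for S Y
    using vectorspace.subspace_is_vs[OF Wvs inv_sub[OF that]] .
  have Zs: "subrep N R (carrier G) Z" "Z \<noteq> {0}" using Z by (auto simp: irreducible_subrep_def)
  let ?U = "\<Lambda> Z" and ?WU = "W\<lparr>carrier := \<Lambda> Z\<rparr>"
  have nontrivial: "carrier ?WU \<noteq> {\<zero>\<^bsub>?WU\<^esub>}"
    using Zs(2) crd_\<Lambda>[OF sub_corner[OF Zs(1)]] crd_0 by auto
  have to_sub: "subrep N R S (crd ` U) \<and> crd ` U \<subseteq> Z \<and> U \<subseteq> \<Lambda> Z"
    if "VectorSpace.subspace class_ring U ?WU" "\<And>g. g \<in> S \<Longrightarrow> \<rho> g ` U \<subseteq> U" "S \<subseteq> carrier G" for U S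
  proof -
    have U: "U \<subseteq> \<Lambda> Z" "\<zero>\<^bsub>W\<^esub> \<in> U" "\<And>v w. v \<in> U \<Longrightarrow> w \<in> U \<Longrightarrow> v \<oplus>\<^bsub>W\<^esub> w \<in> U" "\<And>c v. v \<in> U \<Longrightarrow> c \<odot>\<^bsub>W\<^esub> v \<in> U"
      using that(1) by (auto simp: VectorSpace.subspace_def submodule_def)
    have UW: "w \<in> carrier W" if "w \<in> U" for w using U(1) that by (auto simp: \<Lambda>_def)
    have "seq.subspace (crd ` U)"
      unfolding seq.subspace_def
    proof (intro conjI ballI allI)
      show "0 \<in> crd ` U" using U(2) crd_0 by (metis imageI)
      fix v assume "v \<in> crd ` U"
      then obtain v' where v': "v = crd v'" "v' \<in> U" by blast
      show "cscale c v \<in> crd ` U" for c using v' crd_scale[of v' c] U(4) UW by (metis imageI)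
      fix w assume "w \<in> crd ` U"
      then obtain w' where w': "w = crd w'" "w' \<in> U" by blast
      show "v + w \<in> crd ` U" using v' w' crd_add[of v' w'] U(3) UW by (metis imageI)
    qed
    moreover have "app (R g) v \<in> crd ` U" if "g \<in> S" "v \<in> crd ` U" for g v
      using that \<open>S \<subseteq> carrier G\<close> \<open>\<And>g. g \<in> S \<Longrightarrow> \<rho> g ` U \<subseteq> U\<close> crd_\<rho> UW by (auto simp: image_subset_iff)
    ultimately show ?thesis using U(1) UW crd_corner by (auto simp: subrep_def \<Lambda>_def corner_def)
  qed
  have "irreducible_rep G ?WU \<rho>"
    unfolding irreducible_rep_def
  proof (intro conjI allI impI nontrivial)
    fix U assume U: "invariant_subspace G ?WU \<rho> U"
    then have *: "subrep N R (carrier G) (crd ` U) \<and> crd ` U \<subseteq> Z \<and> U \<subseteq> \<Lambda> Z"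
      by (intro to_sub) (auto simp: invariant_subspace_def)
    then have UW: "U \<subseteq> carrier W" by (auto simp: \<Lambda>_def)
    have "crd ` U = {0} \<or> crd ` U = Z" using * Z by (auto simp: irreducible_subrep_def)
    then show "U = {\<zero>\<^bsub>?WU\<^esub>} \<or> U = carrier ?WU"
    proof
      assume c: "crd ` U = {0}"
      have "w = \<zero>\<^bsub>W\<^esub>" if "w \<in> U" for w
      proof (rule crd_inj)
        have "crd w \<in> {0}" using that c by blast
        then show "crd w = crd \<zero>\<^bsub>W\<^esub>" using crd_0 by simp
      qed (use that UW W0 in auto)
      moreover have "U \<noteq> {}" using c by auto
      ultimately have "U = {\<zero>\<^bsub>W\<^esub>}" by blast
      then show ?thesis by simp
    next
      assume c: "crd ` U = Z"
      have "w \<in> U" if "w \<in> \<Lambda> Z" for w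
      proof -
        have "w \<in> carrier W" "crd w \<in> crd ` U" using that c by (auto simp: \<Lambda>_def)
        then obtain w' where "w' \<in> U" "crd w = crd w'" by blast
        then show ?thesis using crd_inj[of w w'] \<open>w \<in> carrier W\<close> UW by auto
      qed
      then show ?thesis using * by auto
    qed
  qed
  moreover have "invariant_subspace G W \<rho> ?U"
    using inv_sub[OF Zs(1)] \<rho>_\<Lambda>[OF Zs(1)] by (simp add: invariant_subspace_def)
  ultimately have irrH: "irreducible_rep (isotropy_group G act x) ?WU \<rho>"
    using irreducible_restriction by blast
  have "Y = {0} \<or> Y = Z" if Y: "subrep N R H Y" "Y \<subseteq> Z" for Y
  proof -
    have "\<Lambda> Y \<subseteq> \<Lambda> Z" using Y(2) by (auto simp: \<Lambda>_def)
    then have "VectorSpace.subspace class_ring (\<Lambda> Y) ?WU"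
      using inv_sub[OF Y(1)] vs\<Lambda>[OF Zs(1)] by (auto simp: VectorSpace.subspace_def submodule_def vectorspace_def)
    moreover have "\<rho> g ` \<Lambda> Y \<subseteq> \<Lambda> Y" if "g \<in> H" for g
      using \<rho>_\<Lambda>[OF Y(1) that H_G[OF that]] .
    ultimately have "invariant_subspace (isotropy_group G act x) ?WU \<rho> (\<Lambda> Y)"
      by (auto simp: invariant_subspace_def isotropy_group_def)
    then have "\<Lambda> Y = {\<zero>\<^bsub>W\<^esub>} \<or> \<Lambda> Y = \<Lambda> Z" using irrH by (auto simp: irreducible_rep_def)
    then have "crd ` \<Lambda> Y = {0} \<or> crd ` \<Lambda> Y = crd ` \<Lambda> Z" using crd_0 by auto
    then show ?thesis using crd_\<Lambda> sub_corner Y(1) Zs(1) by metis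
  qed
  moreover have "subrep N R H Z" using Zs(1) H_G by (auto simp: subrep_def)
  ultimately show ?thesis using Zs(2) by (simp add: irreducible_subrep_def)
qed

end

section \<open>Clutching maps as a homogeneous space\<close>

lemma quot_map_clutch:
  assumes psi: "pointwise_clutching_map X F \<psi>" and yz: "y \<in> X" "z \<in> X"
    and fib: "\<And>y. y \<in> X \<Longrightarrow> carrier (fibre F y) = {u \<in> total F. proj F u = y}"
    and pX: "\<And>u. u \<in> total F \<Longrightarrow> proj F u \<in> X" and u: "u \<in> carrier (fibre F y)"
  shows "quot_map F \<psi> (\<psi> (y, z) u) = quot_map F \<psi> u"
proof -
  have "\<psi> \<in> (\<Pi>\<^sub>E (y, z)\<in>X \<times> X. iso_set (fibre F y) (fibre F z))"
    using psi by (simp add: pointwise_clutching_map_def)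
  then have "\<psi> (y, z) \<in> iso_set (fibre F y) (fibre F z)" using yz by (auto dest: PiE_mem)
  then have c: "\<psi> (y, z) u \<in> carrier (fibre F z)" using u by (auto simp: iso_set_def)
  have "\<psi> (y, w) = compose (carrier (fibre F y)) (\<psi> (z, w)) (\<psi> (y, z))" if "w \<in> X" for w
    using psi yz that unfolding pointwise_clutching_map_def by blast
  then have comp: "\<psi> (y, w) u = \<psi> (z, w) (\<psi> (y, z) u)" if "w \<in> X" for w
    using u that by (simp add: compose_eq)
  have "proj F u = y" "u \<in> total F" "proj F (\<psi> (y, z) u) = z" "\<psi> (y, z) u \<in> total F"
    using u c fib yz by auto
  then show ?thesis
    using comp pX by (auto simp: quot_map_def clutching_rel_def)
qed

context clutching_coordinates
begin

text \<open>An equivariant \<open>\<psi>\<close> satisfies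
  \<open>\<psi> (g x, g' x) (g u) = g' (S (g'^-1 g) u)\<close>, where \<open>S\<close> is the action
  it induces on the fibre over \<open>x\<close>. This is that formula for the action
  \<open>a R a^-1\<close>, with \<open>g = t y\<close> and \<open>g' = t z\<close>.\<close>

definition transport :: "lop \<Rightarrow> 'x \<times> 'x \<Rightarrow> 'e \<Rightarrow> 'e" where
  "transport a = (\<lambda>(y, z)\<in>X \<times> X. \<lambda>u\<in>carrier (fibre F y).
     \<alpha> (t z) (lam (app (a * R (inv (t z) \<otimes> t y) * binv N a) (\<kappa> (\<alpha> (inv (t y)) u)))))"

definition units where "units = {a \<in> E. bdet N a \<noteq> 0}"

lemma bounded_block_rep: obtains B where "bounded_block_rep G N R B"
proof -
  obtain B where "\<forall>g\<in>carrier G. frob N (R g) \<le> B" using frob_bounded by blast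
  then have "bounded_block_rep G N R B"
    by unfold_locales (auto simp: R_blocks R_mult R_one)
  then show ?thesis by (rule that)
qed

sublocale alg: matrix_like_algebra E scal "bdet N" "binv N"
  by (rule matrix_like_commutant) (use R_blocks H_G in blast)

lemma units_eq: "alg.units = units" by (simp add: alg.units_def units_def)

lemma units_blocks: "a \<in> units \<Longrightarrow> a \<in> blocks N" "a \<in> units \<Longrightarrow> binv N a \<in> blocks N"
  using alg.iv_units[unfolded units_eq] by (auto simp: units_def commutant_def)

lemma units_inv: "a \<in> units \<Longrightarrow> a * binv N a = 1" "a \<in> units \<Longrightarrow> binv N a * a = 1"
  using alg.iv_left alg.iv_right by (auto simp: units_def)

lemma units_R: "a \<in> units \<Longrightarrow> g \<in> H \<Longrightarrow> a * R g = R g * a" "a \<in> units \<Longrightarrow> g \<in> H \<Longrightarrow> binv N a * R g = R g * binv N a"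
  using alg.iv_units[unfolded units_eq] by (auto simp: units_def commutant_def)

section \<open>Clutching maps from conjugated actions\<close>

definition conjR :: "lop \<Rightarrow> 'g \<Rightarrow> lop" where "conjR a g = a * R g * binv N a"

lemma conjR_blocks: "a \<in> units \<Longrightarrow> g \<in> carrier G \<Longrightarrow> conjR a g \<in> blocks N"
  by (simp add: conjR_def blocks_mult units_blocks R_blocks)

lemma conjR_mult: "a \<in> units \<Longrightarrow> g \<in> carrier G \<Longrightarrow> h \<in> carrier G \<Longrightarrow> conjR a (g \<otimes> h) = conjR a g * conjR a h"
  unfolding conjR_def R_mult using units_inv(2) by (metis mult.assoc mult_1)

lemma conjR_one: "a \<in> units \<Longrightarrow> conjR a \<one> = 1"
  by (simp add: conjR_def R_one units_inv)

lemma conjR_H: "a \<in> units \<Longrightarrow> h \<in> H \<Longrightarrow> conjR a h = R h"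
  by (simp add: conjR_def units_R mult.assoc units_inv)

lemma conjR_corner: "a \<in> units \<Longrightarrow> g \<in> carrier G \<Longrightarrow> v \<in> corner N \<Longrightarrow> app (conjR a g) v \<in> corner N"
  by (intro blocks_corner conjR_blocks)

lemma fibre_coset:
  assumes "y \<in> X" "u \<in> carrier (fibre F y)" "g \<in> carrier G" "act g x = y"
  obtains v where "v \<in> carrier V" "u = \<alpha> g v"
  using that[of "\<alpha> (inv g) u"] assms \<alpha>_inv_fibre[of g x u] \<alpha>_inv'[of g u] fibre_total x_X by auto

text \<open>The chosen representatives may be replaced by any others: the difference lies in
  \<open>H\<close>, where \<open>conjR a\<close> agrees with \<open>R\<close>, since
  \<open>a\<close> commutes with it, and therefore with \<open>\<alpha>\<close>.\<close>

lemma transport_coset: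
  assumes a: "a \<in> units" and g: "g \<in> carrier G" "act g x = y" and g': "g' \<in> carrier G" "act g' x = z"
    and u: "u \<in> carrier V"
  shows "transport a (y, z) (\<alpha> g u) = \<alpha> g' (lam (app (conjR a (inv g' \<otimes> g)) (\<kappa> u)))"
proof -
  have yz: "y \<in> X" "z \<in> X" using g g' act_X x_X by auto
  note ty = t[OF yz(1)] and tz = t[OF yz(2)]
  define h h' where "h = inv (t y) \<otimes> g" and "h' = inv g' \<otimes> t z"
  have h: "h \<in> H" "h' \<in> H" unfolding h_def h'_def using ty tz g g' by (auto intro!: coset_H)
  have hG: "h \<in> carrier G" "h' \<in> carrier G" using h H_G by auto
  have uT: "u \<in> total F" using fibre_total[OF x_X u] .
  have 1: "\<alpha> (inv (t y)) (\<alpha> g u) = \<alpha> h u" using ty g uT by (simp add: h_def \<alpha>_mult)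
  have agu: "\<alpha> g u \<in> carrier (fibre F y)" using \<alpha>_fibre[OF g(1) x_X u] g(2) by simp
  have 2: "\<kappa> (\<alpha> h u) = app (conjR a h) (\<kappa> u)" using h u a by (simp add: conjR_H R_\<kappa> H_G \<rho>V_H)
  let ?v = "app (conjR a (inv (t z) \<otimes> t y)) (app (conjR a h) (\<kappa> u))"
  have v: "?v \<in> corner N" using a ty tz hG u by (intro conjR_corner \<kappa>_corner) auto
  have tz': "t z = g' \<otimes> h'" using g' tz by (simp add: h'_def m_assoc[symmetric])
  have "transport a (y, z) (\<alpha> g u) = \<alpha> (t z) (lam ?v)"
    using yz agu by (simp add: transport_def 1 2 flip: conjR_def)
  also have "\<dots> = \<alpha> g' (\<alpha> h' (lam ?v))" 
    using \<alpha>_mult[OF g'(1) hG(2) fibre_total[OF x_X lam_V[OF v]]] unfolding tz'[symmetric] .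
  also have "\<alpha> h' (lam ?v) = lam (app (conjR a h') ?v)" using h v a by (simp add: R_H_lam conjR_H)
  also have "app (conjR a h') ?v = app (conjR a (h' \<otimes> (inv (t z) \<otimes> t y) \<otimes> h)) (\<kappa> u)"
    using a hG ty tz by (simp add: conjR_mult)
  also have "h' \<otimes> (inv (t z) \<otimes> t y) \<otimes> h = inv g' \<otimes> g"
  proof -
    have "h' \<otimes> (inv (t z) \<otimes> t y) \<otimes> h = inv g' \<otimes> (t z \<otimes> inv (t z)) \<otimes> (t y \<otimes> inv (t y)) \<otimes> g"
      unfolding h_def h'_def using g g' ty tz by (simp only: m_assoc inv_closed m_closed)
    then show ?thesis using g g' ty tz by simp
  qed
  finally show ?thesis .
qed

lemma transport_fibre:
  assumes a: "a \<in> units" and yz: "y \<in> X" "z \<in> X" and u: "u \<in> carrier (fibre F y)"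
  shows "transport a (y, z) u \<in> carrier (fibre F z)"
proof -
  note ty = t[OF yz(1)] and tz = t[OF yz(2)]
  obtain v where v: "v \<in> carrier V" "u = \<alpha> (t y) v" using fibre_coset[OF yz(1) u ty] by blast
  have "lam (app (conjR a (inv (t z) \<otimes> t y)) (\<kappa> v)) \<in> carrier V"
    using a ty tz v by (intro lam_V conjR_corner \<kappa>_corner) auto
  then show ?thesis using transport_coset[OF a ty tz v(1)] v(2) \<alpha>_fibre[OF tz(1) x_X] tz(2) by simp
qed

lemma transport_cocycle:
  assumes a: "a \<in> units" and X: "y \<in> X" "z \<in> X" "w \<in> X" and u: "u \<in> carrier (fibre F y)"
  shows "transport a (y, w) u = transport a (z, w) (transport a (y, z) u)"
proof -
  note ty = t[OF X(1)] and tz = t[OF X(2)] and tw = t[OF X(3)]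
  obtain v where v: "v \<in> carrier V" "u = \<alpha> (t y) v" using fibre_coset[OF X(1) u ty] by blast
  let ?v = "app (conjR a (inv (t z) \<otimes> t y)) (\<kappa> v)"
  have v': "?v \<in> corner N" using a ty tz v by (intro conjR_corner \<kappa>_corner) auto
  have "transport a (z, w) (transport a (y, z) u) = \<alpha> (t w) (lam (app (conjR a (inv (t w) \<otimes> t z)) ?v))"
    using transport_coset[OF a tz tw lam_V[OF v']] transport_coset[OF a ty tz v(1)] v(2) \<kappa>_lam[OF v'] by simp
  also have "app (conjR a (inv (t w) \<otimes> t z)) ?v = app (conjR a ((inv (t w) \<otimes> t z) \<otimes> (inv (t z) \<otimes> t y))) (\<kappa> v)"
    using a ty tz tw by (simp add: conjR_mult)
  also have "(inv (t w) \<otimes> t z) \<otimes> (inv (t z) \<otimes> t y) = inv (t w) \<otimes> t y"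
  proof -
    have "(inv (t w) \<otimes> t z) \<otimes> (inv (t z) \<otimes> t y) = inv (t w) \<otimes> (t z \<otimes> inv (t z)) \<otimes> t y"
      using ty tz tw by (simp only: m_assoc inv_closed m_closed)
    then show ?thesis using ty tz tw by simp
  qed
  finally show ?thesis using transport_coset[OF a ty tw v(1)] v(2) by simp
qed

lemma transport_refl:
  assumes a: "a \<in> units" and y: "y \<in> X" and u: "u \<in> carrier (fibre F y)"
  shows "transport a (y, y) u = u"
proof -
  note ty = t[OF y]
  obtain v where v: "v \<in> carrier V" "u = \<alpha> (t y) v" using fibre_coset[OF y u ty] by blast
  show ?thesis using transport_coset[OF a ty ty v(1)] v ty a by (simp add: conjR_one lam_\<kappa>)
qed

lemma transport_linear:
  assumes a: "a \<in> units" and yz: "y \<in> X" "z \<in> X"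
  shows "linear_map class_ring (fibre F y) (fibre F z) (transport a (y, z))"
proof -
  note ty = t[OF yz(1)] and tz = t[OF yz(2)]
  have 1: "linear_map class_ring (fibre F y) V (\<alpha> (inv (t y)))"
    using \<alpha>_linear[of "inv (t y)" y] ty act_inv[OF ty(1) x_X] yz by simp
  have 2: "linear_map class_ring V V (\<lambda>u. lam (app (conjR a (inv (t z) \<otimes> t y)) (\<kappa> u)))"
    using a ty tz by (intro linear_map_of_blocks conjR_blocks) auto
  have 3: "linear_map class_ring V (fibre F z) (\<alpha> (t z))" using \<alpha>_linear[OF tz(1) x_X] tz by simp
  note l = linear_map_compose[OF linear_map_compose[OF 1 2] 3]
  have eq: "transport a (y, z) u = \<alpha> (t z) (lam (app (conjR a (inv (t z) \<otimes> t y)) (\<kappa> (\<alpha> (inv (t y)) u))))"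
    if "u \<in> carrier (fibre F y)" for u
    using yz that by (simp add: transport_def conjR_def)
  show ?thesis
    using linear_mapD[OF l] vectorspace_closed[OF fibre_vs[OF yz(1)]]
    by (intro linear_mapI fibre_vs yz) (simp_all add: eq)
qed

lemma transport_extensional: "y \<in> X \<Longrightarrow> z \<in> X \<Longrightarrow> transport a (y, z) \<in> extensional (carrier (fibre F y))"
  by (simp add: transport_def)

lemma transport_clutching:
  assumes a: "a \<in> units"
  shows "pointwise_clutching_map X F (transport a)"
  unfolding pointwise_clutching_map_def
proof (intro conjI ballI)
  have iso: "transport a (y, z) \<in> iso_set (fibre F y) (fibre F z)" if "y \<in> X" "z \<in> X" for y z
  proof -
    have "linear_iso (fibre F y) (fibre F z) (transport a (y, z))"
    proof (rule linear_isoI[OF transport_linear[OF a that], of "transport a (z, y)"])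
      show "transport a (z, y) w \<in> carrier (fibre F y)" "transport a (y, z) (transport a (z, y) w) = w"
        if "w \<in> carrier (fibre F z)" for w
        using transport_fibre[OF a _ _ that] transport_cocycle[OF a _ _ _ that, of y z] transport_refl[OF a _ that] \<open>y \<in> X\<close> \<open>z \<in> X\<close> by auto
      show "transport a (z, y) (transport a (y, z) u) = u" if "u \<in> carrier (fibre F y)" for u
        using transport_cocycle[OF a _ _ _ that, of z y] transport_refl[OF a _ that] \<open>y \<in> X\<close> \<open>z \<in> X\<close> by auto
    qed
    then show ?thesis
      using transport_fibre[OF a that] transport_extensional[OF that] by (auto simp: iso_set_def PiE_def)
  qed
  show "transport a \<in> (\<Pi>\<^sub>E (y, z)\<in>X \<times> X. iso_set (fibre F y) (fibre F z))"
    using iso by (auto intro!: PiE_I simp: transport_def)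
  fix y assume y: "y \<in> X"
  show "transport a (y, y) = (\<lambda>u\<in>carrier (fibre F y). u)"
    using transport_extensional[OF y y] transport_refl[OF a y] by (auto simp: extensional_def fun_eq_iff restrict_def)
  fix z assume z: "z \<in> X"
  show "transport a (y, z) = restrict (inv_into (carrier (fibre F z)) (transport a (z, y))) (carrier (fibre F y))"
  proof (rule extensionalityI[OF transport_extensional[OF y z]])
    fix u assume u: "u \<in> carrier (fibre F y)"
    have inj: "inj_on (transport a (z, y)) (carrier (fibre F z))"
      using iso[OF z y] by (auto simp: iso_set_def linear_iso_def bij_betw_def)
    have "inv_into (carrier (fibre F z)) (transport a (z, y)) (transport a (z, y) (transport a (y, z) u)) = transport a (y, z) u"
      by (rule inv_into_f_f[OF inj transport_fibre[OF a y z u]])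
    then show "transport a (y, z) u = restrict (inv_into (carrier (fibre F z)) (transport a (z, y))) (carrier (fibre F y)) u"
      using u transport_cocycle[OF a y z y u] transport_refl[OF a y u] by simp
  qed simp
  fix w assume w: "w \<in> X"
  show "transport a (y, w) = compose (carrier (fibre F y)) (transport a (z, w)) (transport a (y, z))"
    by (rule extensionalityI[OF transport_extensional[OF y w] compose_extensional])
      (simp add: compose_eq transport_cocycle[OF a y z w])
qed

text \<open>Acting with \<open>g\<close> changes the representatives to
  \<open>inv g \<otimes> t y\<close> and \<open>inv g \<otimes> t z\<close>, which
  \<open>transport_coset\<close> admits, and the quotient of the two stays the same.\<close>

lemma transport_equivariant:
  assumes a: "a \<in> units"
  shows "transport a \<in> equivariant_clutching_maps G X act F \<alpha>"
proof -
  have "clutching_action G X act F \<alpha> g (transport a) = transport a" if g: "g \<in> carrier G" for g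
  proof (rule extensionalityI[of _ "X \<times> X"])
    show "clutching_action G X act F \<alpha> g (transport a) \<in> extensional (X \<times> X)" by (simp add: clutching_action_def)
    show "transport a \<in> extensional (X \<times> X)" by (simp add: transport_def)
    fix yz assume "yz \<in> X \<times> X"
    then obtain y z where yz: "yz = (y, z)" "y \<in> X" "z \<in> X" by auto
    note ty = t[OF yz(2)] and tz = t[OF yz(3)]
    have "clutching_action G X act F \<alpha> g (transport a) (y, z) = transport a (y, z)"
    proof (rule extensionalityI[of _ "carrier (fibre F y)"])
      show "clutching_action G X act F \<alpha> g (transport a) (y, z) \<in> extensional (carrier (fibre F y))"
        using yz by (simp add: clutching_action_def)
      show "transport a (y, z) \<in> extensional (carrier (fibre F y))" by (rule transport_extensional[OF yz(2,3)])
      fix u assume u: "u \<in> carrier (fibre F y)"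
      obtain v where v: "v \<in> carrier V" "u = \<alpha> (t y) v" using fibre_coset[OF yz(2) u ty] by blast
      note vT = fibre_total[OF x_X v(1)]
      let ?y = "inv g \<otimes> t y" and ?z = "inv g \<otimes> t z"
      let ?v = "lam (app (conjR a (inv ?z \<otimes> ?y)) (\<kappa> v))"
      have G: "?y \<in> carrier G" "?z \<in> carrier G" using g ty tz by auto
      have vV: "?v \<in> carrier V" using a G v by (intro lam_V conjR_corner \<kappa>_corner) auto
      have x: "act ?y x = act (inv g) y" "act ?z x = act (inv g) z"
        using g ty tz x_X by (auto simp: act_mult)
      have "clutching_action G X act F \<alpha> g (transport a) (y, z) u = \<alpha> g (transport a (act (inv g) y, act (inv g) z) (\<alpha> ?y v))"
        using yz u v ty g vT by (simp add: clutching_action_def \<alpha>_mult)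
      also have "\<dots> = \<alpha> g (\<alpha> ?z ?v)"
        using transport_coset[OF a G(1) x(1) G(2) x(2) v(1)] by simp
      also have "\<dots> = \<alpha> (t z) ?v"
        using g G tz fibre_total[OF x_X vV] by (simp flip: \<alpha>_mult m_assoc)
      also have "inv ?z \<otimes> ?y = inv (t z) \<otimes> t y"
      proof -
        have "inv ?z \<otimes> ?y = inv (t z) \<otimes> (g \<otimes> inv g) \<otimes> t y"
          using g ty tz by (simp only: inv_mult_group inv_inv m_assoc inv_closed m_closed)
        then show ?thesis using g ty tz by simp
      qed
      finally show "clutching_action G X act F \<alpha> g (transport a) (y, z) u = transport a (y, z) u"
        using transport_coset[OF a ty tz v(1)] v(2) by simp
    qed
    then show "clutching_action G X act F \<alpha> g (transport a) yz = transport a yz" using yz by simp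
  qed
  then show ?thesis using transport_clutching[OF a] by (simp add: equivariant_clutching_maps_def)
qed

lemma act_one_x: "act \<one> x = x"
  using group_action.id_eq_one[OF act_action] x_X by (metis restrict_apply')

text \<open>When classes are read off in the fibre over \<open>x\<close>, the action on the quotient
  becomes \<open>conjR a\<close>, and \<open>a\<close> intertwines \<open>R\<close> with it.\<close>

lemma transport_onto:
  assumes a: "a \<in> units"
  shows "transport a \<in> clutching_maps_onto G X act F \<alpha> W \<rho>"
proof -
  let ?\<psi> = "transport a" and ?Q = "quot_space X F (transport a)" and ?q = "quot_map F (transport a)"
  have bundle': "complex_vector_bundle (discrete_topology X) F"
    using equivariant by (simp add: equivariant_vector_bundle_def)
  have q: "linear_iso V ?Q ?q" by (rule quot_map_linear_iso[OF bundle' transport_clutching[OF a] x_X])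
  have A: "linear_iso V V (\<lambda>u. lam (app a (\<kappa> u)))"
    by (rule linear_isoI[OF linear_map_of_blocks[OF units_blocks(1)[OF a]], of "\<lambda>u. lam (app (binv N a) (\<kappa> u))"])
      (simp_all add: lam_V \<kappa>_lam blocks_corner \<kappa>_corner units_blocks a lam_\<kappa> units_inv flip: app_times)
  define T where "T w = ?q (lam (app a (\<kappa> (T0 w))))" for w
  have T: "linear_iso W ?Q T"
    unfolding T_def[abs_def] by (rule linear_iso_compose[OF linear_iso_compose[OF T0 A] q])
  have TE: "quot_action F \<alpha> ?\<psi> g (T w) = T (\<rho> g w)" if g: "g \<in> carrier G" and w: "w \<in> carrier W" for g w
  proof -
    let ?u = "lam (app a (\<kappa> (T0 w)))"
    have c: "app a (\<kappa> (T0 w)) \<in> corner N" by (intro blocks_corner units_blocks a \<kappa>_corner T0_V w)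
    have u: "?u \<in> carrier V" by (rule lam_V[OF c])
    have gx: "act g x \<in> X" by (rule act_X[OF g x_X])
    have agu: "\<alpha> g ?u \<in> carrier (fibre F (act g x))" by (rule \<alpha>_fibre[OF g x_X u])
    have "quot_action F \<alpha> ?\<psi> g (T w) = ?q (\<alpha> g ?u)"
      unfolding T_def by (rule quot_map_equivariant[OF equivariant transport_equivariant[OF a] g fibre_total[OF x_X u]])
    also have "\<dots> = ?q (?\<psi> (act g x, x) (\<alpha> g ?u))"
      by (rule quot_map_clutch[OF transport_clutching[OF a] gx x_X fibre proj_X agu, symmetric])
    also have "?\<psi> (act g x, x) (\<alpha> g ?u) = \<alpha> \<one> (lam (app (conjR a (inv \<one> \<otimes> g)) (\<kappa> ?u)))"
      by (rule transport_coset[OF a g refl one_closed act_one_x u])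
    also have "\<dots> = lam (app (conjR a g) (app a (\<kappa> (T0 w))))"
      using g c a by (simp add: \<kappa>_lam \<alpha>_one fibre_total[OF x_X] lam_V conjR_corner)
    also have "app (conjR a g) (app a (\<kappa> (T0 w))) = app (a * R g * (binv N a * a)) (\<kappa> (T0 w))"
      by (simp add: conjR_def)
    also have "\<dots> = app a (\<kappa> (T0 (\<rho> g w)))"
      using units_inv(2)[OF a] R_\<kappa>[OF g T0_V[OF w]] \<rho>V_T0[OF w] by simp
    finally show ?thesis by (simp add: T_def)
  qed
  let ?S = "inv_into (carrier W) T"
  have bij: "bij_betw T (carrier W) (carrier ?Q)" using T by (simp add: linear_iso_def)
  have "rep_iso G ?Q (quot_action F \<alpha> ?\<psi>) W \<rho>"
    unfolding rep_iso_def
  proof (intro exI[of _ ?S] conjI ballI)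
    show "linear_iso ?Q W ?S" by (rule linear_iso_inverse[OF T])
    fix g P assume g: "g \<in> carrier G" and "P \<in> carrier ?Q"
    then obtain w where w: "w \<in> carrier W" "P = T w" using bij by (auto simp: bij_betw_def)
    then show "?S (quot_action F \<alpha> ?\<psi> g P) = \<rho> g (?S P)"
      using TE[OF g w(1)] bij \<rho>_W[OF g w(1)] by (simp add: bij_betw_def)
  qed
  then show ?thesis using transport_equivariant[OF a] by (simp add: clutching_maps_onto_def)
qed

text \<open>Moving by \<open>g\<close> and clutching back to the fibre over \<open>x\<close>: for
  equivariant \<open>\<psi>\<close> this is the action on \<open>F/\<psi>\<close>, seen in that
  fibre.\<close>

definition monodromy :: "('x \<times> 'x \<Rightarrow> 'e \<Rightarrow> 'e) \<Rightarrow> 'g \<Rightarrow> 'e \<Rightarrow> 'e" where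
  "monodromy \<psi> g u = \<psi> (act g x, x) (\<alpha> g u)"

section \<open>Recovering the conjugating operator from a clutching map\<close>

lemma clutching_iso:
  assumes "pointwise_clutching_map X F \<psi>" "y \<in> X" "z \<in> X"
  shows "linear_map class_ring (fibre F y) (fibre F z) (\<psi> (y, z))"
proof -
  have "\<psi> \<in> (\<Pi>\<^sub>E (y, z)\<in>X \<times> X. iso_set (fibre F y) (fibre F z))"
    using assms by (simp add: pointwise_clutching_map_def)
  then have "\<psi> (y, z) \<in> iso_set (fibre F y) (fibre F z)" using assms by (auto dest: PiE_mem)
  then show ?thesis by (simp add: iso_set_def linear_iso_def)
qed

lemma monodromy_linear:
  assumes "pointwise_clutching_map X F \<psi>" "g \<in> carrier G"
  shows "linear_map class_ring V V (monodromy \<psi> g)"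
  unfolding monodromy_def[abs_def]
  by (rule linear_map_compose[OF \<alpha>_linear[OF assms(2) x_X] clutching_iso[OF assms(1) act_X[OF assms(2) x_X] x_X]])

lemma monodromy_transport:
  assumes a: "a \<in> units" and g: "g \<in> carrier G"
  shows "coord_op (monodromy (transport a) g) = conjR a g"
proof (rule coord_op_eqI[symmetric])
  show "linear_map class_ring V V (monodromy (transport a) g)"
    by (rule monodromy_linear[OF transport_clutching[OF a] g])
  show "conjR a g \<in> blocks N" by (rule conjR_blocks[OF a g])
  have "ent (a * binv N a) N N = 1" using units_inv(1)[OF a] by (simp add: ent_one)
  then show "ent (conjR a g) N N = 1"
    using a g units_blocks[OF a] by (simp add: conjR_def ent_mult(2)[where N = N] blocks_mult R_blocks R_NN)
  fix u assume u: "u \<in> carrier V"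
  have "monodromy (transport a) g u = \<alpha> \<one> (lam (app (conjR a (inv \<one> \<otimes> g)) (\<kappa> u)))"
    unfolding monodromy_def by (rule transport_coset[OF a g refl one_closed act_one_x u])
  then show "app (conjR a g) (\<kappa> u) = \<kappa> (monodromy (transport a) g u)"
    using a g u by (simp add: \<alpha>_one fibre_total[OF x_X] lam_V conjR_corner \<kappa>_corner \<kappa>_lam)
qed

lemma equivariant_coset:
  assumes \<psi>: "\<psi> \<in> equivariant_clutching_maps G X act F \<alpha>"
    and g: "g \<in> carrier G" and g': "g' \<in> carrier G" and u: "u \<in> carrier V"
  shows "\<psi> (act g x, act g' x) (\<alpha> g u) = \<alpha> g' (monodromy \<psi> (inv g' \<otimes> g) u)"
proof -
  have yz: "act g x \<in> X" "act g' x \<in> X" using g g' x_X act_X by auto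
  have agu: "\<alpha> g u \<in> carrier (fibre F (act g x))" by (rule \<alpha>_fibre[OF g x_X u])
  have "clutching_action G X act F \<alpha> g' \<psi> = \<psi>" using \<psi> g' by (simp add: equivariant_clutching_maps_def)
  then have "\<psi> (act g x, act g' x) (\<alpha> g u) = clutching_action G X act F \<alpha> g' \<psi> (act g x, act g' x) (\<alpha> g u)" by simp
  also have "\<dots> = \<alpha> g' (\<psi> (act (inv g') (act g x), act (inv g') (act g' x)) (\<alpha> (inv g') (\<alpha> g u)))"
    using yz agu by (simp add: clutching_action_def)
  finally show ?thesis
    using g g' x_X fibre_total[OF x_X u] by (simp add: monodromy_def act_inv act_mult \<alpha>_mult)
qed

text \<open>By equivariance every component is a translate of one that ends at \<open>x\<close>, and
  those components are given by the monodromy.\<close>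

lemma clutching_determined:
  assumes "\<psi> \<in> equivariant_clutching_maps G X act F \<alpha>" "\<psi>' \<in> equivariant_clutching_maps G X act F \<alpha>"
    and "\<And>g u. g \<in> carrier G \<Longrightarrow> u \<in> carrier V \<Longrightarrow> monodromy \<psi> g u = monodromy \<psi>' g u"
  shows "\<psi> = \<psi>'"
proof -
  have ext: "\<psi> \<in> extensional (X \<times> X)" "\<psi> (y, z) \<in> extensional (carrier (fibre F y))"
    if "\<psi> \<in> equivariant_clutching_maps G X act F \<alpha>" "y \<in> X" "z \<in> X" for \<psi> y z
  proof -
    have P: "\<psi> \<in> (\<Pi>\<^sub>E (y, z)\<in>X \<times> X. iso_set (fibre F y) (fibre F z))"
      using that(1) by (simp add: equivariant_clutching_maps_def pointwise_clutching_map_def)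
    then have "\<psi> (y, z) \<in> iso_set (fibre F y) (fibre F z)" using that by (auto dest: PiE_mem)
    then show "\<psi> \<in> extensional (X \<times> X)" "\<psi> (y, z) \<in> extensional (carrier (fibre F y))"
      using P by (auto simp: iso_set_def PiE_def)
  qed
  show ?thesis
  proof (rule extensionalityI[OF ext(1)[OF assms(1) x_X x_X] ext(1)[OF assms(2) x_X x_X]])
    fix yz assume "yz \<in> X \<times> X"
    then obtain y z where yz: "yz = (y, z)" "y \<in> X" "z \<in> X" by auto
    note ty = t[OF yz(2)] and tz = t[OF yz(3)]
    show "\<psi> yz = \<psi>' yz" unfolding yz(1)
    proof (rule extensionalityI[OF ext(2)[OF assms(1) yz(2,3)] ext(2)[OF assms(2) yz(2,3)]])
      fix u assume "u \<in> carrier (fibre F y)"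
      then obtain v where v: "v \<in> carrier V" "u = \<alpha> (t y) v" using fibre_coset[OF yz(2) _ ty] by blast
      then show "\<psi> (y, z) u = \<psi>' (y, z) u"
        using equivariant_coset[OF assms(1) ty(1) tz(1) v(1)] equivariant_coset[OF assms(2) ty(1) tz(1) v(1)]
          assms(3)[of "inv (t z) \<otimes> t y" v] ty tz by simp
    qed
  qed
qed

text \<open>Running from the fibre over \<open>x\<close> through the quotient and \<open>W\<close>
  back to the fibre gives a map \<open>b\<close> that intertwines the monodromy with
  \<open>\<rho>V\<close>. On \<open>H\<close> both actions are \<open>\<alpha>\<close>, so
  \<open>b\<close> lies in \<open>E\<close>, and its inverse is the conjugating unit.\<close>

lemma transport_surj:
  assumes \<psi>: "\<psi> \<in> clutching_maps_onto G X act F \<alpha> W \<rho>"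
  shows "\<psi> \<in> transport ` units"
proof -
  have \<psi>e: "\<psi> \<in> equivariant_clutching_maps G X act F \<alpha>" using \<psi> by (simp add: clutching_maps_onto_def)
  then have \<psi>p: "pointwise_clutching_map X F \<psi>" by (simp add: equivariant_clutching_maps_def)
  have bundle': "complex_vector_bundle (discrete_topology X) F"
    using equivariant by (simp add: equivariant_vector_bundle_def)
  let ?Q = "quot_space X F \<psi>" and ?q = "quot_map F \<psi>"
  have q: "linear_iso V ?Q ?q" by (rule quot_map_linear_iso[OF bundle' \<psi>p x_X])
  obtain T where T: "linear_iso ?Q W T" "\<And>g P. g \<in> carrier G \<Longrightarrow> P \<in> carrier ?Q \<Longrightarrow> T (quot_action F \<alpha> \<psi> g P) = \<rho> g (T P)"
    using \<psi> by (auto simp: clutching_maps_onto_def rep_iso_def)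
  define b where "b u = T0 (T (?q u))" for u
  have b: "linear_iso V V b" unfolding b_def[abs_def] by (rule linear_iso_compose[OF linear_iso_compose[OF q T(1)] T0])
  have bl: "linear_map class_ring V V b" using b by (simp add: linear_iso_def)
  have qQ: "?q u \<in> carrier ?Q" if "u \<in> carrier V" for u
    using q that by (auto simp: linear_iso_def bij_betw_def)
  have TW: "T P \<in> carrier W" if "P \<in> carrier ?Q" for P
    using T(1) that by (auto simp: linear_iso_def bij_betw_def)
  have b_equiv: "b (monodromy \<psi> g u) = \<rho>V g (b u)" if g: "g \<in> carrier G" and u: "u \<in> carrier V" for g u
  proof -
    have "?q (monodromy \<psi> g u) = ?q (\<alpha> g u)"
      unfolding monodromy_def
      by (rule quot_map_clutch[OF \<psi>p act_X[OF g x_X] x_X fibre proj_X \<alpha>_fibre[OF g x_X u]])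
    also have "\<dots> = quot_action F \<alpha> \<psi> g (?q u)"
      by (rule quot_map_equivariant[OF equivariant \<psi>e g fibre_total[OF x_X u], symmetric])
    finally show ?thesis using T(2)[OF g qQ[OF u]] by (simp add: b_def \<rho>V_T0 TW qQ u)
  qed
  have mon_H: "monodromy \<psi> h u = \<alpha> h u" if h: "h \<in> H" and u: "u \<in> carrier V" for h u
  proof -
    have "\<psi> (x, x) = (\<lambda>u\<in>carrier V. u)" using \<psi>p x_X unfolding pointwise_clutching_map_def by blast
    then show ?thesis using \<alpha>_fibre[OF H_G[OF h] x_X u] H_x[OF h] by (simp add: monodromy_def)
  qed
  let ?b = "coord_op b"
  let ?b' = "coord_op (inv_into (carrier V) b)"
  have b': "linear_map class_ring V V (inv_into (carrier V) b)" using linear_iso_inverse[OF b] by (simp add: linear_iso_def)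
  have bij: "bij_betw b (carrier V) (carrier V)" using b by (simp add: linear_iso_def)
  have one: "1 = coord_op (\<lambda>u. u)"
    using vs by (intro coord_op_eqI linear_mapI blocks_one) (auto simp: ent_one)
  have inverse: "f = 1" if "f \<in> blocks N" "ent f N N = 1" "\<And>u. u \<in> carrier V \<Longrightarrow> app f (\<kappa> u) = \<kappa> u" for f
    unfolding one using that vs by (intro coord_op_eqI linear_mapI) auto
  have bb: "?b * ?b' = 1" "?b' * ?b = 1"
    using bij linear_mapD(1)[OF b'] linear_mapD(1)[OF bl]
    by (auto intro!: inverse simp: blocks_mult coord_op_blocks bl b' ent_mult(2)[OF coord_op_blocks] ent_coord_op coord_op_\<kappa>
        bij_betw_inv_into_left bij_betw_inv_into_right)
  have bR: "?b * coord_op (monodromy \<psi> g) = R g * ?b" if g: "g \<in> carrier G" for g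
  proof -
    note m = monodromy_linear[OF \<psi>p g]
    have "?b * coord_op (monodromy \<psi> g) = coord_op (\<lambda>u. \<rho>V g (b u))"
      using bl m g by (intro coord_op_eqI linear_map_compose[OF bl \<rho>V_linear] blocks_mult coord_op_blocks)
        (auto simp: ent_mult(2)[OF coord_op_blocks] ent_coord_op coord_op_\<kappa> linear_mapD(1)[OF m] b_equiv)
    then show ?thesis using g by (simp add: R_def coord_op_mult bl \<rho>V_linear)
  qed
  have "coord_op (monodromy \<psi> h) = R h" if "h \<in> H" for h
    using that H_G by (intro coord_op_eqI[symmetric] monodromy_linear \<psi>p R_blocks R_NN) (auto simp: R_\<kappa> \<rho>V_H mon_H)
  then have "?b * R h = R h * ?b" if "h \<in> H" for h
    using bR[OF H_G[OF that]] that by simp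
  then have bE: "?b \<in> E" by (simp add: commutant_def coord_op_blocks bl)
  have b'E: "?b' \<in> E"
  proof -
    have "?b' * R h = R h * ?b'" if "h \<in> H" for h
    proof -
      have "?b' * R h = ?b' * (R h * ?b) * ?b'" using bb by (simp add: mult.assoc)
      also have "\<dots> = (?b' * ?b) * R h * ?b'" using commutantD[OF bE that] by (simp add: mult.assoc)
      finally show ?thesis using bb by simp
    qed
    then show ?thesis by (simp add: commutant_def coord_op_blocks b')
  qed
  have "bdet N ?b' * bdet N ?b = 1" using bb(2) bdet_mult[OF coord_op_blocks[OF b']] by (metis bdet_one)
  then have a: "?b' \<in> units" using b'E by (auto simp: units_def)
  have inv_b: "binv N ?b' = ?b"
    using units_inv(2)[OF a] bb(2) by (metis mult.assoc mult_1 mult_1_right)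
  have "transport ?b' = \<psi>"
  proof (rule clutching_determined[OF transport_equivariant[OF a] \<psi>e])
    fix g u assume g: "g \<in> carrier G" and u: "u \<in> carrier V"
    have "coord_op (monodromy (transport ?b') g) = ?b' * (R g * ?b)"
      using monodromy_transport[OF a g] by (simp add: conjR_def inv_b mult.assoc)
    also have "\<dots> = (?b' * ?b) * coord_op (monodromy \<psi> g)" using bR[OF g] by (simp add: mult.assoc)
    finally have "coord_op (monodromy (transport ?b') g) = coord_op (monodromy \<psi> g)" using bb by simp
    then have "\<kappa> (monodromy (transport ?b') g u) = \<kappa> (monodromy \<psi> g u)"
      using coord_op_\<kappa>[OF monodromy_linear[OF transport_clutching[OF a] g] u] coord_op_\<kappa>[OF monodromy_linear[OF \<psi>p g] u] by simp
    then show "monodromy (transport ?b') g u = monodromy \<psi> g u"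
      using lam_\<kappa> linear_mapD(1)[OF monodromy_linear[OF transport_clutching[OF a] g] u] linear_mapD(1)[OF monodromy_linear[OF \<psi>p g] u] by metis
  qed
  then show ?thesis using a by blast
qed

lemma transport_image: "transport ` units = clutching_maps_onto G X act F \<alpha> W \<rho>"
  using transport_onto transport_surj by blast

text \<open>\<open>transport a\<close> and the action \<open>conjR a\<close> determine each other,
  and two conjugates of \<open>R\<close> are equal when the conjugating units differ by a factor
  that commutes with \<open>R\<close>.\<close>

lemma transport_eq_iff:
  assumes a: "a \<in> units" and b: "b \<in> units"
  shows "transport a = transport b \<longleftrightarrow> binv N a * b \<in> D"
proof
  assume eq: "transport a = transport b"
  have "binv N a * b * R g = R g * (binv N a * b)" if g: "g \<in> carrier G" for g
  proof -
    have "conjR a g = conjR b g" using monodromy_transport[OF a g] monodromy_transport[OF b g] eq by simp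
    then have "binv N a * (conjR a g) * b = binv N a * (conjR b g) * b" by simp
    moreover have "binv N a * (conjR a g) * b = (binv N a * a) * R g * (binv N a * b)" by (simp add: conjR_def mult.assoc)
    moreover have "binv N a * (conjR b g) * b = binv N a * b * R g * (binv N b * b)" by (simp add: conjR_def mult.assoc)
    ultimately show ?thesis using units_inv a b by simp
  qed
  then show "binv N a * b \<in> D" using units_blocks a b by (simp add: commutant_def blocks_mult)
next
  assume D: "binv N a * b \<in> D"
  have "conjR a g = conjR b g" if g: "g \<in> carrier G" for g
  proof -
    have "conjR b g = (a * binv N a) * b * R g * binv N b" using units_inv(1)[OF a] by (simp add: conjR_def)
    also have "\<dots> = a * (binv N a * b * R g) * binv N b" by (simp add: mult.assoc)
    also have "\<dots> = a * R g * binv N a * (b * binv N b)" unfolding commutantD[OF D g] by (simp add: mult.assoc)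
    finally show ?thesis using units_inv(1)[OF b] by (simp add: conjR_def)
  qed
  then have "a * R (inv (t z) \<otimes> t y) * binv N a = b * R (inv (t z) \<otimes> t y) * binv N b" if "y \<in> X" "z \<in> X" for y z
    using t that by (simp add: conjR_def)
  then show "transport a = transport b"
    by (auto simp: transport_def fun_eq_iff restrict_def simp del: app_times)
qed

lemma continuous_on_transport: "continuous_on units transport"
proof (intro continuous_on_coordinatewise_then_product)
  fix yz :: "'x \<times> 'x" and u
  obtain y z where yz: "yz = (y, z)" by (cases yz)
  show "continuous_on units (\<lambda>a. transport a yz u)"
  proof (cases "y \<in> X \<and> z \<in> X \<and> u \<in> carrier (fibre F y)")
    case False
    \<comment> \<open>Off the domain the value is \<open>undefined\<close> for every operator; 0 is
      an arbitrary representative.\<close>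
    then have "(\<lambda>a. transport a yz u) = (\<lambda>a. transport 0 yz u)" by (auto simp: transport_def yz fun_eq_iff restrict_def)
    then show ?thesis by (metis continuous_on_const)
  next
    case True
    then have X: "y \<in> X" "z \<in> X" and u: "u \<in> carrier (fibre F y)" by auto
    note ty = t[OF X(1)] and tz = t[OF X(2)]
    let ?v = "\<kappa> (\<alpha> (inv (t y)) u)" and ?g = "inv (t z) \<otimes> t y"
    have v: "?v \<in> corner N" using \<alpha>_inv_fibre[OF ty(1) x_X] u ty(2) by (intro \<kappa>_corner) simp
    have "continuous_on units (\<lambda>a. a * R ?g * binv N a)"
      using ty tz units_blocks R_blocks
      by (intro continuous_on_blocks_mult[where N = N] continuous_on_id continuous_on_const continuous_on_binv)
        (auto simp: units_def intro!: blocks_mult)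
    then have "continuous_on units (\<lambda>a. app (conjR a ?g) ?v)"
      unfolding conjR_def using ty tz units_blocks R_blocks by (intro continuous_on_app[where N = N]) (auto intro!: blocks_mult)
    then have "continuous_on units (\<lambda>a. lam (app (conjR a ?g) ?v))"
      by (rule continuous_on_compose2[OF continuous_lam]) (use conjR_corner v ty tz in auto)
    then have "continuous_on units (\<lambda>a. \<alpha> (t z) (lam (app (conjR a ?g) ?v)))"
      by (rule continuous_on_compose2[OF continuous_on_\<alpha>[OF tz(1)]])
        (use conjR_corner v ty tz fibre_total[OF x_X lam_V] in auto)
    then show ?thesis using True by (simp add: transport_def yz conjR_def)
  qed
qed

text \<open>Multiplication by \<open>g\<close> permutes the cosets, and the representatives
  \<open>g \<otimes> t y\<close> and \<open>t (act g y)\<close> differ by an element of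
  \<open>H\<close>, which commutes with \<open>f\<close>.\<close>

lemma average_D:
  assumes f: "f \<in> E"
  shows "(\<Sum>y\<in>X. R (t y) * f * R (inv (t y))) \<in> D"
proof -
  let ?S = "\<Sum>y\<in>X. R (t y) * f * R (inv (t y))"
  have fb: "f \<in> blocks N" using f by (simp add: commutant_def)
  have "?S \<in> commutant N R {}"
    by (rule commutant_sum) (use t R_blocks fb in \<open>auto simp: commutant_def intro!: blocks_mult\<close>)
  then have "?S \<in> blocks N" by (simp add: commutant_def)
  moreover have "?S * R g = R g * ?S" if g: "g \<in> carrier G" for g
  proof -
    have "R g * ?S = (\<Sum>y\<in>X. R (t (act g y)) * f * R (inv (t (act g y))) * R g)"
      unfolding sum_distrib_left
    proof (rule sum.cong)
      fix y assume y: "y \<in> X"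
      have gy: "act g y \<in> X" using g y act_X by blast
      note ty = t[OF y] and tgy = t[OF gy]
      define h where "h = inv (t (act g y)) \<otimes> (g \<otimes> t y)"
      have h: "h \<in> H" unfolding h_def using g ty tgy x_X by (intro coset_H) (auto simp: act_mult)
      have hG: "h \<in> carrier G" using h H_G by blast
      have 1: "g \<otimes> t y = t (act g y) \<otimes> h" using g ty tgy by (simp add: h_def m_assoc[symmetric])
      have 2: "h \<otimes> inv (t y) = inv (t (act g y)) \<otimes> g" using g ty tgy by (simp add: h_def m_assoc)
      have "R g * (R (t y) * f * R (inv (t y))) = R (g \<otimes> t y) * f * R (inv (t y))"
        using g ty by (simp add: R_mult mult.assoc)
      also have "\<dots> = R (t (act g y)) * (R h * f) * R (inv (t y))" unfolding 1 using tgy hG by (simp add: R_mult mult.assoc)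
      also have "\<dots> = R (t (act g y)) * f * (R h * R (inv (t y)))"
        unfolding commutantD[OF f h, symmetric] by (simp only: mult.assoc)
      also have "R h * R (inv (t y)) = R (inv (t (act g y))) * R g" using 2 hG ty tgy g by (simp flip: R_mult)
      finally show "R g * (R (t y) * f * R (inv (t y))) = R (t (act g y)) * f * R (inv (t (act g y))) * R g"
        by (simp add: mult.assoc)
    qed simp
    also have "\<dots> = (\<Sum>y\<in>X. R (t y) * f * R (inv (t y)) * R g)"
    proof (rule sum.reindex_bij_betw[where h = "act g"])
      show "bij_betw (act g) X X"
        using group_action.inj_prop[OF act_action g] group_action.surj_prop[OF act_action g] by (simp add: bij_betw_def)
    qed
    finally show ?thesis by (simp add: sum_distrib_right)
  qed
  ultimately show ?thesis by (simp add: commutant_def)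
qed

text \<open>Averaging \<open>a0\<close> between the monodromy of \<open>\<psi>\<close> and
  \<open>R\<close> over the cosets yields an intertwiner that depends continuously on
  \<open>\<psi>\<close>. For \<open>\<psi> = transport a\<close> it has the form
  \<open>a * d\<close> with \<open>d\<close> in \<open>D\<close>, so it maps back to
  \<open>\<psi>\<close> wherever it is invertible, an open condition that holds at
  \<open>transport a0\<close>.\<close>

lemma local_sections:
  assumes a0: "a0 \<in> units"
  shows "\<exists>U s. openin (top_of_set (clutching_maps_onto G X act F \<alpha> W \<rho>)) U \<and> transport a0 \<in> U \<and>
    continuous_on U s \<and> s ` U \<subseteq> units \<and> (\<forall>\<psi>\<in>U. transport (s \<psi>) = \<psi>)"
proof -
  let ?S = "clutching_maps_onto G X act F \<alpha> W \<rho>"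
  \<comment> \<open>Dividing by the number of cosets makes the average at
    \<open>transport a0\<close> equal to \<open>a0\<close>.\<close>
  define c where "c = scal (1 / of_nat (card X))"
  define s where "s \<psi> = c * (\<Sum>y\<in>X. coord_op (monodromy \<psi> (t y)) * a0 * R (inv (t y)))" for \<psi>
  have Sp: "pointwise_clutching_map X F \<psi>" if "\<psi> \<in> ?S" for \<psi>
    using that by (simp add: clutching_maps_onto_def equivariant_clutching_maps_def)
  have a0b: "a0 \<in> blocks N" and a0E: "a0 \<in> E" using a0 units_blocks by (auto simp: units_def)
  have s_transport: "\<exists>d\<in>D. s (transport a) = a * d" if a: "a \<in> units" for a
  proof -
    let ?d = "c * (\<Sum>y\<in>X. R (t y) * (binv N a * a0) * R (inv (t y)))"
    have "s (transport a) = c * (\<Sum>y\<in>X. a * (R (t y) * (binv N a * a0) * R (inv (t y))))"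
      unfolding s_def using monodromy_transport[OF a t(1)] by (simp add: conjR_def mult.assoc cong: sum.cong)
    also have "\<dots> = (c * a) * (\<Sum>y\<in>X. R (t y) * (binv N a * a0) * R (inv (t y)))"
      unfolding mult.assoc[of c] by (simp only: sum_distrib_left)
    also have "c * a = a * c" unfolding c_def by (rule scal_central[symmetric])
    also have "a * c * (\<Sum>y\<in>X. R (t y) * (binv N a * a0) * R (inv (t y))) = a * ?d" by (rule mult.assoc)
    finally have "s (transport a) = a * ?d" .
    moreover have "binv N a * a0 \<in> E"
      using a a0E alg.iv_units[unfolded units_eq] by (intro commutant_mult) (auto simp: units_def)
    then have "?d \<in> D" unfolding c_def by (rule commutant_mult[OF commutant_scal average_D])
    ultimately show ?thesis by blast
  qed
  have DE: "D \<subseteq> E" using H_G by (auto simp: commutant_def)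
  have s_E: "s \<psi> \<in> E" if \<psi>: "\<psi> \<in> ?S" for \<psi>
  proof -
    obtain a where a: "a \<in> units" "\<psi> = transport a" using transport_surj[OF \<psi>] by blast
    obtain d where d: "d \<in> D" "s \<psi> = a * d" using s_transport[OF a(1)] a(2) by blast
    have "a * d \<in> E" by (rule commutant_mult) (use a(1) d(1) DE in \<open>auto simp: units_def\<close>)
    then show ?thesis by (simp add: d(2))
  qed
  have s_a0: "s (transport a0) = a0"
  proof -
    have "R (t y) * (binv N a0 * a0) * R (inv (t y)) = 1" if "y \<in> X" for y
      using t[OF that] units_inv(2)[OF a0] by (simp add: R_one flip: R_mult)
    then have "coord_op (monodromy (transport a0) (t y)) * a0 * R (inv (t y)) = a0" if "y \<in> X" for y
      unfolding monodromy_transport[OF a0 t(1)[OF that]] conjR_def using that by (metis mult.assoc mult_1_right)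
    then have "s (transport a0) = c * (\<Sum>y\<in>X. a0)" unfolding s_def by simp
    also have "(\<Sum>y\<in>X. a0) = scal (of_nat (card X)) * a0"
    proof -
      have "scal (of_nat n) = of_nat n" for n by (induction n) (simp_all add: scal_0 scal_add scal_1)
      then show ?thesis by simp
    qed
    also have "c * (scal (of_nat (card X)) * a0) = a0"
    proof -
      have "c * scal (of_nat (card X)) = 1"
        using finite_X x_X unfolding c_def by (subst scal_mult[symmetric]) (auto simp: scal_1)
      then show ?thesis by (simp flip: mult.assoc)
    qed
    finally show ?thesis .
  qed
  have mon_blocks: "coord_op (monodromy \<psi> g) \<in> blocks N" if "\<psi> \<in> ?S" "g \<in> carrier G" for \<psi> g
    by (intro coord_op_blocks monodromy_linear Sp that)
  have cont_mon: "continuous_on ?S (\<lambda>\<psi>. coord_op (monodromy \<psi> g))" if g: "g \<in> carrier G" for g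
  proof (rule continuous_on_blocks)
    show "(\<lambda>\<psi>. coord_op (monodromy \<psi> g)) ` ?S \<subseteq> blocks N" using mon_blocks g by blast
    have "ent (coord_op (monodromy \<psi> g)) N N = 1" if "\<psi> \<in> ?S" for \<psi>
      by (rule ent_coord_op(1)[OF monodromy_linear[OF Sp[OF that] g]])
    then show "continuous_on ?S (\<lambda>\<psi>. ent (coord_op (monodromy \<psi> g)) N N)" by (simp cong: continuous_on_cong)
    fix i j assume "i < N" and j: "j < N"
    let ?u = "\<alpha> g (lam (unit_seq j))"
    have "continuous_on ?S (\<lambda>\<psi>. \<psi> (act g x, x))"
      by (rule continuous_on_product_then_coordinatewise[OF continuous_on_id])
    then have "continuous_on ?S (\<lambda>\<psi>. \<psi> (act g x, x) ?u)"
      by (rule continuous_on_product_then_coordinatewise)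
    then have "continuous_on ?S (\<lambda>\<psi>. \<kappa> (\<psi> (act g x, x) ?u))"
      by (rule continuous_on_compose2[OF continuous_\<kappa>])
        (use linear_mapD(1)[OF monodromy_linear[OF Sp g] lam_V[OF unit_seq_corner[OF j]]] in \<open>auto simp: monodromy_def\<close>)
    then have "continuous_on ?S (\<lambda>\<psi>. \<kappa> (monodromy \<psi> g (lam (unit_seq j))) i)"
      unfolding monodromy_def by (rule continuous_on_product_then_coordinatewise)
    moreover have "ent (coord_op (monodromy \<psi> g)) i j = \<kappa> (monodromy \<psi> g (lam (unit_seq j))) i" if "\<psi> \<in> ?S" for \<psi>
      by (rule ent_coord_op(2)[OF monodromy_linear[OF Sp[OF that] g] j])
    ultimately show "continuous_on ?S (\<lambda>\<psi>. ent (coord_op (monodromy \<psi> g)) i j)" by (simp cong: continuous_on_cong)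
  qed
  have cont_sum: "continuous_on ?S (\<lambda>\<psi>. \<Sum>y\<in>Y. f y \<psi> :: lop)" if "\<And>y. y \<in> Y \<Longrightarrow> continuous_on ?S (f y)" "finite Y" for Y and f :: "'x \<Rightarrow> _"
    using that(2,1) by (induction Y rule: finite_induct) (auto intro: continuous_on_blocks_add)
  have cont_s: "continuous_on ?S s"
  proof -
    have "continuous_on ?S (\<lambda>\<psi>. coord_op (monodromy \<psi> (t y)) * a0 * R (inv (t y)))" if "y \<in> X" for y
      using t[OF that] mon_blocks a0b R_blocks
      by (intro continuous_on_blocks_mult[where N = N] cont_mon continuous_on_const) (auto intro!: blocks_mult)
    then have cont: "continuous_on ?S (\<lambda>\<psi>. \<Sum>y\<in>X. coord_op (monodromy \<psi> (t y)) * a0 * R (inv (t y)))"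
      using finite_X by (intro cont_sum) auto
    have ent_s: "ent (s \<psi>) i j = 1 / of_nat (card X) * ent (\<Sum>y\<in>X. coord_op (monodromy \<psi> (t y)) * a0 * R (inv (t y))) i j" for \<psi> i j
      unfolding s_def c_def by (rule ent_scal_mult)
    show ?thesis
      unfolding continuous_on_lop_iff[of _ s] ent_s
      by (intro allI continuous_on_mult continuous_on_const continuous_on_ent cont)
  qed
  let ?U = "?S \<inter> (\<lambda>\<psi>. bdet N (s \<psi>)) -` (- {0})"
  have "openin (top_of_set ?S) ?U"
    by (intro continuous_openin_preimage_gen continuous_on_bdet cont_s) auto
  moreover have "transport a0 \<in> ?U" using transport_onto[OF a0] s_a0 a0 by (simp add: units_def)
  moreover have "continuous_on ?U s" by (rule continuous_on_subset[OF cont_s]) blast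
  moreover have su: "s ` ?U \<subseteq> units" using s_E by (auto simp: units_def)
  moreover have "transport (s \<psi>) = \<psi>" if \<psi>: "\<psi> \<in> ?U" for \<psi>
  proof -
    obtain a where a: "a \<in> units" "\<psi> = transport a" using transport_surj[of \<psi>] \<psi> by blast
    obtain d where d: "d \<in> D" "s \<psi> = a * d" using s_transport[OF a(1)] a(2) by blast
    have "binv N a * s \<psi> = d" using units_inv(2)[OF a(1)] d(2) by (simp flip: mult.assoc)
    moreover have "s \<psi> \<in> units" using su \<psi> by blast
    ultimately show ?thesis using transport_eq_iff[OF a(1), of "s \<psi>"] d(1) a(2) by simp
  qed
  ultimately show ?thesis by blast
qed

theorem simply_connected_clutching: "simply_connected (clutching_maps_onto G X act F \<alpha> W \<rho>)"
proof -
  obtain B where "bounded_block_rep G N R B" by (rule bounded_block_rep)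
  then obtain I where "split_subalgebra E scal (bdet N) (binv N) D I (\<lambda>p. p)"
    using bounded_block_rep.split_commutants[of G N R B H] irreducible_subrep_H H_G by blast
  then interpret split_subalgebra E scal "bdet N" "binv N" D I "\<lambda>p. p" .
  interpret orbit_map E scal "bdet N" "binv N" D I "\<lambda>p. p" transport "clutching_maps_onto G X act F \<alpha> W \<rho>"
    by unfold_locales
      (use continuous_on_transport transport_image transport_eq_iff local_sections in \<open>simp_all add: units_eq\<close>)
  show ?thesis by (rule simply_connected_orbit)
qed

end

section \<open>Coordinates from a local trivialisation, and the conclusion\<close>

lemma corner_iff: "v \<in> corner N \<longleftrightarrow> (\<forall>i\<ge>N. v i = 0)"
  by (auto simp: corner_def app_cutop fun_eq_iff not_less)

text \<open>Elements of \<open>Cn N\<close> are \<open>undefined\<close> from index \<open>N\<close>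
  on, whereas sequences in the corner are 0 there; \<open>\<kappa>\<close> and \<open>lam\<close>
  are the trivialisation and its inverse with this default exchanged.\<close>

lemma bundle_coordinates:
  fixes F :: "('e::topological_space, 'x) vector_bundle"
  assumes F: "complex_vector_bundle (discrete_topology X) F" and x: "x \<in> X"
  obtains N \<kappa> lam where "coordinates (fibre F x) N \<kappa> lam" "continuous_on (carrier (fibre F x)) \<kappa>"
    "continuous_on (corner N) lam"
proof -
  let ?V = "fibre F x"
  have V: "carrier ?V = {u \<in> total F. proj F u = x}" "vectorspace class_ring ?V"
    using F x by (auto simp: complex_vector_bundle_def)
  obtain U N h where U: "openin (discrete_topology X) U" "x \<in> U"
    and hom: "homeomorphic_map (top_of_set {u \<in> total F. proj F u \<in> U})
          (prod_topology (subtopology (discrete_topology X) U) (Cn_topology N)) (\<lambda>u. (proj F u, h u))"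
    and lin: "\<And>y. y \<in> U \<Longrightarrow> linear_iso (fibre F y) (Cn N) h"
    using F x unfolding complex_vector_bundle_def topspace_discrete_topology by blast
  obtain k where maps: "homeomorphic_maps (top_of_set {u \<in> total F. proj F u \<in> U})
          (prod_topology (subtopology (discrete_topology X) U) (Cn_topology N)) (\<lambda>u. (proj F u, h u)) k"
    using hom homeomorphic_map_maps by blast
  let ?S = "{u \<in> total F. proj F u \<in> U}"
  let ?P = "prod_topology (subtopology (discrete_topology X) U) (Cn_topology N)"
  have cont_f: "continuous_map (top_of_set ?S) ?P (\<lambda>u. (proj F u, h u))" and cont_k: "continuous_map ?P (top_of_set ?S) k"
    and k: "\<And>u. u \<in> ?S \<Longrightarrow> k (proj F u, h u) = u"
      "\<And>w. w \<in> topspace ?P \<Longrightarrow> (proj F (k w), h (k w)) = w"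
    using maps by (auto simp: homeomorphic_maps_def)
  have hl: "linear_map class_ring ?V (Cn N) h" using lin[OF U(2)] by (simp add: linear_iso_def)
  have h_ext: "h u \<in> extensional {..<N}" if "u \<in> carrier ?V" for u
    using linear_mapD(1)[OF hl that] by (simp add: Cn_def class_ring.func_space_def PiE_def)
  define \<kappa> where "\<kappa> u i = (if i < N then h u i else 0)" for u i
  define lam where "lam v = k (x, restrict v {..<N})" for v
  have top: "(x, restrict v {..<N}) \<in> topspace ?P" for v :: "nat \<Rightarrow> complex"
    using U x by (simp add: Cn_topology_def)
  have lamP: "lam v \<in> carrier ?V" "h (lam v) = restrict v {..<N}" for v
  proof -
    have "k (x, restrict v {..<N}) \<in> ?S"
      using continuous_map_image_subset_topspace[OF cont_k] top[of v] by auto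
    then show "lam v \<in> carrier ?V" "h (lam v) = restrict v {..<N}"
      using k(2)[OF top, of v] V by (auto simp: lam_def)
  qed
  have "coordinates ?V N \<kappa> lam"
  proof (rule coordinates.intro)
    show "vectorspace class_ring ?V" by (rule V(2))
    fix u assume u: "u \<in> carrier ?V"
    show "\<kappa> u \<in> corner N" by (simp add: corner_iff \<kappa>_def)
    fix c show "\<kappa> (c \<odot>\<^bsub>?V\<^esub> u) = cscale c (\<kappa> u)"
      using linear_mapD(2)[OF hl u, of c] by (auto simp: \<kappa>_def fun_eq_iff Cn_def class_ring.func_space_def)
    have "restrict (\<kappa> u) {..<N} = h u"
      using h_ext[OF u] by (auto simp: \<kappa>_def fun_eq_iff extensional_def)
    then show "lam (\<kappa> u) = u" using k(1)[of u] u V U by (auto simp: lam_def)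
  next
    fix u v assume u: "u \<in> carrier ?V" "v \<in> carrier ?V"
    show "\<kappa> (u \<oplus>\<^bsub>?V\<^esub> v) = \<kappa> u + \<kappa> v"
      using linear_mapD(3)[OF hl u] by (auto simp: \<kappa>_def fun_eq_iff Cn_def class_ring.func_space_def)
  next
    fix w assume w: "w \<in> corner N"
    show "lam w \<in> carrier ?V" by (rule lamP)
    show "\<kappa> (lam w) = w" using w lamP(2) by (auto simp: \<kappa>_def fun_eq_iff corner_iff not_less)
  qed
  moreover have "continuous_on (carrier ?V) \<kappa>"
  proof (rule continuous_on_coordinatewise_then_product)
    fix i
    show "continuous_on (carrier ?V) (\<lambda>u. \<kappa> u i)"
    proof (cases "i < N")
      case True
      have "continuous_map (top_of_set ?S) (Cn_topology N) h"
        using continuous_map_compose[OF cont_f continuous_map_snd] by (simp add: comp_def)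
      then have "continuous_map (top_of_set ?S) euclidean (\<lambda>u. h u i)"
        using True unfolding Cn_topology_def by (auto dest: continuous_map_product_then_coordinatewise(1))
      then have "continuous_on ?S (\<lambda>u. h u i)" by simp
      then show ?thesis using True U(2) V by (auto simp: \<kappa>_def elim!: continuous_on_subset)
    qed (simp add: \<kappa>_def)
  qed
  moreover have "continuous_on (corner N) lam"
  proof -
    have "continuous_map (top_of_set (corner N)) (Cn_topology N) (\<lambda>v. restrict v {..<N})"
      unfolding Cn_topology_def
      by (rule continuous_map_coordinatewise_then_product)
        (auto intro!: continuous_on_product_then_coordinatewise continuous_on_id)
    moreover have "continuous_map (top_of_set (corner N)) (subtopology (discrete_topology X) U) (\<lambda>v. x)"
      using U x by simp
    ultimately have "continuous_map (top_of_set (corner N)) ?P (\<lambda>v. (x, restrict v {..<N}))"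
      by (simp add: continuous_map_pairedI)
    from continuous_map_compose[OF this cont_k]
    have "continuous_map (top_of_set (corner N)) (top_of_set ?S) lam" by (simp add: comp_def lam_def[abs_def])
    then show ?thesis by (simp add: continuous_map_in_subtopology)
  qed
  ultimately show ?thesis by (rule that)
qed

theorem proposition1p4:
  fixes n :: nat
    and TG :: "'g topology"
    and A :: "'g chart set"
    and G :: "'g monoid"
    and X :: "'x set"
    and act :: "'g \<Rightarrow> 'x \<Rightarrow> 'x"
    and F :: "('e::topological_space, 'x) vector_bundle"
    and \<alpha> :: "'g \<Rightarrow> 'e \<Rightarrow> 'e"
    and W :: "(complex, 'w) module"
    and \<rho> :: "'g \<Rightarrow> 'w \<Rightarrow> 'w"
    and x :: 'x
  assumes "compact_lie_group n TG A G"
    and "finite X"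
    and "continuous_action TG G (discrete_topology X) act"
    and "transitive_action G X act"
    and "equivariant_vector_bundle TG G (discrete_topology X) act F \<alpha>"
    and "representation_extension TG G X act F \<alpha> W \<rho>"
    and "x \<in> X"
    and "\<And>U. invariant_subspace G W \<rho> U \<Longrightarrow> irreducible_rep G (W\<lparr>carrier := U\<rparr>) \<rho> \<Longrightarrow>
           irreducible_rep (isotropy_group G act x) (W\<lparr>carrier := U\<rparr>) \<rho>"
  shows "simply_connected (clutching_maps_onto G X act F \<alpha> W \<rho>)"
proof -
  have "complex_vector_bundle (discrete_topology X) F"
    using assms(5) by (simp add: equivariant_vector_bundle_def)
  then obtain N \<kappa> lam where c: "coordinates (fibre F x) N \<kappa> lam" "continuous_on (carrier (fibre F x)) \<kappa>"
    "continuous_on (corner N) lam"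
    using bundle_coordinates[OF _ assms(7)] by blast
  obtain T0 where T0: "linear_iso W (fibre F x) T0"
      "\<And>g w. g \<in> stabilizer G act x \<Longrightarrow> w \<in> carrier W \<Longrightarrow> T0 (\<rho> g w) = \<alpha> g (T0 w)"
    using assms(6,7) by (fastforce simp: representation_extension_def rep_iso_def isotropy_group_def)
  have G: "group G" "topspace TG = carrier G" "compact_space TG"
    using assms(1) by (auto simp: compact_lie_group_def lie_group_def)
  have W: "group_action G (carrier W) \<rho>" "\<And>g. g \<in> carrier G \<Longrightarrow> linear_map class_ring W W (\<rho> g)"
    using assms(6) by (auto simp: representation_extension_def representation_def)
  have "clutching_coordinates TG G X act F \<alpha> W \<rho> x N \<kappa> lam T0"
    by (intro clutching_coordinates.intro clutching_coordinates_axioms.intro G c W T0 assms(2,4,5,7,8))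
  then show ?thesis by (rule clutching_coordinates.simply_connected_clutching)
qed

end
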